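(* Let $X$ be a Borel right process on $(E,d)$ that satisfies (AC), (H2a) and (H2b). Assume further that at a fixed point $x\in E$, for some $T>0$, $\alpha>0$, $\beta>1$, there exist constants $C_1,C_2>0$ such that $$p(t,x,y)\ge \frac{C_1}{t^{\alpha/\beta}}\exp\left\{-C_2\left(\frac{d(x,y)}{t^{1/\beta}}\right)^{\beta/(\beta-1)}\right\},\qquad \forall t\in(0,T],\ y\in E.$$ Let $B\subset E$ be a nearly Borel set with compact closure $\overline B$. Then for any $\delta,\rho>0$ and any $\lambda>0$ ($\lambda\ge0$ if $X$ is transient), $$\mathbb P^x[\sigma_B\le t]\ge \frac{\nu^{(\lambda)}_{B_{x,\delta}}(\overline B_{x,\delta})}{e^{\lambda T}}\cdot\frac{C_1C_3}{t^{(\alpha-\beta)/\beta}}\exp\left\{-(1+\rho)C_2\left(\frac{\widetilde d(x,B)+\delta}{t^{1/\beta}}\right)^{\beta/(\beta-1)}\right\},\qquad 0<t\le T,$$ where $B_{x,\delta}:=\{y\in B:d(y,x)\le\widetilde d(x,B)+\delta\}$, $\overline B_{x,\delta}$ is its closure, $\nu^{(\lambda)}_{B_{x,\delta}}$ is the measure defined in the context, $C_1$ and $C_2$ are as in the lower bound for $p$, and $C_3=(\beta-1)\rho\cdot\min\{(1+\rho)^{\alpha-\beta-\alpha/\beta},1\}>0$ is a constant depending on $\alpha,\beta,\rho$.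
   Context: $E$ is a Lusin topological space whose topology is induced by the metric $d$; $\mu$ is a $\sigma$-finite Borel measure on $E$ with full support; $X=(\Omega,\mathscr F,\mathscr F_t,X_t,\theta_t,\mathbb P^x)$ is a Borel right process on $E$ with transition function $(P_t)_{t\ge 0}$. (AC): $P_t(x,\cdot)$ is absolutely continuous with respect to $\mu$ for every $t>0$, $x\in E$. Under (AC) there is a nonnegative Borel function $p(t,x,y)$ on $(0,\infty)\times E\times E$, the transition density function, with $P_tf(x)=\int_E p(t,x,y)f(y)\,\mu(dy)$ for all bounded Borel $f$. For $\lambda\ge0$, $u_\lambda(x,y):=\int_0^\infty e^{-\lambda t}p(t,x,y)\,dt$. $X$ is transient if there is a strictly positive universally measurable $h$ on $E$ with $\int_E u_0(x,y)h(y)\mu(dy)<\infty$ for all $x\in E$. (H2a): There is another Borel right process $\widehat X$ on $E$, with transition function $(\widehat P_t)_{t\ge0}$, that satisfies (AC) with respect to $\mu$ and $\int_E P_tf\,g\,d\mu=\int_E f\,\widehat P_tg\,d\mu$ for all bounded Borel $f,g$ (then $\widehat P_t$ has transition density $\widehat p(t,x,y)=p(t,y,x)$). (H2b): $(E,d)$ is a locally compact separable metric space, $\mu$ is a Radon measure on $E$, and for $\lambda>0$ ($\lambda\ge0$ if $X$ is transient) and every $f\in C_c(E)$ (continuous with compact support), $y\mapsto\int_E u_\lambda(x,y)f(x)\,\mu(dx)$ is continuous on $E$. Nearly Borel sets $\mathscr B^n(E)$: $B\subset E$ such that for each probability measure $\nu$ on $E$ there are Borel $B_1\subset B\subset B_2$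 with $\mathbb P^\nu(X_t\in B_2\setminus B_1\text{ for some }t\ge0)=0$. $\sigma_B:=\inf\{t>0:X_t\in B\}$, $\inf\emptyset=\infty$. $\mathscr N:=\{N\in\mathscr B^n(E):\mathbb P^y[\sigma_N<\infty]=0\ \forall y\in E\}$; $d(x,B):=\inf\{d(x,y):y\in B\}$ (with $d(x,\emptyset)=\infty$); $\widetilde d(x,B):=\sup_{N\in\mathscr N}d(x,B\setminus N)$. For $A\in\mathscr B^n(E)$ with compact closure and $\lambda>0$ ($\lambda\ge0$ if $X$ is transient), $\nu^{(\lambda)}_A$ denotes the unique positive measure on $E$ with $\mathbb E^y[e^{-\lambda\sigma_A};\sigma_A<\infty]=\int_E u_\lambda(y,z)\,\nu^{(\lambda)}_A(dz)$ for all $y\in E$; it exists under (AC), (H2a), (H2b), and is finite and concentrated on $\overline A$. *)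

theory Defs
  imports "HOL-Probability.Probability"
begin

section \<open>The state space\<close>

text \<open>
  The state space \<open>E\<close> is a type \<open>'e\<close> of class \<open>metric_space\<close>, with \<open>d = dist\<close>.

  A Lusin space is one that is homeomorphic to a Borel subset of a compact metric space. Every
  compact metric space embeds as a compact set into the Hilbert cube, hence into
  \<open>nat \<Rightarrow> real\<close> with the product topology, so it suffices to let \<open>K\<close> range over the
  compact subsets of the latter.
\<close>
definition lusin_space :: "'e topology \<Rightarrow> bool" where
  "lusin_space Y \<longleftrightarrow>
     (\<exists>(K :: (nat \<Rightarrow> real) set) S. compact K \<and> S \<subseteq> K \<and> S \<in> sets borel \<and>
        Y homeomorphic_space (top_of_set S))"

definition full_support :: "'e::topological_space measure \<Rightarrow> bool" where
  "full_support \<mu> \<longleftrightarrow> (\<forall>U. open U \<and> U \<noteq> {} \<longrightarrow> 0 < emeasure \<mu> U)"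

definition radon_measure :: "'e::topological_space measure \<Rightarrow> bool" where
  "radon_measure \<mu> \<longleftrightarrow> sets \<mu> = sets borel \<and>
     (\<forall>K. compact K \<longrightarrow> emeasure \<mu> K < \<infinity>) \<and>
     (\<forall>A\<in>sets borel. emeasure \<mu> A = (SUP K\<in>{K. compact K \<and> K \<subseteq> A}. emeasure \<mu> K))"

definition universally_measurable :: "('e::topological_space \<Rightarrow> real) \<Rightarrow> bool" where
  "universally_measurable h \<longleftrightarrow>
     (\<forall>\<nu>. sets \<nu> = sets borel \<and> finite_measure \<nu> \<longrightarrow> h \<in> borel_measurable (completion \<nu>))"

section \<open>Borel right processes\<close>

text \<open>
  A process is given by \<open>X t \<omega> :: 'e option\<close> for \<open>t \<ge> 0\<close>, where \<open>None\<close> is the cemetery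
  \<open>\<Delta>\<close>, together with the laws \<open>P y\<close>, \<open>y \<in> E\<close>, on the sample space \<open>\<Omega> = UNIV :: 'w set\<close>.
  Functions on \<open>E\<close> are extended by \<open>0\<close> at \<open>\<Delta>\<close>. Values of \<open>X\<close> at negative times play no role.

  \<open>raw_filtration X t\<close> is the \<open>\<sigma>\<close>-algebra generated by \<open>X s\<close>, \<open>s \<le> t\<close>. Filtrations are
  indexed by \<open>[0,\<infinity>]\<close>, so that \<open>raw_filtration X \<infinity>\<close> is generated by the whole process; it is the
  \<open>\<sigma>\<close>-algebra on which the laws are defined.
\<close>
definition raw_filtration :: "(real \<Rightarrow> 'w \<Rightarrow> 'e::topological_space option) \<Rightarrow> ennreal \<Rightarrow> 'w measure"
  where
  "raw_filtration X t =
     sigma UNIV {X s -` (Some ` A) | s A. 0 \<le> s \<and> ennreal s \<le> t \<and> A \<in> sets borel}"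

text \<open>The law \<open>\<integral> P y \<nu>(dy)\<close> of the process with initial distribution \<open>\<nu>\<close>.\<close>
definition law :: "('e \<Rightarrow> 'w measure) \<Rightarrow> 'e measure \<Rightarrow> 'w measure" where
  "law P \<nu> = Giry_Monad.bind \<nu> P"

text \<open>
  The usual augmentation: \<open>A\<close> belongs to it iff for every initial distribution \<open>\<nu>\<close> it differs
  from an element of the raw \<open>\<sigma>\<close>-algebra by a subset of a \<open>law P \<nu>\<close>-null set.
\<close>
definition aug_filtration ::
  "(real \<Rightarrow> 'w \<Rightarrow> 'e::topological_space option) \<Rightarrow> ('e \<Rightarrow> 'w measure) \<Rightarrow> ennreal \<Rightarrow> 'w measure" where
  "aug_filtration X P t = sigma UNIV
     {A. \<forall>\<nu>\<in>space (prob_algebra borel). \<exists>A'\<in>sets (raw_filtration X t).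
           (A - A') \<union> (A' - A) \<in> null_sets (completion (law P \<nu>))}"

text \<open>\<open>transition X P t y\<close> is the (sub-probability) measure \<open>P\<^sub>t(y,\<cdot>)\<close> on \<open>E\<close>.\<close>
definition transition ::
  "(real \<Rightarrow> 'w \<Rightarrow> 'e::topological_space option) \<Rightarrow> ('e \<Rightarrow> 'w measure) \<Rightarrow> real \<Rightarrow> 'e \<Rightarrow> 'e measure" where
  "transition X P t y =
     distr (restrict_space (P y) {\<omega>. X t \<omega> \<noteq> None}) borel (\<lambda>\<omega>. the (X t \<omega>))"

text \<open>
  \<open>P\<^sup>\<nu>(X\<^sub>\<tau>\<^sub>+\<^sub>s \<in> A | F\<^sub>\<tau>) = P\<^sub>s(X\<^sub>\<tau>, A)\<close> on \<open>{\<tau> < \<infinity>}\<close>, for all initial distributions \<open>\<nu>\<close>, all stopping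
  times \<open>\<tau>\<close> of the augmented filtration and all Borel \<open>A \<subseteq> E\<close>, integrated over the events \<open>\<Lambda>\<close>
  of \<open>F\<^sub>\<tau>\<close>.
\<close>
definition strong_markov ::
  "(real \<Rightarrow> 'w \<Rightarrow> 'e::topological_space option) \<Rightarrow> ('e \<Rightarrow> 'w measure) \<Rightarrow> bool" where
  "strong_markov X P \<longleftrightarrow>
     (\<forall>\<nu>\<in>space (prob_algebra borel). \<forall>\<tau>. stopping_time (aug_filtration X P) \<tau> \<longrightarrow>
       (\<forall>\<Lambda>\<in>sets (filtration.pre_sigma UNIV (aug_filtration X P) \<tau>). \<forall>s\<ge>0. \<forall>A\<in>sets borel.
          emeasure (completion (law P \<nu>))
            {\<omega>\<in>\<Lambda>. \<tau> \<omega> < \<infinity> \<and> X (enn2real (\<tau> \<omega>) + s) \<omega> \<in> Some ` A} =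
          (\<integral>\<^sup>+\<omega>. indicator {\<omega>\<in>\<Lambda>. \<tau> \<omega> < \<infinity>} \<omega> *
             (case X (enn2real (\<tau> \<omega>)) \<omega> of None \<Rightarrow> 0 | Some y \<Rightarrow> emeasure (transition X P s y) A)
           \<partial>completion (law P \<nu>))))"

text \<open>
  A Borel right process on a Lusin space: a normal, right continuous process with shift operators
  \<open>\<theta>\<close>, whose laws depend on the starting point in a Borel measurable way, whose augmented
  filtration is right continuous, and which has the strong Markov property. Since \<open>\<Delta>\<close> is
  absorbing, right continuity in \<open>E \<union> {\<Delta>}\<close> is a condition only at the times where the path is
  in \<open>E\<close>, whatever topology is chosen at \<open>\<Delta>\<close>.
  For Borel semigroups this is equivalent to the definition of right processes by the almost sure
  right continuity of \<open>f(X\<^sub>t)\<close> for \<open>\<alpha>\<close>-excessive functions \<open>f\<close>.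
\<close>
locale borel_right_process =
  fixes X :: "real \<Rightarrow> 'w \<Rightarrow> 'e::metric_space option"
    and \<theta> :: "real \<Rightarrow> 'w \<Rightarrow> 'w"
    and P :: "'e \<Rightarrow> 'w measure"
  assumes lusin: "lusin_space (euclidean :: 'e topology)"
    and laws: "P \<in> borel \<rightarrow>\<^sub>M prob_algebra (raw_filtration X \<infinity>)"
    and normal: "AE \<omega> in P y. X 0 \<omega> = Some y"
    and absorbing: "0 \<le> s \<Longrightarrow> s \<le> t \<Longrightarrow> X s \<omega> = None \<Longrightarrow> X t \<omega> = None"
    and right_continuous_paths:
      "0 \<le> t \<Longrightarrow> X t \<omega> = Some y \<Longrightarrow> open U \<Longrightarrow> y \<in> U \<Longrightarrow>
         \<forall>\<^sub>F s in at_right t. X s \<omega> \<in> Some ` U"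
    and shift: "0 \<le> s \<Longrightarrow> 0 \<le> t \<Longrightarrow> X s (\<theta> t \<omega>) = X (s + t) \<omega>"
    and right_continuous_filtration:
      "t < \<infinity> \<Longrightarrow> (\<Inter>s\<in>{t<..}. sets (aug_filtration X P s)) = sets (aug_filtration X P t)"
    and strong_markov: "strong_markov X P"

section \<open>Densities, resolvent densities, transience, duality\<close>

definition abs_cont_process ::
  "'e::topological_space measure \<Rightarrow> (real \<Rightarrow> 'w \<Rightarrow> 'e option) \<Rightarrow> ('e \<Rightarrow> 'w measure) \<Rightarrow> bool" where
  "abs_cont_process \<mu> X P \<longleftrightarrow> (\<forall>t>0. \<forall>y. absolutely_continuous \<mu> (transition X P t y))"

text \<open>
  A density of \<open>P\<^sub>t(y,\<cdot>)\<close> is determined only up to \<open>\<mu>\<close>-null sets. In duality, the version is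
  understood to be such that \<open>p(t,y,z)\<close> is a density of the given process and \<open>p(t,z,y)\<close> one of
  the dual process, i.e. \<open>transition_density\<close> holds for \<open>p\<close> and for its transpose.
\<close>
definition transition_density ::
  "'e::topological_space measure \<Rightarrow> (real \<Rightarrow> 'w \<Rightarrow> 'e option) \<Rightarrow> ('e \<Rightarrow> 'w measure)
     \<Rightarrow> (real \<Rightarrow> 'e \<Rightarrow> 'e \<Rightarrow> ennreal) \<Rightarrow> bool" where
  "transition_density \<mu> X P p \<longleftrightarrow>
     (\<lambda>(t, y, z). p t y z) \<in>
        borel_measurable (restrict_space borel {0<..} \<Otimes>\<^sub>M (borel \<Otimes>\<^sub>M borel)) \<and>
     (\<forall>t>0. \<forall>y. transition X P t y = density \<mu> (p t y))"

definition resolvent_density ::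
  "(real \<Rightarrow> 'e \<Rightarrow> 'e \<Rightarrow> ennreal) \<Rightarrow> real \<Rightarrow> 'e \<Rightarrow> 'e \<Rightarrow> ennreal" where
  "resolvent_density p l y z = (\<integral>\<^sup>+t\<in>{0<..}. ennreal (exp (- l * t)) * p t y z \<partial>lborel)"

definition transient ::
  "'e::topological_space measure \<Rightarrow> (real \<Rightarrow> 'e \<Rightarrow> 'e \<Rightarrow> ennreal) \<Rightarrow> bool" where
  "transient \<mu> p \<longleftrightarrow>
     (\<exists>h. universally_measurable h \<and> (\<forall>z. 0 < h z) \<and>
        (\<forall>y. (\<integral>\<^sup>+z. resolvent_density p 0 y z * ennreal (h z) \<partial>completion \<mu>) < \<infinity>))"

text \<open>\<open>\<lambda> > 0\<close>, or \<open>\<lambda> \<ge> 0\<close> in the transient case.\<close>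
definition admissible_rate ::
  "'e::topological_space measure \<Rightarrow> (real \<Rightarrow> 'e \<Rightarrow> 'e \<Rightarrow> ennreal) \<Rightarrow> real \<Rightarrow> bool" where
  "admissible_rate \<mu> p l \<longleftrightarrow> 0 < l \<or> (0 \<le> l \<and> transient \<mu> p)"

text \<open>
  \<open>\<integral> (P\<^sub>t f) g d\<mu> = \<integral> f (Q\<^sub>t g) d\<mu>\<close>. As \<open>\<mu>\<close> may be infinite, the identity is meant for nonnegative
  bounded Borel functions, with values in \<open>[0,\<infinity>]\<close>.
\<close>
definition in_duality ::
  "'e::topological_space measure \<Rightarrow> (real \<Rightarrow> 'w \<Rightarrow> 'e option) \<Rightarrow> ('e \<Rightarrow> 'w measure)
     \<Rightarrow> (real \<Rightarrow> 'v \<Rightarrow> 'e option) \<Rightarrow> ('e \<Rightarrow> 'v measure) \<Rightarrow> bool" where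
  "in_duality \<mu> X P X' P' \<longleftrightarrow>
     (\<forall>t\<ge>0. \<forall>f g :: 'e \<Rightarrow> real.
        f \<in> borel_measurable borel \<and> bounded (range f) \<and> (\<forall>y. 0 \<le> f y) \<and>
        g \<in> borel_measurable borel \<and> bounded (range g) \<and> (\<forall>y. 0 \<le> g y) \<longrightarrow>
        (\<integral>\<^sup>+y. (\<integral>\<^sup>+z. f z \<partial>transition X P t y) * g y \<partial>\<mu>) =
        (\<integral>\<^sup>+y. f y * (\<integral>\<^sup>+z. g z \<partial>transition X' P' t y) \<partial>\<mu>))"

text \<open>
  Finiteness of the integrals is implicit in the continuity requirement; it has to be spelt out
  since the Bochner integral of a non-integrable function is \<open>0\<close>.
\<close>
definition co_resolvent_continuous ::
  "'e::metric_space measure \<Rightarrow> (real \<Rightarrow> 'e \<Rightarrow> 'e \<Rightarrow> ennreal) \<Rightarrow> bool" where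
  "co_resolvent_continuous \<mu> p \<longleftrightarrow>
     (\<forall>l f. admissible_rate \<mu> p l \<and> continuous_on UNIV (f :: 'e \<Rightarrow> real) \<and>
        compact (closure {y. f y \<noteq> 0}) \<longrightarrow>
        (\<forall>z. (\<integral>\<^sup>+y. resolvent_density p l y z * ennreal \<bar>f y\<bar> \<partial>\<mu>) < \<infinity>) \<and>
        continuous_on UNIV (\<lambda>z. \<integral>y. enn2real (resolvent_density p l y z) * f y \<partial>\<mu>))"

section \<open>Hitting times, exceptional sets, equilibrium measures\<close>

definition nearly_borel ::
  "(real \<Rightarrow> 'w \<Rightarrow> 'e::topological_space option) \<Rightarrow> ('e \<Rightarrow> 'w measure) \<Rightarrow> 'e set \<Rightarrow> bool" where
  "nearly_borel X P B \<longleftrightarrow>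
     (\<forall>\<nu>\<in>space (prob_algebra borel). \<exists>B1\<in>sets borel. \<exists>B2\<in>sets borel. B1 \<subseteq> B \<and> B \<subseteq> B2 \<and>
        (AE \<omega> in law P \<nu>. \<not> (\<exists>t\<ge>0. X t \<omega> \<in> Some ` (B2 - B1))))"

definition hitting_time :: "(real \<Rightarrow> 'w \<Rightarrow> 'e option) \<Rightarrow> 'e set \<Rightarrow> 'w \<Rightarrow> ennreal" where
  "hitting_time X B \<omega> = Inf (ennreal ` {t. 0 < t \<and> X t \<omega> \<in> Some ` B})"

definition exceptional_sets ::
  "(real \<Rightarrow> 'w \<Rightarrow> 'e::topological_space option) \<Rightarrow> ('e \<Rightarrow> 'w measure) \<Rightarrow> 'e set set" where
  "exceptional_sets X P =
     {N. nearly_borel X P N \<and> (\<forall>y. AE \<omega> in P y. \<not> hitting_time X N \<omega> < \<infinity>)}"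

definition set_distance :: "'e::metric_space \<Rightarrow> 'e set \<Rightarrow> ennreal" where
  "set_distance x B = (INF y\<in>B. ennreal (dist x y))"

definition essential_distance ::
  "(real \<Rightarrow> 'w \<Rightarrow> 'e::metric_space option) \<Rightarrow> ('e \<Rightarrow> 'w measure) \<Rightarrow> 'e \<Rightarrow> 'e set \<Rightarrow> ennreal" where
  "essential_distance X P x B = (SUP N\<in>exceptional_sets X P. set_distance x (B - N))"

text \<open>
  \<open>equilibrium_measure X P p \<lambda> A \<nu>\<close>: the measure \<open>\<nu>\<close> has the property that characterises
  \<open>\<nu>\<^sub>A\<^sup>(\<^sup>\<lambda>\<^sup>)\<close>. The completion makes \<open>P y\<close> act on the events given by hitting times.
\<close>
definition equilibrium_measure ::
  "(real \<Rightarrow> 'w \<Rightarrow> 'e::topological_space option) \<Rightarrow> ('e \<Rightarrow> 'w measure)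
     \<Rightarrow> (real \<Rightarrow> 'e \<Rightarrow> 'e \<Rightarrow> ennreal) \<Rightarrow> real \<Rightarrow> 'e set \<Rightarrow> 'e measure \<Rightarrow> bool" where
  "equilibrium_measure X P p l A \<nu> \<longleftrightarrow> sets \<nu> = sets borel \<and>
     (\<forall>y. (\<integral>\<^sup>+\<omega>\<in>{\<omega>. hitting_time X A \<omega> < \<infinity>}.
              ennreal (exp (- l * enn2real (hitting_time X A \<omega>))) \<partial>completion (P y)) =
          (\<integral>\<^sup>+z. resolvent_density p l y z \<partial>\<nu>))"

text \<open>The part of \<open>B\<close> within distance \<open>essential_distance + \<delta>\<close> of \<open>x\<close>.\<close>
definition near_part ::
  "(real \<Rightarrow> 'w \<Rightarrow> 'e::metric_space option) \<Rightarrow> ('e \<Rightarrow> 'w measure) \<Rightarrow> 'e set \<Rightarrow> 'e \<Rightarrow> real \<Rightarrow> 'e set" where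
  "near_part X P B x \<delta> =
     {y\<in>B. ennreal (dist y x) \<le> essential_distance X P x B + ennreal \<delta>}"

end

theory Submission
  imports Defs
begin

text \<open>
  Let \<open>A\<close> be the near part of \<open>B\<close>, \<open>v = E[exp(-l \<sigma>\<^sub>A)] = \<integral> u\<^sub>l(\<cdot>,z) \<nu>(dz)\<close>, and let \<open>\<sigma>\<^sup>r\<close> be the first
  hitting time of \<open>A\<close> after time \<open>r\<close>. For \<open>\<epsilon> < t\<close> the times \<open>\<sigma>\<^sup>\<epsilon>\<close> and \<open>\<sigma>\<^sup>t\<close> differ only on
  \<open>{\<sigma>\<^sub>A \<le> t}\<close>, so that by the Markov property
  \<open>P\<^sup>x[\<sigma>\<^sub>A \<le> t] \<ge> e\<^bsup>-l\<epsilon>\<^esup> P\<^sub>\<epsilon>v(x) - e\<^bsup>-lt\<^esup> P\<^sub>tv(x) = \<integral>\<integral>\<^bsub>\<epsilon>\<^esub>\<^bsup>t\<^esup> e\<^bsup>-ls\<^esup> p(s,x,z) ds \<nu>(dz)\<close>,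
  and the lower bound on \<open>p\<close> is inserted with \<open>\<epsilon> = t (1+\<rho>)\<^bsup>1-\<beta>\<^esup>\<close>.

  Two points need care. Hitting times are measurable only with respect to completions, which rests
  on the measurable projection theorem. And \<open>p\<close> has to be replaced by a version that satisfies the
  Chapman-Kolmogorov equation everywhere, to which the lower bound carries over by Fatou's lemma and
  the right continuity of the dual process.
\<close>

section \<open>Souslin sets and measurable projection\<close>

text \<open>The cut at \<open>\<epsilon>\<close> fixes the constants. The exponent in the bound on
  \<open>p\<close> depends on time through \<open>s^(-1/(\<beta>-1))\<close>, so at
  \<open>s = t (1+\<rho>)^(1-\<beta>)\<close> it is exactly \<open>1+\<rho>\<close> times its value
  at \<open>t\<close>. On the interval from \<open>\<epsilon>\<close> to \<open>t\<close> the
  exponential can therefore be frozen at the loss that the theorem admits, and \<open>C3\<close> is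
  what the integral of \<open>s^(-\<alpha>/\<beta>)\<close> over this interval retains. A positive
  \<open>\<epsilon>\<close> is needed anyway, since the good version of \<open>p\<close> arises by
  composing densities at an intermediate time.

  The completion in which a hitting time is measurable depends on the initial law, while the Markov
  property mixes the laws \<open>P y\<close> over \<open>P_t(x,dy)\<close>. A measurable version has
  to be chosen for one initial law that dominates this mixture.

  Exchanging integrals needs a sigma-finite equilibrium measure. This is extracted from the
  finiteness of its potential at \<open>x\<close> and the positivity of the kernel there.\<close>

definition finitely_dependent :: "((nat \<Rightarrow> nat) \<Rightarrow> 'a) \<Rightarrow> bool" where
  "finitely_dependent G \<longleftrightarrow>
     (\<exists>S. finite S \<and> (\<forall>f g. (\<forall>i\<in>S. f i = g i) \<longrightarrow> G f = G g))"

text \<open>The Souslin operation. Dependence on finitely many coordinates replaces the usual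
  indexing by initial segments of \<open>f\<close>, so that branches can be recoded through pairings
  without keeping track of lengths.\<close>

definition souslin_scheme :: "'a set set \<Rightarrow> 'a set \<Rightarrow> (nat \<Rightarrow> (nat \<Rightarrow> nat) \<Rightarrow> 'a set) \<Rightarrow> bool" where
  "souslin_scheme R H G \<longleftrightarrow> (\<forall>n f. G n f \<in> R) \<and> (\<forall>n. finitely_dependent (G n)) \<and>
     H = {z. \<exists>f. \<forall>n. z \<in> G n f}"

definition souslin :: "'a set set \<Rightarrow> 'a set \<Rightarrow> bool" where
  "souslin R H \<longleftrightarrow> (\<exists>G. souslin_scheme R H G)"

section \<open>Closure properties of the Souslin operation\<close>

lemma finitely_dependent_compose:
  assumes "finitely_dependent G"
  shows "finitely_dependent (\<lambda>f. G (\<lambda>i. f (e i)))"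
proof -
  obtain S where S: "finite S" "\<And>f g. (\<forall>i\<in>S. f i = g i) \<Longrightarrow> G f = G g"
    using assms unfolding finitely_dependent_def by metis
  show ?thesis unfolding finitely_dependent_def
    by (rule exI[of _ "e ` S"]) (use S in auto)
qed

lemma finitely_dependent_const: "finitely_dependent (\<lambda>f. c)"
  unfolding finitely_dependent_def by (rule exI[of _ "{}"]) auto

lemma finitely_dependent_apply:
  "finitely_dependent G \<Longrightarrow> finitely_dependent (\<lambda>f. h (G f))"
  unfolding finitely_dependent_def by metis

lemma finitely_dependent_INT:
  assumes "finite J" "\<And>j. j \<in> J \<Longrightarrow> finitely_dependent (G j)"
  shows "finitely_dependent (\<lambda>f. \<Inter>j\<in>J. G j f)"
proof -
  from assms(2) have "\<forall>j\<in>J. \<exists>S. finite S \<and> (\<forall>f g. (\<forall>i\<in>S. f i = g i) \<longrightarrow> G j f = G j g)"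
    unfolding finitely_dependent_def by blast
  then obtain S where S: "\<And>j. j \<in> J \<Longrightarrow> finite (S j)"
      "\<And>j f g. j \<in> J \<Longrightarrow> (\<forall>i\<in>S j. f i = g i) \<Longrightarrow> G j f = G j g"
    by metis
  show ?thesis unfolding finitely_dependent_def
  proof (intro exI[of _ "\<Union>j\<in>J. S j"] conjI allI impI)
    show "finite (\<Union>j\<in>J. S j)" using assms(1) S(1) by auto
  next
    fix f g :: "nat \<Rightarrow> nat" assume "\<forall>i\<in>\<Union>j\<in>J. S j. f i = g i"
    then show "(\<Inter>j\<in>J. G j f) = (\<Inter>j\<in>J. G j g)"
      using S(2) by (intro INF_cong refl) auto
  qed
qed

lemma souslin_basic:
  assumes "A \<in> R" shows "souslin R A"
  unfolding souslin_def souslin_scheme_def using assms finitely_dependent_const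
  by (intro exI[of _ "\<lambda>_ _. A"]) auto

lemma souslinI:
  assumes "\<And>n f. G n f \<in> R" "\<And>n. finitely_dependent (G n)"
    "H = {z. \<exists>f. \<forall>n::nat. z \<in> G n f}"
  shows "souslin R H"
  unfolding souslin_def souslin_scheme_def by (rule exI[of _ G]) (use assms in auto)

lemma finitely_dependentE:
  assumes "finitely_dependent G"
  obtains S where "finite S" "\<And>f g. (\<forall>i\<in>S. f i = g i) \<Longrightarrow> G f = G g"
  using assms unfolding finitely_dependent_def by (elim exE conjE) (rule that; auto)

text \<open>Countably many branches are packed into one: coordinate
  \<open>prod_encode (k, i)\<close> stores entry \<open>i\<close> of the branch for
  \<open>H k\<close>, and level \<open>m\<close> decodes to a pair of a set and one of its
  levels.\<close>

lemma souslin_INT: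
  fixes H :: "nat \<Rightarrow> 'a set"
  assumes "\<And>k. souslin R (H k)"
  shows "souslin R (\<Inter>k. H k)"
proof -
  from assms obtain G where "\<And>k. souslin_scheme R (H k) (G k)"
    unfolding souslin_def by metis
  then have G: "\<And>k n f. G k n f \<in> R" "\<And>k n. finitely_dependent (G k n)"
     "\<And>k. H k = {z. \<exists>f. \<forall>n. z \<in> G k n f}"
    unfolding souslin_scheme_def by auto
  define G' where "G' m f =
    G (fst (prod_decode m)) (snd (prod_decode m)) (\<lambda>i. f (prod_encode (fst (prod_decode m), i)))"
    for m f
  have "(\<Inter>k. H k) = {z. \<exists>f. \<forall>m. z \<in> G' m f}"
  proof (intro set_eqI iffI)
    fix z assume "z \<in> (\<Inter>k. H k)"
    then have "\<forall>k. \<exists>f. \<forall>n. z \<in> G k n f" using G(3) by auto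
    then obtain f where f: "\<And>k n. z \<in> G k n (f k)" by metis
    have "\<forall>m. z \<in> G' m (\<lambda>i. f (fst (prod_decode i)) (snd (prod_decode i)))"
      unfolding G'_def using f by simp
    then show "z \<in> {z. \<exists>f. \<forall>m. z \<in> G' m f}" by blast
  next
    fix z assume "z \<in> {z. \<exists>f. \<forall>m. z \<in> G' m f}"
    then obtain f where f: "\<And>m. z \<in> G' m f" by blast
    have "z \<in> G k n (\<lambda>i. f (prod_encode (k, i)))" for k n
      using f[of "prod_encode (k, n)"] unfolding G'_def by simp
    then show "z \<in> (\<Inter>k. H k)" unfolding G(3) by blast
  qed
  moreover have "finitely_dependent (G' m)" for m
    unfolding G'_def[abs_def] by (rule finitely_dependent_compose[OF G(2)])
  moreover have "G' m f \<in> R" for m f unfolding G'_def by (rule G)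
  ultimately show ?thesis by (intro souslinI[of G'])
qed

text \<open>Entry \<open>f 0\<close> selects the set and the remaining entries form the branch.
  Levels that belong to other sets become \<open>UNIV\<close> and impose nothing, hence the
  hypothesis on \<open>UNIV\<close>.\<close>

lemma souslin_UN:
  fixes H :: "nat \<Rightarrow> 'a set"
  assumes "\<And>k. souslin R (H k)" "UNIV \<in> R"
  shows "souslin R (\<Union>k. H k)"
proof -
  from assms(1) obtain G where "\<And>k. souslin_scheme R (H k) (G k)"
    unfolding souslin_def by metis
  then have G: "\<And>k n f. G k n f \<in> R" "\<And>k n. finitely_dependent (G k n)"
     "\<And>k. H k = {z. \<exists>f. \<forall>n. z \<in> G k n f}"
    unfolding souslin_scheme_def by auto
  define G' where "G' m f =
    (if f 0 = fst (prod_decode m) then G (fst (prod_decode m)) (snd (prod_decode m)) (\<lambda>i. f (Suc i))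
     else UNIV)" for m f
  have "(\<Union>k. H k) = {z. \<exists>f. \<forall>m. z \<in> G' m f}"
  proof (intro set_eqI iffI)
    fix z assume "z \<in> (\<Union>k. H k)"
    then obtain k f where f: "\<And>n. z \<in> G k n f" using G(3) by auto
    have "\<forall>m. z \<in> G' m (\<lambda>i. case i of 0 \<Rightarrow> k | Suc j \<Rightarrow> f j)"
      unfolding G'_def using f by auto
    then show "z \<in> {z. \<exists>f. \<forall>m. z \<in> G' m f}" by blast
  next
    fix z assume "z \<in> {z. \<exists>f. \<forall>m. z \<in> G' m f}"
    then obtain f where f: "\<And>m. z \<in> G' m f" by blast
    have "z \<in> G (f 0) n (\<lambda>i. f (Suc i))" for n
      using f[of "prod_encode (f 0, n)"] unfolding G'_def by simp
    then show "z \<in> (\<Union>k. H k)" unfolding G(3) by blast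
  qed
  moreover have "finitely_dependent (G' m)" for m
  proof -
    obtain S where S: "finite S" "\<And>f g. (\<forall>i\<in>S. f i = g i) \<Longrightarrow>
        G (fst (prod_decode m)) (snd (prod_decode m)) f = G (fst (prod_decode m)) (snd (prod_decode m)) g"
      using G(2) by (rule finitely_dependentE) (rule that)
    show ?thesis unfolding finitely_dependent_def
    proof (intro exI[of _ "insert 0 (Suc ` S)"] conjI allI impI)
      fix f g :: "nat \<Rightarrow> nat" assume "\<forall>i\<in>insert 0 (Suc ` S). f i = g i"
      then show "G' m f = G' m g"
        unfolding G'_def using S(2)[of "\<lambda>i. f (Suc i)" "\<lambda>i. g (Suc i)"] by auto
    qed (use S(1) in auto)
  qed
  moreover have "G' m f \<in> R" for m f unfolding G'_def using G assms(2) by auto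
  ultimately show ?thesis by (intro souslinI[of G'])
qed

text \<open>The bounds make the tree finitely branching, so by the pigeonhole principle infinitely
  many rows survive each time one more entry is fixed. Infinitely many rows are kept in order to
  find one beyond any given \<open>n\<close>.\<close>

lemma koenig_bounded_branches:
  fixes F :: "nat \<Rightarrow> nat \<Rightarrow> nat"
  assumes bounded: "\<And>k i. i < k \<Longrightarrow> F k i \<le> m i"
  shows "\<exists>f. \<forall>n. \<exists>k\<ge>n. \<forall>i<n. F k i = f i"
proof -
  define Q where "Q n h \<longleftrightarrow> infinite {k. \<forall>i<n. F k i = h i}" for n and h :: "nat \<Rightarrow> nat"
  have "\<exists>h. \<forall>n. Q n (h n) \<and> (\<forall>i<n. h (Suc n) i = h n i)"
  proof (rule dependent_nat_choice)
    show "\<exists>x. Q 0 x" unfolding Q_def by (simp add: infinite_UNIV_nat)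
  next
    fix h n assume Q: "Q n h"
    have "finite {..m n}" by simp
    \<comment> \<open>Rows \<open>k \<le> n\<close> are dropped because entry \<open>n\<close> of
      row \<open>k\<close> is bounded only if \<open>n < k\<close>.\<close>
    moreover have "infinite ({k. \<forall>i<n. F k i = h i} - {..n})" (is "infinite ?I")
      using Q unfolding Q_def by simp
    moreover have "(\<lambda>k. F k n) ` ?I \<subseteq> {..m n}" by (intro image_subsetI) (simp add: bounded)
    ultimately obtain j where j: "infinite {k\<in>?I. F k n = j}"
      using pigeonhole_infinite_rel[of ?I "{..m n}" "\<lambda>k j. F k n = j"] by auto
    have "Q (Suc n) (h(n := j))" unfolding Q_def
      by (rule infinite_super[OF _ j]) (auto simp: less_Suc_eq)
    moreover have "\<forall>i<n. (h(n := j)) i = h i" by simp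
    ultimately show "\<exists>y. Q (Suc n) y \<and> (\<forall>i<n. y i = h i)" by blast
  qed
  then obtain h where h: "\<And>n. Q n (h n)" "\<And>n i. i < n \<Longrightarrow> h (Suc n) i = h n i" by metis
  have stable: "h n i = h (Suc i) i" if "i < n" for n i
    using that
  proof (induction n)
    case (Suc n)
    show ?case
    proof (cases "i = n")
      case False
      then show ?thesis using Suc h(2)[of i n] by simp
    qed simp
  qed simp
  show ?thesis
  proof (intro exI[of _ "\<lambda>i. h (Suc i) i"] allI)
    fix n
    obtain k where "k \<ge> n" "k \<in> {k. \<forall>i<n. F k i = h n i}"
      using h(1)[of n] unfolding Q_def infinite_nat_iff_unbounded_le by blast
    then have "k \<ge> n \<and> (\<forall>i<n. F k i = h (Suc i) i)" using stable[of _ n] by auto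
    then show "\<exists>k\<ge>n. \<forall>i<n. F k i = h (Suc i) i" by blast
  qed
qed

text \<open>
  The Souslin set is approximated from inside by the branches dominated by a fixed sequence \<open>m\<close>:
  continuity from below of the outer measure yields the \<open>m i\<close> one after the other, and by
  Koenig's lemma the dominated branches form a measurable set.
\<close>
lemma souslin_inner_approx:
  assumes M: "finite_measure M" and UNIV: "space M = UNIV" and W: "souslin (sets M) W"
    and c: "c < outer_measure_of M W"
  shows "\<exists>T\<in>sets M. T \<subseteq> W \<and> c \<le> emeasure M T"
proof -
  interpret finite_measure M by fact
  obtain G where "souslin_scheme (sets M) W G"
    using W unfolding souslin_def by blast
  then have G: "\<And>n f. G n f \<in> sets M" "\<And>n. finitely_dependent (G n)"
      "W = {z. \<exists>f. \<forall>n. z \<in> G n f}"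
    unfolding souslin_scheme_def by auto
  have "\<exists>S. finite S \<and> (\<forall>f g. (\<forall>i\<in>S. f i = g i) \<longrightarrow> G n f = G n g)" for n
    using G(2)[of n] unfolding finitely_dependent_def by simp
  then obtain S where S: "\<And>n. finite (S n)"
      "\<And>n f g. (\<forall>i\<in>S n. f i = g i) \<Longrightarrow> G n f = G n g"
    by metis
  \<comment> \<open>Entries from \<open>k\<close> on range freely, so this is an uncountable union
    that may fail to be measurable; only its outer measure is available.\<close>
  define U where "U k m = {z. \<exists>f. (\<forall>i<k. f i \<le> m i) \<and> (\<forall>n. z \<in> G n f)}"
    for k and m :: "nat \<Rightarrow> nat"
  have U_cong: "U k m = U k m'" if "\<forall>i<k. m i = m' i" for k m m'
    unfolding U_def using that by auto
  have "\<exists>h. \<forall>n. c < outer_measure_of M (U n (h n)) \<and> (\<forall>i<n. h (Suc n) i = h n i)"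
  proof (rule dependent_nat_choice)
    show "\<exists>h. c < outer_measure_of M (U 0 h)" using c by (simp add: U_def G(3))
  next
    fix h n assume *: "c < outer_measure_of M (U n h)"
    have "U n h = (\<Union>j. U (Suc n) (h(n := j)))"
      unfolding U_def by (auto simp: less_Suc_eq)
    moreover have "incseq (\<lambda>j. U (Suc n) (h(n := j)))"
      unfolding U_def incseq_def by (auto simp: less_Suc_eq) (metis order_trans)
    ultimately have "outer_measure_of M (U n h) = (SUP j. outer_measure_of M (U (Suc n) (h(n := j))))"
      using SUP_outer_measure_of_incseq[of "\<lambda>j. U (Suc n) (h(n := j))" M] UNIV by simp
    then obtain j where "c < outer_measure_of M (U (Suc n) (h(n := j)))"
      using * by (auto simp: less_SUP_iff)
    then show "\<exists>y. c < outer_measure_of M (U (Suc n) y) \<and> (\<forall>i<n. y i = h i)"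
      by (intro exI[of _ "h(n := j)"]) auto
  qed
  then obtain h where h: "\<And>n. c < outer_measure_of M (U n (h n))"
      "\<And>n i. i < n \<Longrightarrow> h (Suc n) i = h n i" by metis
  define m where "m i = h (Suc i) i" for i
  have stable: "h n i = m i" if "i < n" for n i
    using that
  proof (induction n)
    case (Suc n)
    show ?case
    proof (cases "i = n")
      case False
      then show ?thesis using Suc h(2)[of i n] by simp
    qed (simp add: m_def)
  qed simp
  have U: "c < outer_measure_of M (U k m)" for k
    using h(1)[of k] U_cong[of k "h k" m] stable by auto
  \<comment> \<open>Only the levels decided by the first \<open>k\<close> entries are kept. Up to
    those entries there are finitely many bounded branches, so \<open>V k\<close> is a finite union
    of measurable sets, and it still contains \<open>U k m\<close>.\<close>
  define V where "V k = {z. \<exists>f. (\<forall>i<k. f i \<le> m i) \<and> (\<forall>n. n < k \<and> S n \<subseteq> {..<k} \<longrightarrow> z \<in> G n f)}"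
    for k
  have finite_INT: "(\<Inter>n\<in>J. G n f) \<in> sets M" if "finite J" for J f
    using that G(1) UNIV sets.top[of M] by (cases "J = {}") (auto intro!: sets.finite_INT)
  have V_meas: "V k \<in> sets M" for k
  proof -
    have "V k = (\<Union>f\<in>PiE {..<k} (\<lambda>i. {..m i}). \<Inter>n\<in>{n. n < k \<and> S n \<subseteq> {..<k}}. G n f)"
      (is "_ = ?R")
    proof (intro set_eqI iffI)
      fix z assume "z \<in> V k"
      then obtain f where f: "\<And>i. i < k \<Longrightarrow> f i \<le> m i"
          "\<And>n. n < k \<Longrightarrow> S n \<subseteq> {..<k} \<Longrightarrow> z \<in> G n f"
        unfolding V_def by blast
      have "G n (restrict f {..<k}) = G n f" if "S n \<subseteq> {..<k}" for n
        using that by (intro S(2)) auto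
      then show "z \<in> ?R"
        using f by (intro UN_I[of "restrict f {..<k}"]) auto
    next
      fix z assume "z \<in> ?R"
      then obtain f where "f \<in> PiE {..<k} (\<lambda>i. {..m i})" "\<And>n. n < k \<Longrightarrow> S n \<subseteq> {..<k} \<Longrightarrow> z \<in> G n f"
        by auto
      then show "z \<in> V k" unfolding V_def mem_Collect_eq
        by (intro exI[of _ f]) (simp add: PiE_iff)
    qed
    moreover have "finite (PiE {..<k} (\<lambda>i. {..m i}))" by (intro finite_PiE) auto
    moreover have "(\<Inter>n\<in>{n. n < k \<and> S n \<subseteq> {..<k}}. G n f) \<in> sets M" for f
      by (rule finite_INT) simp
    ultimately show ?thesis by (auto intro!: sets.finite_UN)
  qed
  have V_dec: "decseq V"
    unfolding decseq_Suc_iff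
  proof (intro allI subsetI)
    fix k z assume "z \<in> V (Suc k)"
    then obtain f where f: "\<And>i. i < Suc k \<Longrightarrow> f i \<le> m i"
          "\<And>n. n < Suc k \<Longrightarrow> S n \<subseteq> {..<Suc k} \<Longrightarrow> z \<in> G n f"
        unfolding V_def by blast
    have "z \<in> G n f" if "n < k" "S n \<subseteq> {..<k}" for n
      using that by (intro f(2)) auto
    then have "(\<forall>i<k. f i \<le> m i) \<and> (\<forall>n. n < k \<and> S n \<subseteq> {..<k} \<longrightarrow> z \<in> G n f)"
      using f(1) by auto
    then show "z \<in> V k" unfolding V_def by blast
  qed
  have V_ge: "c \<le> emeasure M (V k)" for k
  proof -
    have "U k m \<subseteq> V k" unfolding U_def V_def by blast
    then have "outer_measure_of M (U k m) \<le> outer_measure_of M (V k)"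
      by (rule outer_measure_of_mono)
    then show ?thesis using U[of k] V_meas[of k] by simp
  qed
  \<comment> \<open>Each \<open>k\<close> supplies its own branch. The limit branch meets level
    \<open>n\<close> because that level is decided by finitely many entries, which the limit shares
    with a row \<open>k\<close> long enough to have been tested at level \<open>n\<close>.\<close>
  have "(\<Inter>k. V k) \<subseteq> W"
  proof
    fix z assume "z \<in> (\<Inter>k. V k)"
    then have "\<forall>k. \<exists>f. (\<forall>i<k. f i \<le> m i) \<and> (\<forall>n. n < k \<and> S n \<subseteq> {..<k} \<longrightarrow> z \<in> G n f)"
      unfolding V_def by blast
    then obtain F where F: "\<And>k i. i < k \<Longrightarrow> F k i \<le> m i"
        "\<And>k n. n < k \<Longrightarrow> S n \<subseteq> {..<k} \<Longrightarrow> z \<in> G n (F k)" by metis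
    obtain f where f: "\<And>n. \<exists>k\<ge>n. \<forall>i<n. F k i = f i"
      using koenig_bounded_branches[of F m] F(1) by blast
    have "z \<in> G n f" for n
    proof -
      obtain N where N: "S n \<subseteq> {..<N}" using S(1)[of n] finite_nat_iff_bounded by auto
      obtain k where k: "k \<ge> max N (Suc n)" "\<forall>i<max N (Suc n). F k i = f i"
        using f[of "max N (Suc n)"] by blast
      have "S n \<subseteq> {..<k}" using N k(1) by auto
      then have "z \<in> G n (F k)" using F(2)[of n k] k(1) by auto
      moreover have "G n (F k) = G n f" using N k(2) by (intro S(2)) auto
      ultimately show ?thesis by simp
    qed
    then show "z \<in> W" unfolding G(3) by blast
  qed
  moreover have "c \<le> emeasure M (\<Inter>k. V k)"
  proof -
    have "emeasure M (\<Inter>k. V k) = (INF k. emeasure M (V k))"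
      using V_meas V_dec by (intro INF_emeasure_decseq[symmetric]) auto
    then show ?thesis using V_ge by (auto intro!: INF_greatest)
  qed
  moreover have "(\<Inter>k. V k) \<in> sets M" using V_meas by auto
  ultimately show ?thesis by blast
qed

text \<open>Inner approximations at levels increasing to the outer measure unite to a measurable
  \<open>T\<close> inside \<open>W\<close> that has the measure of a measurable hull
  \<open>E\<close>. Thus \<open>W\<close> lies between two measurable sets with null
  difference.\<close>

lemma souslin_completion:
  assumes M: "finite_measure M" and UNIV: "space M = UNIV" and W: "souslin (sets M) W"
  shows "W \<in> sets (completion M)"
proof -
  interpret finite_measure M by fact
  obtain E where E: "E \<in> sets M" "W \<subseteq> E" "outer_measure_of M W = emeasure M E"
    using outer_measure_of_attain[of W M] UNIV by auto
  have "\<exists>T\<in>sets M. T \<subseteq> W \<and> emeasure M T = emeasure M E"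
  \<comment> \<open>No level lies strictly below measure 0, so there the empty set serves as
    \<open>T\<close>.\<close>
  proof (cases "emeasure M E = 0")
    case True
    then show ?thesis by (intro bexI[of _ "{}"]) auto
  next
    case False
    obtain c where c: "\<And>n::nat. c n < emeasure M E" "c \<longlonglongrightarrow> emeasure M E"
    proof -
      from False have "(0::ennreal) < emeasure M E" by (simp add: zero_less_iff_neq_zero)
      from approx_from_below_dense_linorder[OF this] show ?thesis using that by blast
    qed
    have "\<forall>n. \<exists>T. T \<in> sets M \<and> T \<subseteq> W \<and> c n \<le> emeasure M T"
      using souslin_inner_approx[OF M UNIV W] c(1) E(3) by (simp add: Bex_def)
    then obtain T where T: "\<And>n. T n \<in> sets M" "\<And>n. T n \<subseteq> W" "\<And>n. c n \<le> emeasure M (T n)"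
      by metis
    have "(\<Union>n. T n) \<in> sets M" using T(1) by auto
    moreover have "(\<Union>n. T n) \<subseteq> W" using T(2) by auto
    moreover have "emeasure M E \<le> emeasure M (\<Union>n. T n)"
    proof (rule LIMSEQ_le_const2[OF c(2)], intro exI allI impI)
      fix n
      have "emeasure M (T n) \<le> emeasure M (\<Union>n. T n)"
        using T(1) by (intro emeasure_mono) auto
      then show "c n \<le> emeasure M (\<Union>n. T n)" using T(3)[of n] by (rule order_trans[rotated])
    qed
    moreover have "emeasure M (\<Union>n. T n) \<le> emeasure M E"
      using E(1,2) \<open>(\<Union>n. T n) \<subseteq> W\<close> by (intro emeasure_mono) auto
    ultimately show ?thesis by (intro bexI[of _ "\<Union>n. T n"]) auto
  qed
  then obtain T where T: "T \<in> sets M" "T \<subseteq> W" "emeasure M T = emeasure M E" by blast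
  have "E - T \<in> null_sets M"
    using T E emeasure_Diff[of M T E] by (auto intro!: null_setsI)
  then show ?thesis
    using T E by (intro sets_completionI[of W T "W - T" "E - T"]) auto
qed

text \<open>Souslin sets are not closed under complements, so the induction carries each set
  together with its complement; countable unions of the one are then countable intersections of the
  other.\<close>

lemma souslin_complementary_sigma_algebra:
  assumes "A \<in> sigma_sets UNIV R0" "\<And>r. r \<in> R0 \<Longrightarrow> souslin R r \<and> souslin R (- r)"
    and R: "UNIV \<in> R" "{} \<in> R"
  shows "souslin R A \<and> souslin R (- A)"
  using assms(1)
proof induction
  case (Basic a)
  then show ?case using assms(2) by blast
next
  case Empty
  then show ?case using R by (auto intro: souslin_basic)
next
  case (Compl a)
  then show ?case by (simp add: Compl_eq_Diff_UNIV[symmetric])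
next
  case (Union a)
  then show ?case using souslin_UN[OF _ R(1), of a] souslin_INT[of R "\<lambda>i. - a i"]
    by simp
qed

text \<open>Rectangles with a closed time side generate the product sigma-algebra, and the
  complement of such a rectangle is a countable union of rectangles of the same kind, since open
  sets of reals are countable unions of compact sets. Closedness of the time side is what the
  projection argument exploits.\<close>

lemma souslin_borel_product:
  fixes M :: "'a measure"
  assumes UNIV: "space M = UNIV" and H: "H \<in> sets ((borel :: real measure) \<Otimes>\<^sub>M M)"
  shows "souslin {K \<times> F | K F. closed K \<and> F \<in> sets M} H"
proof -
  define R where "R = {K \<times> F | K F. closed (K :: real set) \<and> F \<in> sets M}"
  have UR: "UNIV \<in> R"
    unfolding R_def using UNIV sets.top[of M] by (auto intro!: exI[of _ UNIV])
  have ER: "{} \<in> R" unfolding R_def by auto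
  have "sets ((borel :: real measure) \<Otimes>\<^sub>M M) = sets (sigma UNIV (Collect closed) \<Otimes>\<^sub>M sigma UNIV (sets M))"
    using UNIV by (intro sets_pair_measure_cong) (auto simp: borel_eq_closed sets.sigma_sets_eq[of M, unfolded UNIV] sets_measure_of_conv)
  also have "\<dots> = sigma_sets UNIV R"
  proof -
    have "sets (sigma UNIV (Collect closed) \<Otimes>\<^sub>M sigma UNIV (sets M)) =
        sets (sigma (UNIV \<times> UNIV) {a \<times> b | a b. a \<in> Collect closed \<and> b \<in> sets M})"
      using sets.top[of M] UNIV
      by (subst sigma_prod) (auto intro!: exI[of _ "{UNIV}"])
    also have "{a \<times> b | a b. a \<in> Collect closed \<and> b \<in> sets M} = R" unfolding R_def by auto
    finally show ?thesis by simp
  qed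
  finally have "H \<in> sigma_sets UNIV R" using H by simp
  moreover have "souslin R r \<and> souslin R (- r)" if r: "r \<in> R" for r
  proof
    show "souslin R r" using r by (rule souslin_basic)
    obtain K F where KF: "r = K \<times> F" "closed K" "F \<in> sets M" using r unfolding R_def by auto
    obtain C where C: "\<And>n::nat. closed (C n)" "- K = (\<Union>n. C n)"
    proof -
      obtain D where "\<And>n::nat. compact (D n)" "(\<Union>n. D n) = - K"
        using open_Union_compact_subsets[of "- K"] KF(2) by (metis open_Compl)
      then show ?thesis using that compact_imp_closed by metis
    qed
    have "- r = (\<Union>n. case n of 0 \<Rightarrow> UNIV \<times> (- F) | Suc n \<Rightarrow> C n \<times> UNIV)"
    proof -
      have "- r = UNIV \<times> (- F) \<union> (\<Union>n. C n \<times> UNIV)" using C(2) KF(1) by auto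
      also have "\<dots> = (\<Union>n. case n of 0 \<Rightarrow> UNIV \<times> (- F) | Suc n \<Rightarrow> C n \<times> UNIV)"
        by (auto split: nat.splits) 
      finally show ?thesis .
    qed
    moreover have "souslin R (case n of 0 \<Rightarrow> UNIV \<times> (- F) | Suc n \<Rightarrow> C n \<times> UNIV)" for n
      unfolding R_def using C(1) sets.compl_sets[OF KF(3)] UNIV sets.top[of M]
      by (intro souslin_basic) (auto split: nat.split simp: Compl_eq_Diff_UNIV)
    ultimately show "souslin R (- r)" using souslin_UN[OF _ UR] by metis
  qed
  ultimately show ?thesis
    using souslin_complementary_sigma_algebra[of H R R] UR ER unfolding R_def by blast
qed

text \<open>Projection commutes with the union over branches, but with the intersection over levels
  only if the time sections are nested and compact. This is why time is confined to a bounded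
  interval and the levels are replaced by the decreasing finite intersections \<open>L n f\<close>.
  These are rectangles, so their projections lie in \<open>M\<close> and the projected set is again
  Souslin.\<close>

theorem measurable_projection:
  fixes M :: "'a measure"
  assumes M: "finite_measure M" and UNIV: "space M = UNIV"
    and H: "H \<in> sets ((borel :: real measure) \<Otimes>\<^sub>M M)"
  shows "{\<omega>. \<exists>t. (t, \<omega>) \<in> H} \<in> sets (completion M)"
proof -
  have "{\<omega>. \<exists>t\<in>{-real N..real N}. (t, \<omega>) \<in> H} \<in> sets (completion M)" for N :: nat
  proof -
    obtain G where "souslin_scheme {K \<times> F | K F. closed K \<and> F \<in> sets M} H G"
      using souslin_borel_product[OF UNIV H] unfolding souslin_def by blast
    then have G: "\<And>n f. G n f \<in> {K \<times> F | K F. closed K \<and> F \<in> sets M}"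
        "\<And>n. finitely_dependent (G n)" "H = {z. \<exists>f. \<forall>n. z \<in> G n f}"
      unfolding souslin_scheme_def by (blast, blast, simp only:)
    define L where "L n f = (\<Inter>j\<in>{..n}. G j f) \<inter> ({-real N..real N} \<times> UNIV)" for n f
    have L_comp: "compact {t. (t, \<omega>) \<in> L n f}" for n f \<omega>
    proof -
      have "closed {t. (t, \<omega>) \<in> G j f}" for j
      proof -
        obtain K F where "G j f = K \<times> F" "closed K" using G(1)[of j f] by auto
        then have "closed (if \<omega> \<in> F then K else {})"
            "{t. (t, \<omega>) \<in> G j f} = (if \<omega> \<in> F then K else {})" by auto
        then show ?thesis by simp
      qed
      then have "compact ({-real N..real N} \<inter> (\<Inter>j\<in>{..n}. {t. (t, \<omega>) \<in> G j f}))"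
        by (intro compact_Int_closed closed_INT) auto
      moreover have "{t. (t, \<omega>) \<in> L n f} = {-real N..real N} \<inter> (\<Inter>j\<in>{..n}. {t. (t, \<omega>) \<in> G j f})"
        unfolding L_def by auto
      ultimately show ?thesis by simp
    qed
    have "{\<omega>. \<exists>t\<in>{-real N..real N}. (t, \<omega>) \<in> H} = {\<omega>. \<exists>f. \<forall>n. \<omega> \<in> snd ` L n f}"
    proof (intro set_eqI iffI)
      fix \<omega> assume "\<omega> \<in> {\<omega>. \<exists>t\<in>{-real N..real N}. (t, \<omega>) \<in> H}"
      then obtain t where t: "t \<in> {-real N..real N}" "(t, \<omega>) \<in> H" by blast
      then obtain f where "\<And>n. (t, \<omega>) \<in> G n f" unfolding G(3) by blast
      then have "(t, \<omega>) \<in> L n f" for n unfolding L_def using t(1) by auto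
      then show "\<omega> \<in> {\<omega>. \<exists>f. \<forall>n. \<omega> \<in> snd ` L n f}" by force
    next
      fix \<omega> assume "\<omega> \<in> {\<omega>. \<exists>f. \<forall>n. \<omega> \<in> snd ` L n f}"
      then obtain f where f: "\<And>n. \<omega> \<in> snd ` L n f" by blast
      have "(\<Inter>n. {t. (t, \<omega>) \<in> L n f}) \<noteq> {}"
      proof (rule compact_nest)
        show "{t. (t, \<omega>) \<in> L n f} \<noteq> {}" for n using f[of n] by force
        show "{t. (t, \<omega>) \<in> L n f} \<subseteq> {t. (t, \<omega>) \<in> L k f}" if "k \<le> n" for k n
          unfolding L_def using that by auto
      qed (rule L_comp)
      then obtain t where "\<And>n. (t, \<omega>) \<in> L n f" by blast
      then have "t \<in> {-real N..real N}" "\<And>n. (t, \<omega>) \<in> G n f" unfolding L_def by auto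
      then show "\<omega> \<in> {\<omega>. \<exists>t\<in>{-real N..real N}. (t, \<omega>) \<in> H}" using G(3) by blast
    qed
    moreover have "finitely_dependent (\<lambda>f. snd ` L n f)" for n
      unfolding L_def
      by (intro finitely_dependent_apply[of "\<lambda>f. \<Inter>j\<in>{..n}. G j f" "\<lambda>A. snd ` (A \<inter> _)"]
          finitely_dependent_INT G(2)) simp
    moreover have "snd ` L n f \<in> sets M" for n f
    proof -
      obtain K F where KF: "\<And>j. G j f = K j \<times> F j" "\<And>j. F j \<in> sets M"
        using G(1)[of _ f] by simp metis
      have "L n f = ((\<Inter>j\<in>{..n}. K j) \<inter> {-real N..real N}) \<times> (\<Inter>j\<in>{..n}. F j)"
        unfolding L_def KF by auto
      then have "snd ` L n f = {} \<or> snd ` L n f = (\<Inter>j\<in>{..n}. F j)" by (auto simp: image_iff)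
      moreover have "(\<Inter>j\<in>{..n}. F j) \<in> sets M" using KF(2) by (intro sets.finite_INT) auto
      ultimately show ?thesis by auto
    qed
    ultimately have "souslin (sets M) {\<omega>. \<exists>t\<in>{-real N..real N}. (t, \<omega>) \<in> H}"
      by (intro souslinI[of "\<lambda>n f. snd ` L n f"])
    then show ?thesis by (rule souslin_completion[OF M UNIV])
  qed
  then have "(\<Union>N. {\<omega>. \<exists>t\<in>{-real N..real N}. (t, \<omega>) \<in> H}) \<in> sets (completion M)"
    by blast
  also have "(\<Union>N. {\<omega>. \<exists>t\<in>{-real N..real N}. (t, \<omega>) \<in> H}) = {\<omega>. \<exists>t. (t, \<omega>) \<in> H}"
  proof -
    have "\<exists>N. t \<in> {-real N..real N}" for t
      using real_arch_simple[of "\<bar>t\<bar>"] by (auto simp: abs_le_iff)  (metis minus_le_iff)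
    then show ?thesis by blast
  qed
  finally show ?thesis .
qed

section \<open>The Markov property\<close>

lemma space_raw_filtration [simp]: "space (raw_filtration X t) = UNIV"
  unfolding raw_filtration_def by (simp add: space_measure_of_conv)

lemma sets_raw_filtration:
  "sets (raw_filtration X t) =
     sigma_sets UNIV {X s -` (Some ` A) | s A. 0 \<le> s \<and> ennreal s \<le> t \<and> A \<in> sets borel}"
  unfolding raw_filtration_def by (simp add: sets_measure_of_conv)

lemma sets_raw_filtration_mono: "u \<le> v \<Longrightarrow> sets (raw_filtration X u) \<subseteq> sets (raw_filtration X v)"
  unfolding sets_raw_filtration by (intro sigma_sets_mono') (blast intro: order_trans)

lemma in_sets_raw_filtration:
  assumes "0 \<le> s" "ennreal s \<le> t" "A \<in> sets borel"
  shows "{\<omega>. X s \<omega> \<in> Some ` A} \<in> sets (raw_filtration X t)"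
proof -
  have "X s -` (Some ` A) \<in> sets (raw_filtration X t)"
    unfolding sets_raw_filtration by (rule sigma_sets.Basic) (use assms in blast)
  then show ?thesis by (simp add: vimage_def)
qed

lemma not_None_iff: "z \<noteq> None \<longleftrightarrow> z \<in> Some ` UNIV"
  by (cases z) auto

lemma None_in_sets_raw_filtration:
  assumes "0 \<le> s" "ennreal s \<le> t"
  shows "{\<omega>. X s \<omega> = None} \<in> sets (raw_filtration X t)"
proof -
  have "UNIV - {\<omega>. X s \<omega> \<in> Some ` UNIV} \<in> sets (raw_filtration X t)"
    using in_sets_raw_filtration[OF assms, of UNIV X]
      sets.compl_sets[of "{\<omega>. X s \<omega> \<in> Some ` UNIV}" "raw_filtration X t"]
    by simp
  moreover have "UNIV - {\<omega>. X s \<omega> \<in> Some ` UNIV} = {\<omega>. X s \<omega> = None}"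
    by (auto simp: not_None_iff[symmetric])
  ultimately show ?thesis by simp
qed

section \<open>Functions of the process, extended by 0 at the cemetery\<close>

definition observe :: "(real \<Rightarrow> 'w \<Rightarrow> 'e option) \<Rightarrow> ('e \<Rightarrow> ennreal) \<Rightarrow> real \<Rightarrow> 'w \<Rightarrow> ennreal" where
  "observe X f t \<omega> = (case X t \<omega> of None \<Rightarrow> 0 | Some y \<Rightarrow> f y)"

lemma observe_indicator: "observe X (indicator A) t = indicator {\<omega>. X t \<omega> \<in> Some ` A}"
  unfolding observe_def by (auto simp: fun_eq_iff indicator_def split: option.splits)

lemma observe_one: "observe X (\<lambda>_. 1) t = indicator {\<omega>. X t \<omega> \<noteq> None}"
  unfolding observe_def by (auto simp: fun_eq_iff indicator_def split: option.splits)

lemma observe_cmult: "observe X (\<lambda>y. c * f y) t \<omega> = c * observe X f t \<omega>"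
  unfolding observe_def by (auto split: option.splits)

lemma observe_add: "observe X (\<lambda>y. f y + g y) t \<omega> = observe X f t \<omega> + observe X g t \<omega>"
  unfolding observe_def by (auto split: option.splits)

lemma observe_SUP:
  "observe X (\<lambda>y. SUP i. f i y) t \<omega> = (SUP i. observe X (f i) t \<omega>)"
  unfolding observe_def by (auto split: option.splits)

lemma observe_mono: "(\<And>y. f y \<le> g y) \<Longrightarrow> observe X f t \<omega> \<le> observe X g t \<omega>"
  unfolding observe_def by (auto split: option.splits)

lemma borel_measurable_observe:
  assumes f: "f \<in> borel_measurable borel" and "0 \<le> s" "ennreal s \<le> t"
  shows "observe X f s \<in> borel_measurable (raw_filtration X t)"
proof (rule measurableI)
  fix S :: "ennreal set" assume S: "S \<in> sets borel"
  have "f -` S \<in> sets borel" using measurable_sets[OF f S] by simp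
  then have 1: "{\<omega>. X s \<omega> \<in> Some ` (f -` S)} \<in> sets (raw_filtration X t)"
    by (rule in_sets_raw_filtration[OF assms(2,3)])
  have 2: "{\<omega>. X s \<omega> = None} \<in> sets (raw_filtration X t)"
    by (rule None_in_sets_raw_filtration[OF assms(2,3)])
  have "observe X f s -` S \<inter> space (raw_filtration X t) =
      {\<omega>. X s \<omega> \<in> Some ` (f -` S)} \<union> (if 0 \<in> S then {\<omega>. X s \<omega> = None} else {})"
    unfolding observe_def by (auto split: option.splits)
  then show "observe X f s -` S \<inter> space (raw_filtration X t) \<in> sets (raw_filtration X t)"
    using 1 2 by auto
qed simp

lemma space_aug_filtration [simp]: "space (aug_filtration X P t) = UNIV"
  unfolding aug_filtration_def by (simp add: space_measure_of_conv)

lemma filtration_aug_filtration: "filtration UNIV (aug_filtration X P)"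
proof
  fix i j :: ennreal assume "i \<le> j"
  then show "sets (aug_filtration X P i) \<subseteq> sets (aug_filtration X P j)"
    unfolding aug_filtration_def using sets_raw_filtration_mono[of i j X]
    by (simp add: sets_measure_of_conv) (intro sigma_sets_mono' Collect_mono, blast)
qed simp

lemma raw_subset_aug: "sets (raw_filtration X t) \<subseteq> sets (aug_filtration X P t)"
proof
  fix A assume A: "A \<in> sets (raw_filtration X t)"
  show "A \<in> sets (aug_filtration X P t)"
    unfolding aug_filtration_def using A
    by (auto simp: sets_measure_of_conv intro!: sigma_sets.Basic bexI[of _ A])
qed

section \<open>Transition kernels and the Markov property at a fixed time\<close>

context borel_right_process
begin

lemma prob_space_P: "prob_space (P y)" and sets_P [measurable_cong]: "sets (P y) = sets (raw_filtration X \<infinity>)"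
  using measurable_space[OF laws, of y] by (auto simp: space_prob_algebra)

lemma space_P [simp]: "space (P y) = UNIV"
  using sets_eq_imp_space_eq[OF sets_P] by simp

lemma emeasure_P_UNIV [simp]: "emeasure (P y) UNIV = 1"
  using prob_space.emeasure_space_1[OF prob_space_P, of y] by simp

lemma P_measurable: "P \<in> borel \<rightarrow>\<^sub>M subprob_algebra (raw_filtration X \<infinity>)"
  by (rule measurable_prob_algebraD[OF laws])

text \<open>Point masses transfer whatever is assumed about general initial laws to the laws
  \<open>P y\<close>.\<close>

lemma law_return: "law P (return borel y) = P y"
  unfolding law_def by (rule bind_return[OF P_measurable]) simp

lemma in_sets_P: "0 \<le> t \<Longrightarrow> A \<in> sets borel \<Longrightarrow> {\<omega>. X t \<omega> \<in> Some ` A} \<in> sets (P y)"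
  using in_sets_raw_filtration[of t \<infinity> A X] by (simp add: sets_P)

lemma alive_sets_P: "0 \<le> t \<Longrightarrow> {\<omega>. X t \<omega> \<noteq> None} \<in> sets (P y)"
  using in_sets_P[of t UNIV y] sets.top[of "borel :: 'e measure"] by (simp only: not_None_iff space_borel)

lemma the_measurable:
  assumes "0 \<le> t"
  shows "(\<lambda>\<omega>. the (X t \<omega>)) \<in> restrict_space (P y) {\<omega>. X t \<omega> \<noteq> None} \<rightarrow>\<^sub>M borel"
proof (rule measurableI)
  fix A :: "'e set" assume "A \<in> sets borel"
  moreover have "(\<lambda>\<omega>. the (X t \<omega>)) -` A \<inter> {\<omega>. X t \<omega> \<noteq> None} =
      {\<omega>. X t \<omega> \<noteq> None} \<inter> {\<omega>. X t \<omega> \<in> Some ` A}"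
    by auto
  ultimately show "(\<lambda>\<omega>. the (X t \<omega>)) -` A \<inter> space (restrict_space (P y) {\<omega>. X t \<omega> \<noteq> None})
      \<in> sets (restrict_space (P y) {\<omega>. X t \<omega> \<noteq> None})"
    using in_sets_P[OF assms, of A y]
    by (auto simp: space_restrict_space sets_restrict_space)
qed simp

lemma sets_transition [measurable_cong, simp]: "sets (transition X P t y) = sets borel"
  unfolding transition_def by simp

lemma space_transition [simp]: "space (transition X P t y) = UNIV"
  unfolding transition_def by simp

text \<open>Restricting \<open>P y\<close> to the surviving paths in \<open>transition\<close>
  corresponds to the value 0 of \<open>observe\<close> at the cemetery.\<close>

lemma nn_integral_transition:
  assumes t: "0 \<le> t" and f: "f \<in> borel_measurable borel"
  shows "(\<integral>\<^sup>+z. f z \<partial>transition X P t y) = (\<integral>\<^sup>+\<omega>. observe X f t \<omega> \<partial>P y)"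
proof -
  have "(\<integral>\<^sup>+z. f z \<partial>transition X P t y) =
      (\<integral>\<^sup>+\<omega>. f (the (X t \<omega>)) \<partial>restrict_space (P y) {\<omega>. X t \<omega> \<noteq> None})"
    unfolding transition_def by (rule nn_integral_distr[OF the_measurable[OF t]]) (use f in simp)
  also have "\<dots> = (\<integral>\<^sup>+\<omega>. f (the (X t \<omega>)) * indicator {\<omega>. X t \<omega> \<noteq> None} \<omega> \<partial>P y)"
    using alive_sets_P[OF t] by (subst nn_integral_restrict_space) auto
  also have "\<dots> = (\<integral>\<^sup>+\<omega>. observe X f t \<omega> \<partial>P y)"
    by (intro nn_integral_cong) (auto simp: observe_def split: option.splits)
  finally show ?thesis .
qed

lemma emeasure_transition:
  assumes "0 \<le> t" "A \<in> sets borel"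
  shows "emeasure (transition X P t y) A = emeasure (P y) {\<omega>. X t \<omega> \<in> Some ` A}"
proof -
  have "emeasure (transition X P t y) A = (\<integral>\<^sup>+z. indicator A z \<partial>transition X P t y)"
    using assms by simp
  also have "\<dots> = (\<integral>\<^sup>+\<omega>. observe X (indicator A) t \<omega> \<partial>P y)"
    using assms by (intro nn_integral_transition) auto
  also have "\<dots> = emeasure (P y) {\<omega>. X t \<omega> \<in> Some ` A}"
    unfolding observe_indicator using in_sets_P[OF assms] by simp
  finally show ?thesis .
qed

lemma emeasure_transition_le_1: "0 \<le> t \<Longrightarrow> emeasure (transition X P t y) A \<le> 1"
  using emeasure_space[of "transition X P t y" A] emeasure_space[of "P y" "{\<omega>. X t \<omega> \<in> Some ` UNIV}"]
  by (auto simp: emeasure_transition)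

lemma subprob_space_transition: "0 \<le> t \<Longrightarrow> subprob_space (transition X P t y)"
  by (rule subprob_spaceI) (auto simp: emeasure_transition_le_1)

lemma P_integral_measurable:
  assumes "F \<in> borel_measurable (raw_filtration X \<infinity>)"
  shows "(\<lambda>y. \<integral>\<^sup>+\<omega>. F \<omega> \<partial>P y) \<in> borel_measurable borel"
  by (rule measurable_compose[OF P_measurable nn_integral_measurable_subprob_algebra[OF assms]])

lemma transition_integral_measurable:
  assumes t: "0 \<le> t" and f: "f \<in> borel_measurable borel"
  shows "(\<lambda>y. \<integral>\<^sup>+z. f z \<partial>transition X P t y) \<in> borel_measurable borel"
  unfolding nn_integral_transition[OF assms]
  using assms by (intro P_integral_measurable borel_measurable_observe) auto

lemma observe_measurable [measurable]:
  assumes "0 \<le> t" "f \<in> borel_measurable borel"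
  shows "observe X f t \<in> borel_measurable (P y)"
  unfolding measurable_cong_sets[OF sets_P refl]
  using assms by (intro borel_measurable_observe) auto

text \<open>The strong Markov property for the constant time \<open>t\<close> and a point mass as
  initial law. Raw events at time \<open>t\<close> belong to the sigma-algebra of this stopping
  time, and the completion drops out because the event is raw measurable.\<close>

lemma markov_set:
  assumes \<Lambda>: "\<Lambda> \<in> sets (raw_filtration X (ennreal t))" and t: "0 \<le> t" and s: "0 \<le> s"
    and A: "A \<in> sets borel"
  shows "emeasure (P x) {\<omega>\<in>\<Lambda>. X (t + s) \<omega> \<in> Some ` A} =
    (\<integral>\<^sup>+\<omega>. indicator \<Lambda> \<omega> * observe X (\<lambda>y. emeasure (transition X P s y) A) t \<omega> \<partial>P x)"
proof -
  let ?\<tau> = "\<lambda>_ :: 'w. ennreal t"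
  interpret F: filtration UNIV "aug_filtration X P" by (rule filtration_aug_filtration)
  have st: "stopping_time (aug_filtration X P) ?\<tau>" by (rule stopping_time_const)
  have "\<Lambda> \<in> sets (F.pre_sigma ?\<tau>)"
  proof (rule F.sets_pre_sigmaI[OF st])
    fix u
    show "{\<omega> \<in> \<Lambda>. ennreal t \<le> u} \<in> sets (aug_filtration X P u)"
      using \<Lambda> sets_raw_filtration_mono[of "ennreal t" u X] raw_subset_aug[of X u P]
      by (cases "ennreal t \<le> u") auto
  qed
  moreover have "return borel x \<in> space (prob_algebra borel)"
    by (simp add: space_prob_algebra prob_space_return)
  ultimately have *: "emeasure (completion (law P (return borel x)))
            {\<omega>\<in>\<Lambda>. ennreal t < \<infinity> \<and> X (enn2real (ennreal t) + s) \<omega> \<in> Some ` A} =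
          (\<integral>\<^sup>+\<omega>. indicator {\<omega>\<in>\<Lambda>. ennreal t < \<infinity>} \<omega> *
             (case X (enn2real (ennreal t)) \<omega> of None \<Rightarrow> 0 | Some y \<Rightarrow> emeasure (transition X P s y) A)
           \<partial>completion (law P (return borel x)))"
    using strong_markov[unfolded strong_markov_def] st s A by blast
  have "\<Lambda> \<in> sets (P x)" using \<Lambda> sets_raw_filtration_mono[of "ennreal t" \<infinity> X] by (auto simp: sets_P)
  moreover have "{\<omega>. X (t + s) \<omega> \<in> Some ` A} \<in> sets (P x)" using t s A by (intro in_sets_P) auto
  ultimately have "\<Lambda> \<inter> {\<omega>. X (t + s) \<omega> \<in> Some ` A} \<in> sets (P x)" by (rule sets.Int)
  moreover have "\<Lambda> \<inter> {\<omega>. X (t + s) \<omega> \<in> Some ` A} = {\<omega>\<in>\<Lambda>. X (t + s) \<omega> \<in> Some ` A}" by blast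
  ultimately have "{\<omega>\<in>\<Lambda>. X (t + s) \<omega> \<in> Some ` A} \<in> sets (P x)" by simp
  with * t show ?thesis
    by (simp add: law_return nn_integral_completion observe_def)
qed

text \<open>Extension from sets to functions by monotone approximation. The past event
  \<open>\<Lambda>\<close> stays arbitrary so that later observations can be absorbed into
  it.\<close>

lemma markov_integral:
  assumes \<Lambda>: "\<Lambda> \<in> sets (raw_filtration X (ennreal t))" and t: "0 \<le> t" and s: "0 \<le> s"
    and f: "f \<in> borel_measurable borel"
  shows "(\<integral>\<^sup>+\<omega>. indicator \<Lambda> \<omega> * observe X f (t + s) \<omega> \<partial>P x) =
    (\<integral>\<^sup>+\<omega>. indicator \<Lambda> \<omega> * observe X (\<lambda>y. \<integral>\<^sup>+z. f z \<partial>transition X P s y) t \<omega> \<partial>P x)"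
  using f
proof (induction rule: borel_measurable_induct)
  have \<Lambda>_P [measurable]: "\<Lambda> \<in> sets (P x)"
    using \<Lambda> sets_raw_filtration_mono[of "ennreal t" \<infinity> X] by (auto simp: sets_P)
  have ts: "0 \<le> t + s" using t s by simp
  note [measurable] = observe_measurable[OF ts] observe_measurable[OF t]
    transition_integral_measurable[OF s]
  {
    case (cong f g)
    then show ?case by (simp cong: nn_integral_cong_simp)
  next
    case (set A)
    have "(\<integral>\<^sup>+\<omega>. indicator \<Lambda> \<omega> * observe X (indicator A) (t + s) \<omega> \<partial>P x) =
        (\<integral>\<^sup>+\<omega>. indicator {\<omega>\<in>\<Lambda>. X (t + s) \<omega> \<in> Some ` A} \<omega> \<partial>P x)"
      unfolding observe_indicator by (intro nn_integral_cong) (auto simp: indicator_def)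
    also have "\<dots> = emeasure (P x) {\<omega>\<in>\<Lambda>. X (t + s) \<omega> \<in> Some ` A}"
    proof (rule nn_integral_indicator)
      have "{\<omega>\<in>\<Lambda>. X (t + s) \<omega> \<in> Some ` A} = \<Lambda> \<inter> {\<omega>. X (t + s) \<omega> \<in> Some ` A}" by auto
      then show "{\<omega>\<in>\<Lambda>. X (t + s) \<omega> \<in> Some ` A} \<in> sets (P x)"
        using in_sets_P[OF ts set] \<Lambda>_P by auto
    qed
    finally show ?case using markov_set[OF \<Lambda> t s set] set by simp
  next
    case (mult u c)
    then show ?case
      by (simp add: observe_cmult nn_integral_cmult mult.left_commute[of _ c])
  next
    case (add u v)
    then show ?case
      by (simp add: observe_add nn_integral_add distrib_left)
  next
    case (seq U)
    have inc1: "incseq (\<lambda>i \<omega>. indicator \<Lambda> \<omega> * observe X (U i) (t + s) \<omega>)"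
      using seq(3) by (auto simp: incseq_def le_fun_def intro!: mult_left_mono observe_mono)
    have inc2: "incseq (\<lambda>i \<omega>. indicator \<Lambda> \<omega> * observe X (\<lambda>y. \<integral>\<^sup>+z. U i z \<partial>transition X P s y) t \<omega>)"
      using seq(3) by (auto simp: incseq_def le_fun_def intro!: mult_left_mono observe_mono nn_integral_mono)
    have "(\<integral>\<^sup>+\<omega>. indicator \<Lambda> \<omega> * observe X (\<lambda>z. SUP i. U i z) (t + s) \<omega> \<partial>P x) =
        (\<integral>\<^sup>+\<omega>. (SUP i. indicator \<Lambda> \<omega> * observe X (U i) (t + s) \<omega>) \<partial>P x)"
      by (simp add: observe_SUP SUP_mult_left_ennreal)
    also have "\<dots> = (SUP i. \<integral>\<^sup>+\<omega>. indicator \<Lambda> \<omega> * observe X (U i) (t + s) \<omega> \<partial>P x)"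
      using seq(1) by (intro nn_integral_monotone_convergence_SUP inc1) measurable
    also have "\<dots> = (SUP i. \<integral>\<^sup>+\<omega>. indicator \<Lambda> \<omega> * observe X (\<lambda>y. \<integral>\<^sup>+z. U i z \<partial>transition X P s y) t \<omega> \<partial>P x)"
      using seq.IH by simp
    also have "\<dots> = (\<integral>\<^sup>+\<omega>. (SUP i. indicator \<Lambda> \<omega> * observe X (\<lambda>y. \<integral>\<^sup>+z. U i z \<partial>transition X P s y) t \<omega>) \<partial>P x)"
      using seq(1) by (intro nn_integral_monotone_convergence_SUP[symmetric] inc2) measurable
    also have "\<dots> = (\<integral>\<^sup>+\<omega>. indicator \<Lambda> \<omega> * observe X (\<lambda>y. SUP i. \<integral>\<^sup>+z. U i z \<partial>transition X P s y) t \<omega> \<partial>P x)"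
      by (simp add: observe_SUP SUP_mult_left_ennreal)
    also have "(\<lambda>y. SUP i. \<integral>\<^sup>+z. U i z \<partial>transition X P s y) =
        (\<lambda>y. \<integral>\<^sup>+z. (SUP i. U i z) \<partial>transition X P s y)"
      using seq(1,3) by (intro ext nn_integral_monotone_convergence_SUP[symmetric]) auto
    finally show ?case by (simp add: image_image)
  }
qed

text \<open>The case in which the past event is the whole space. For kernels the equation holds at
  every starting point, whereas for densities it is only an almost everywhere statement.\<close>

lemma chapman_kolmogorov:
  assumes "0 \<le> t" "0 \<le> s" "f \<in> borel_measurable borel"
  shows "(\<integral>\<^sup>+z. f z \<partial>transition X P (t + s) x) =
    (\<integral>\<^sup>+y. (\<integral>\<^sup>+z. f z \<partial>transition X P s y) \<partial>transition X P t x)"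
proof -
  have "UNIV \<in> sets (raw_filtration X (ennreal t))"
    using sets.top[of "raw_filtration X (ennreal t)"] by simp
  from markov_integral[OF this assms, of x] show ?thesis
    by (simp add: nn_integral_transition[OF add_nonneg_nonneg[OF assms(1,2)] assms(3)]
        nn_integral_transition[OF assms(1) transition_integral_measurable[OF assms(2,3)]])
qed

text \<open>A single Borel function \<open>\<phi>\<close> has to serve all \<open>t\<close>,
  \<open>x\<close> and \<open>\<Lambda>\<close>: evaluated at time 0 it is the cylinder probability
  as a function of the starting point, and at time \<open>t\<close> it expresses the Markov
  property. The induction removes the earliest observation time.\<close>

lemma cylinder_kernel:
  assumes "finite J" "\<And>s. s \<in> J \<Longrightarrow> 0 \<le> s" "\<And>s. A s \<in> sets borel"
  shows "\<exists>\<phi>\<in>borel_measurable borel. \<forall>t\<ge>0. \<forall>x. \<forall>\<Lambda>\<in>sets (raw_filtration X (ennreal t)).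
     emeasure (P x) {\<omega>\<in>\<Lambda>. X t \<omega> \<noteq> None \<and> (\<forall>s\<in>J. X (t + s) \<omega> \<in> Some ` A s)} =
     (\<integral>\<^sup>+\<omega>. indicator \<Lambda> \<omega> * observe X \<phi> t \<omega> \<partial>P x)"
  using assms
proof (induction "card J" arbitrary: J A)
  case 0
  then have "J = {}" by simp
  show ?case
  proof (intro bexI[of _ "\<lambda>_. 1"] allI impI ballI)
    fix t x \<Lambda> assume t: "0 \<le> (t::real)" and \<Lambda>: "\<Lambda> \<in> sets (raw_filtration X (ennreal t))"
    have "\<Lambda> \<in> sets (P x)" using \<Lambda> sets_raw_filtration_mono[of "ennreal t" \<infinity> X] by (auto simp: sets_P)
    then have "\<Lambda> \<inter> {\<omega>. X t \<omega> \<noteq> None} \<in> sets (P x)" using alive_sets_P[OF t] by (rule sets.Int)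
    then have "emeasure (P x) (\<Lambda> \<inter> {\<omega>. X t \<omega> \<noteq> None}) =
        (\<integral>\<^sup>+\<omega>. indicator (\<Lambda> \<inter> {\<omega>. X t \<omega> \<noteq> None}) \<omega> \<partial>P x)" by simp
    also have "\<dots> = (\<integral>\<^sup>+\<omega>. indicator \<Lambda> \<omega> * observe X (\<lambda>_. 1) t \<omega> \<partial>P x)"
      unfolding observe_one indicator_inter_arith ..
    finally show "emeasure (P x) {\<omega>\<in>\<Lambda>. X t \<omega> \<noteq> None \<and> (\<forall>s\<in>J. X (t + s) \<omega> \<in> Some ` A s)} =
     (\<integral>\<^sup>+\<omega>. indicator \<Lambda> \<omega> * observe X (\<lambda>_. 1) t \<omega> \<partial>P x)"
      by (simp add: \<open>J = {}\<close> Int_def)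
  qed simp
next
  case (Suc n)
  define m where "m = Min J"
  have J: "finite J" "J \<noteq> {}" using Suc by auto
  then have m: "m \<in> J" "\<And>s. s \<in> J \<Longrightarrow> m \<le> s" unfolding m_def by auto
  define J' where "J' = (\<lambda>s. s - m) ` (J - {m})"
  define A' where "A' = (\<lambda>s. A (s + m))"
  have "card J' = card (J - {m})" unfolding J'_def by (rule card_image) (simp add: inj_on_def)
  then have "n = card J'" using Suc(2) m(1) J by simp
  moreover have "finite J'" "\<And>s. s \<in> J' \<Longrightarrow> 0 \<le> s" "\<And>s. A' s \<in> sets borel"
    unfolding J'_def A'_def using J m(2) Suc.prems(3) by auto
  ultimately obtain \<phi>' where \<phi>': "\<phi>' \<in> borel_measurable borel"
    "\<And>t x \<Lambda>. 0 \<le> t \<Longrightarrow> \<Lambda> \<in> sets (raw_filtration X (ennreal t)) \<Longrightarrow>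
     emeasure (P x) {\<omega>\<in>\<Lambda>. X t \<omega> \<noteq> None \<and> (\<forall>s\<in>J'. X (t + s) \<omega> \<in> Some ` A' s)} =
     (\<integral>\<^sup>+\<omega>. indicator \<Lambda> \<omega> * observe X \<phi>' t \<omega> \<partial>P x)"
    using Suc(1)[of J' A'] by blast
  have [measurable]: "A m \<in> sets borel" "\<phi>' \<in> borel_measurable borel"
    using Suc.prems(3) \<phi>'(1) by auto
  have m0: "0 \<le> m" using Suc.prems(2) m(1) by blast
  define f where "f = (\<lambda>z. indicator (A m) z * \<phi>' z)"
  have f: "f \<in> borel_measurable borel" unfolding f_def by measurable
  show ?case
  proof (intro bexI[of _ "\<lambda>y. \<integral>\<^sup>+z. f z \<partial>transition X P m y"] allI impI ballI)
    fix t x \<Lambda> assume t: "0 \<le> (t::real)" and \<Lambda>: "\<Lambda> \<in> sets (raw_filtration X (ennreal t))"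
    \<comment> \<open>The observation at the earliest time becomes part of the past, and the
      induction hypothesis is applied from time \<open>t + m\<close> on with the times shifted by
      \<open>m\<close>.\<close>
    define \<Lambda>' where "\<Lambda>' = \<Lambda> \<inter> {\<omega>. X (t + m) \<omega> \<in> Some ` A m}"
    have "\<Lambda> \<in> sets (raw_filtration X (ennreal (t + m)))"
      using \<Lambda> sets_raw_filtration_mono[of "ennreal t" "ennreal (t + m)" X] m0 t
      by (auto simp: ennreal_leI)
    then have \<Lambda>': "\<Lambda>' \<in> sets (raw_filtration X (ennreal (t + m)))"
      unfolding \<Lambda>'_def using t m0 Suc.prems(3) by (intro sets.Int in_sets_raw_filtration) auto
    have J_eq: "J = insert m ((\<lambda>s. s + m) ` J')" unfolding J'_def using m(1) by (auto simp: image_iff)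
    have "{\<omega>\<in>\<Lambda>. X t \<omega> \<noteq> None \<and> (\<forall>s\<in>J. X (t + s) \<omega> \<in> Some ` A s)} =
        {\<omega>\<in>\<Lambda>'. X (t + m) \<omega> \<noteq> None \<and> (\<forall>s\<in>J'. X (t + m + s) \<omega> \<in> Some ` A' s)}"
      (is "?L = ?R")
    proof -
      have "X t \<omega> \<noteq> None" if "X (t + m) \<omega> \<in> Some ` A m" for \<omega>
        using that absorbing[of t "t + m" \<omega>] t m0 by (cases "X t \<omega>") auto
      moreover have "X (t + m) \<omega> \<noteq> None" if "X (t + m) \<omega> \<in> Some ` A m" for \<omega>
        using that by auto
      ultimately show ?thesis
        unfolding J_eq \<Lambda>'_def A'_def by (auto simp: algebra_simps simp del: not_None_eq)
    qed
    then have "emeasure (P x) ?L = (\<integral>\<^sup>+\<omega>. indicator \<Lambda>' \<omega> * observe X \<phi>' (t + m) \<omega> \<partial>P x)"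
      using \<phi>'(2)[OF _ \<Lambda>', of x] t m0 by simp
    also have "\<dots> = (\<integral>\<^sup>+\<omega>. indicator \<Lambda> \<omega> * observe X f (t + m) \<omega> \<partial>P x)"
      unfolding \<Lambda>'_def f_def observe_def
      by (intro nn_integral_cong) (auto simp: indicator_def split: option.splits)
    also have "\<dots> = (\<integral>\<^sup>+\<omega>. indicator \<Lambda> \<omega> * observe X (\<lambda>y. \<integral>\<^sup>+z. f z \<partial>transition X P m y) t \<omega> \<partial>P x)"
      by (rule markov_integral[OF \<Lambda> t m0 f])
    finally show "emeasure (P x) ?L = \<dots>" .
  qed (rule transition_integral_measurable[OF m0 f])
qed

text \<open>Normality identifies \<open>\<phi>\<close>: at time 0 the path sits at its starting
  point \<open>y\<close>, so the expectation of \<open>observe X \<phi> 0\<close> under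
  \<open>P y\<close> is \<open>\<phi> y\<close>.\<close>

lemma markov_cylinder:
  assumes "finite J" "\<And>s. s \<in> J \<Longrightarrow> 0 \<le> s" "\<And>s. A s \<in> sets borel" and t: "0 \<le> t"
  shows "emeasure (P x) {\<omega>. X t \<omega> \<noteq> None \<and> (\<forall>s\<in>J. X (t + s) \<omega> \<in> Some ` A s)} =
    (\<integral>\<^sup>+y. emeasure (P y) {\<omega>. \<forall>s\<in>J. X s \<omega> \<in> Some ` A s} \<partial>transition X P t x)"
proof -
  obtain \<phi> where \<phi>: "\<phi> \<in> borel_measurable borel"
    "\<And>t x \<Lambda>. 0 \<le> t \<Longrightarrow> \<Lambda> \<in> sets (raw_filtration X (ennreal t)) \<Longrightarrow>
     emeasure (P x) {\<omega>\<in>\<Lambda>. X t \<omega> \<noteq> None \<and> (\<forall>s\<in>J. X (t + s) \<omega> \<in> Some ` A s)} =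
     (\<integral>\<^sup>+\<omega>. indicator \<Lambda> \<omega> * observe X \<phi> t \<omega> \<partial>P x)"
    using cylinder_kernel[of J A, OF assms(1-3)] by blast
  have U: "UNIV \<in> sets (raw_filtration X u)" for u using sets.top[of "raw_filtration X u"] by simp
  have start: "emeasure (P y) {\<omega>. \<forall>s\<in>J. X s \<omega> \<in> Some ` A s} = \<phi> y" for y
  proof -
    have "emeasure (P y) {\<omega>. \<forall>s\<in>J. X s \<omega> \<in> Some ` A s} =
        emeasure (P y) {\<omega>. X 0 \<omega> \<noteq> None \<and> (\<forall>s\<in>J. X (0 + s) \<omega> \<in> Some ` A s)}"
    proof (rule emeasure_eq_AE)
      have *: "{\<omega>. \<forall>s\<in>J. X s \<omega> \<in> Some ` A s} \<in> sets (P y)"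
      proof -
        have "(\<Inter>s\<in>J. {\<omega>. X s \<omega> \<in> Some ` A s}) \<in> sets (P y)" if "J \<noteq> {}"
          using that assms in_sets_P by (intro sets.finite_INT) auto
        moreover have "{\<omega>. \<forall>s\<in>J. X s \<omega> \<in> Some ` A s} = (if J = {} then UNIV else (\<Inter>s\<in>J. {\<omega>. X s \<omega> \<in> Some ` A s}))"
          by auto
        ultimately show ?thesis using sets.top[of "P y"] by simp
      qed
      then show "{\<omega>. \<forall>s\<in>J. X s \<omega> \<in> Some ` A s} \<in> sets (P y)" .
      show "{\<omega>. X 0 \<omega> \<noteq> None \<and> (\<forall>s\<in>J. X (0 + s) \<omega> \<in> Some ` A s)} \<in> sets (P y)"
        using sets.Int[OF alive_sets_P[of 0 y] *] by (simp add: Int_def)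
      show "AE \<omega> in P y. \<omega> \<in> {\<omega>. \<forall>s\<in>J. X s \<omega> \<in> Some ` A s} \<longleftrightarrow>
         \<omega> \<in> {\<omega>. X 0 \<omega> \<noteq> None \<and> (\<forall>s\<in>J. X (0 + s) \<omega> \<in> Some ` A s)}"
        using normal[of y] by eventually_elim auto
    qed
    also have "\<dots> = (\<integral>\<^sup>+\<omega>. observe X \<phi> 0 \<omega> \<partial>P y)" using \<phi>(2)[of 0 UNIV y] U by simp
    also have "\<dots> = (\<integral>\<^sup>+\<omega>. \<phi> y \<partial>P y)"
      using normal[of y] by (intro nn_integral_cong_AE) (auto simp: observe_def)
    finally show ?thesis by simp
  qed
  show ?thesis unfolding start using \<phi>(2)[OF t U, of x] nn_integral_transition[OF t \<phi>(1), of x] by simp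
qed

section \<open>The Markov property for functionals of the whole path\<close>

lemma shift_measurable:
  assumes "0 \<le> t"
  shows "\<theta> t \<in> raw_filtration X \<infinity> \<rightarrow>\<^sub>M raw_filtration X \<infinity>"
proof (subst (2) raw_filtration_def, rule measurable_measure_of)
  fix B assume "B \<in> {X s -` Some ` A |s A. 0 \<le> s \<and> ennreal s \<le> \<infinity> \<and> A \<in> sets borel}"
  then obtain s A where B: "B = X s -` Some ` A" "0 \<le> s" "A \<in> sets borel" by blast
  have "\<theta> t -` B \<inter> space (raw_filtration X \<infinity>) = {\<omega>. X (s + t) \<omega> \<in> Some ` A}"
    using shift[OF B(2) assms] by (auto simp: B(1))
  also have "\<dots> \<in> sets (raw_filtration X \<infinity>)"
    using B assms by (intro in_sets_raw_filtration) auto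
  finally show "\<theta> t -` B \<inter> space (raw_filtration X \<infinity>) \<in> sets (raw_filtration X \<infinity>)" .
qed auto

lemma shift_measurable_restrict:
  assumes "0 \<le> t"
  shows "\<theta> t \<in> restrict_space (P x) A \<rightarrow>\<^sub>M raw_filtration X \<infinity>"
  using shift_measurable[OF assms]
  by (intro measurable_restrict_space1) (simp add: measurable_cong_sets[OF sets_P refl])

lemma P_measurable_transition: "P \<in> transition X P t x \<rightarrow>\<^sub>M subprob_algebra (raw_filtration X \<infinity>)"
  using P_measurable by (simp add: measurable_cong_sets[OF sets_transition refl])

text \<open>Both sides are finite measures agreeing on finite-dimensional cylinders, which are
  stable under intersection. Paths dead at time \<open>t\<close> are excluded on the left and carry
  no mass in \<open>transition\<close> on the right.\<close>

theorem markov_measure: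
  assumes t: "0 \<le> t"
  shows "distr (restrict_space (P x) {\<omega>. X t \<omega> \<noteq> None}) (raw_filtration X \<infinity>) (\<theta> t) =
    transition X P t x \<bind> P"
proof -
  define E where "E = {{\<omega>. \<forall>s\<in>J. X s \<omega> \<in> Some ` A s} | J A.
     finite J \<and> (\<forall>s\<in>J. 0 \<le> s) \<and> (\<forall>s. A s \<in> sets borel)}"
  have E_eq: "sets (raw_filtration X \<infinity>) = sigma_sets UNIV E"
  proof (intro equalityI)
    show "sets (raw_filtration X \<infinity>) \<subseteq> sigma_sets UNIV E"
      unfolding sets_raw_filtration
    proof (rule sigma_sets_mono'; rule subsetI)
      fix B assume "B \<in> {X s -` Some ` A |s A. 0 \<le> s \<and> ennreal s \<le> \<infinity> \<and> A \<in> sets borel}"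
      then obtain s A where "B = X s -` Some ` A" "0 \<le> s" "A \<in> sets borel" by blast
      then show "B \<in> E" unfolding E_def
        by (intro CollectI exI[of _ "{s}"] exI[of _ "\<lambda>_. A"]) auto
    qed
    have "E \<subseteq> sets (raw_filtration X \<infinity>)"
    proof
      fix B assume "B \<in> E"
      then obtain J A where B: "B = {\<omega>. \<forall>s\<in>J. X s \<omega> \<in> Some ` A s}" "finite J"
        "\<And>s. s \<in> J \<Longrightarrow> 0 \<le> s" "\<And>s. A s \<in> sets borel" unfolding E_def by blast
      have "(\<Inter>s\<in>J. {\<omega>. X s \<omega> \<in> Some ` A s}) \<in> sets (raw_filtration X \<infinity>)" if "J \<noteq> {}"
        using that B in_sets_raw_filtration[of _ \<infinity> _ X] by (intro sets.finite_INT) auto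
      moreover have "B = (if J = {} then UNIV else (\<Inter>s\<in>J. {\<omega>. X s \<omega> \<in> Some ` A s}))"
        unfolding B(1) by auto
      ultimately show "B \<in> sets (raw_filtration X \<infinity>)" using sets.top[of "raw_filtration X \<infinity>"] by simp
    qed
    then show "sigma_sets UNIV E \<subseteq> sets (raw_filtration X \<infinity>)"
      using sets.sigma_sets_subset[of E "raw_filtration X \<infinity>"] by simp
  qed
  have alive: "{\<omega>. X t \<omega> \<noteq> None} \<in> sets (P x)" by (rule alive_sets_P[OF t])
  have distr_eq: "emeasure (distr (restrict_space (P x) {\<omega>. X t \<omega> \<noteq> None}) (raw_filtration X \<infinity>) (\<theta> t)) N =
      emeasure (P x) {\<omega>. X t \<omega> \<noteq> None \<and> \<theta> t \<omega> \<in> N}" if "N \<in> sets (raw_filtration X \<infinity>)" for N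
    using that alive
    by (subst emeasure_distr[OF shift_measurable_restrict[OF t]])
       (auto simp: emeasure_restrict_space space_restrict_space intro!: arg_cong[where f="emeasure (P x)"])
  have bind_eq: "emeasure (transition X P t x \<bind> P) N = (\<integral>\<^sup>+y. emeasure (P y) N \<partial>transition X P t x)"
    if "N \<in> sets (raw_filtration X \<infinity>)" for N
    using that by (intro emeasure_bind[OF _ P_measurable_transition]) auto
  show ?thesis
  proof (rule measure_eqI_generator_eq[where E = E and \<Omega> = UNIV and A = "\<lambda>_. UNIV"])
    show "Int_stable E"
    proof (rule Int_stableI)
      fix a b assume "a \<in> E" "b \<in> E"
      then obtain J A K B where ab: "a = {\<omega>. \<forall>s\<in>J. X s \<omega> \<in> Some ` A s}" "finite J"
        "\<And>s. s \<in> J \<Longrightarrow> 0 \<le> s" "\<And>s. A s \<in> sets borel"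
        "b = {\<omega>. \<forall>s\<in>K. X s \<omega> \<in> Some ` B s}" "finite K"
        "\<And>s. s \<in> K \<Longrightarrow> 0 \<le> s" "\<And>s. B s \<in> sets borel" unfolding E_def by blast
      show "a \<inter> b \<in> E" unfolding E_def
      \<comment> \<open>At a time observed by only one of the two cylinders, the other contributes
        \<open>UNIV\<close>; survival at that time is already required by the first.\<close>
      proof (intro CollectI exI[of _ "J \<union> K"]
          exI[of _ "\<lambda>s. (if s \<in> J then A s else UNIV) \<inter> (if s \<in> K then B s else UNIV)"] conjI)
        show "a \<inter> b = {\<omega>. \<forall>s\<in>J \<union> K. X s \<omega> \<in> Some ` ((if s \<in> J then A s else UNIV) \<inter> (if s \<in> K then B s else UNIV))}"
          unfolding ab(1,5) by (auto simp: image_Int[OF inj_Some] split: if_splits)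
      qed (use ab in auto)
    qed
    show "emeasure (distr (restrict_space (P x) {\<omega>. X t \<omega> \<noteq> None}) (raw_filtration X \<infinity>) (\<theta> t)) N =
        emeasure (transition X P t x \<bind> P) N" if "N \<in> E" for N
    proof -
      have N: "N \<in> sets (raw_filtration X \<infinity>)" using that E_eq by auto
      from that obtain J A where "N = {\<omega>. \<forall>s\<in>J. X s \<omega> \<in> Some ` A s} \<and>
          finite J \<and> (\<forall>s\<in>J. 0 \<le> s) \<and> (\<forall>s. A s \<in> sets borel)"
        unfolding E_def mem_Collect_eq by (elim exE)
      then have JA: "N = {\<omega>. \<forall>s\<in>J. X s \<omega> \<in> Some ` A s}" "finite J"
        "\<And>s. s \<in> J \<Longrightarrow> 0 \<le> s" "\<And>s. A s \<in> sets borel" by auto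
      have "{\<omega>. X t \<omega> \<noteq> None \<and> \<theta> t \<omega> \<in> N} =
          {\<omega>. X t \<omega> \<noteq> None \<and> (\<forall>s\<in>J. X (t + s) \<omega> \<in> Some ` A s)}"
      proof -
        have "X s (\<theta> t \<omega>) = X (t + s) \<omega>" if "s \<in> J" for s \<omega>
          using shift[OF JA(3)[OF that] t] by (simp add: add.commute)
        then show ?thesis unfolding JA(1) by simp
      qed
      then show ?thesis
        unfolding distr_eq[OF N] bind_eq[OF N] using markov_cylinder[OF JA(2-4) t, of x]
        by (simp add: JA(1))
    qed
    show "sets (transition X P t x \<bind> P) = sigma_sets UNIV E"
      using E_eq by (subst sets_bind[OF sets_kernel[OF P_measurable_transition]]) auto
    show "range (\<lambda>_. UNIV) \<subseteq> E"
      unfolding E_def by (auto intro!: exI[of _ "{}"] exI[of _ "\<lambda>_. UNIV"])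
    show "emeasure (distr (restrict_space (P x) {\<omega>. X t \<omega> \<noteq> None}) (raw_filtration X \<infinity>) (\<theta> t)) UNIV \<noteq> \<infinity>"
    proof -
      interpret prob_space "P x" by (rule prob_space_P)
      have "UNIV \<in> sets (raw_filtration X \<infinity>)" using sets.top[of "raw_filtration X \<infinity>"] by simp
      from distr_eq[OF this] show ?thesis by (simp add: emeasure_eq_measure)
    qed
  qed (use E_eq in auto)
qed

lemma markov_nn_integral:
  assumes t: "0 \<le> t" and F: "F \<in> borel_measurable (raw_filtration X \<infinity>)"
  shows "(\<integral>\<^sup>+\<omega>. F (\<theta> t \<omega>) * indicator {\<omega>. X t \<omega> \<noteq> None} \<omega> \<partial>P x) =
    (\<integral>\<^sup>+y. (\<integral>\<^sup>+\<omega>. F \<omega> \<partial>P y) \<partial>transition X P t x)"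
proof -
  have "(\<integral>\<^sup>+y. (\<integral>\<^sup>+\<omega>. F \<omega> \<partial>P y) \<partial>transition X P t x) = (\<integral>\<^sup>+\<omega>. F \<omega> \<partial>(transition X P t x \<bind> P))"
    using F by (subst nn_integral_bind[OF _ P_measurable_transition]) auto
  also have "\<dots> = (\<integral>\<^sup>+\<omega>. F (\<theta> t \<omega>) \<partial>restrict_space (P x) {\<omega>. X t \<omega> \<noteq> None})"
    unfolding markov_measure[OF t, symmetric]
    using F by (intro nn_integral_distr shift_measurable_restrict t) auto
  also have "\<dots> = (\<integral>\<^sup>+\<omega>. F (\<theta> t \<omega>) * indicator {\<omega>. X t \<omega> \<noteq> None} \<omega> \<partial>P x)"
    using alive_sets_P[OF t] by (subst nn_integral_restrict_space) auto
  finally show ?thesis ..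
qed

end

section \<open>Hitting times\<close>

lemma Inf_ennreal_shift:
  assumes c: "0 \<le> c" and S: "\<And>s. s \<in> S \<Longrightarrow> 0 \<le> s"
  shows "Inf (ennreal ` ((\<lambda>s. c + s) ` S)) = ennreal c + Inf (ennreal ` S)"
proof (cases "S = {}")
  case False
  have "Inf (ennreal ` ((\<lambda>s. c + s) ` S)) = (INF s\<in>S. ennreal c + ennreal s)"
    unfolding image_image using c S by (intro INF_cong refl) simp
  also have "\<dots> = ennreal c + (INF s\<in>S. ennreal s)"
  proof (rule antisym)
    have "(INF s\<in>S. ennreal c + ennreal s) - ennreal c \<le> (INF s\<in>S. ennreal s)"
    proof (rule INF_greatest)
      fix s assume "s \<in> S"
      then have "(INF s\<in>S. ennreal c + ennreal s) \<le> ennreal c + ennreal s" by (rule INF_lower)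
      then show "(INF s\<in>S. ennreal c + ennreal s) - ennreal c \<le> ennreal s"
        by (simp add: ennreal_minus_le_iff)
    qed
    then show "(INF s\<in>S. ennreal c + ennreal s) \<le> ennreal c + (INF s\<in>S. ennreal s)"
      by (simp add: ennreal_minus_le_iff)
    show "ennreal c + (INF s\<in>S. ennreal s) \<le> (INF s\<in>S. ennreal c + ennreal s)"
      by (intro INF_greatest add_left_mono INF_lower)
  qed
  finally show ?thesis .
qed simp

text \<open>The value 0 at infinity, also for \<open>l = 0\<close>, builds the restriction to a
  finite hitting time into the integrand and makes \<open>discount_add\<close> hold without
  exceptions.\<close>

definition discount :: "real \<Rightarrow> ennreal \<Rightarrow> ennreal" where
  "discount l s = (if s < \<infinity> then ennreal (exp (- l * enn2real s)) else 0)"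

lemma discount_measurable [measurable]: "discount l \<in> borel_measurable borel"
  unfolding discount_def[abs_def] by measurable

lemma discount_infinity [simp]: "discount l \<top> = 0"
  by (simp add: discount_def)

lemma discount_add:
  assumes "0 \<le> c"
  shows "discount l (ennreal c + s) = ennreal (exp (- l * c)) * discount l s"
proof (cases "s < \<infinity>")
  case True
  then have "enn2real (ennreal c + s) = c + enn2real s"
    using assms by (subst enn2real_plus) auto
  then show ?thesis
    using True by (simp add: discount_def ennreal_mult[symmetric] exp_add[symmetric] algebra_simps)
qed (auto simp: discount_def not_less top_unique)

lemma discount_le_1: "0 \<le> l \<Longrightarrow> discount l s \<le> 1"
  by (auto simp: discount_def ennreal_le_1)

section \<open>Measurability of hitting times\<close>

context borel_right_process
begin

text \<open>Right continuity gives joint measurability in time and path: the position at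
  \<open>t\<close> is the limit of the positions at grid times \<open>d n t\<close>, which as
  functions of \<open>t\<close> are step functions. For open \<open>U\<close>, the path is in
  \<open>U\<close> at \<open>t\<close> iff these positions eventually stay in one of the sets
  \<open>V k\<close>.\<close>

lemma occupation_measurable_open:
  assumes U: "open U"
  shows "{(t, \<omega>). 0 \<le> t \<and> X t \<omega> \<in> Some ` U} \<in> sets (borel \<Otimes>\<^sub>M raw_filtration X \<infinity>)" (is "?H U \<in> sets ?B")
proof -
  \<comment> \<open>The summand 1 puts the grid time strictly to the right of \<open>t\<close>, the
    only side on which the paths are continuous.\<close>
  define d where "d n t = (real_of_int \<lfloor>real (Suc n) * t\<rfloor> + 1) / real (Suc n)" for n and t :: real
  have d_gt: "t < d n t" and d_le: "d n t \<le> t + 1 / real (Suc n)" for n t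
  proof -
    have "real (Suc n) * t < real_of_int \<lfloor>real (Suc n) * t\<rfloor> + 1" by linarith
    then show "t < d n t" unfolding d_def by (simp add: pos_less_divide_eq mult.commute)
    have "real_of_int \<lfloor>real (Suc n) * t\<rfloor> + 1 \<le> real (Suc n) * t + 1" by linarith
    then have "d n t \<le> (real (Suc n) * t + 1) / real (Suc n)"
      unfolding d_def by (rule divide_right_mono) simp
    also have "\<dots> = t + 1 / real (Suc n)" by (simp add: field_simps)
    finally show "d n t \<le> t + 1 / real (Suc n)" .
  qed
  have d_lim: "filterlim (\<lambda>n. d n t) (at_right t) sequentially" for t
  proof -
    have "(\<lambda>n. t + 1 / real (Suc n)) \<longlonglongrightarrow> t + 0"
      by (intro tendsto_add tendsto_const LIMSEQ_inverse_real_of_nat[unfolded inverse_eq_divide])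
    then have "(\<lambda>n. d n t) \<longlonglongrightarrow> t"
      using d_gt[of t] d_le[of _ t]
      by (intro real_tendsto_sandwich[of "\<lambda>_. t" "\<lambda>n. d n t" sequentially "\<lambda>n. t + 1 / real (Suc n)" t])
         (auto intro!: always_eventually less_imp_le)
    moreover have "d n t \<noteq> t" for n using d_gt[of t n] by simp
    ultimately show ?thesis
      using d_gt by (auto simp: filterlim_at intro!: always_eventually)
  qed
  \<comment> \<open>Points at distance at least \<open>1/(k+1)\<close> from the complement of
    \<open>U\<close>: a limit of points of \<open>V k\<close> stays in \<open>U\<close>, while a
    limit of points of \<open>U\<close> may leave it.\<close>
  define V where "V k = {y. \<forall>z. dist y z < 1 / real (Suc k) \<longrightarrow> z \<in> U}" for k
  have V_borel: "V k \<in> sets borel" for k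
  proof -
    have "V k = (\<Inter>z\<in>-U. {y. 1 / real (Suc k) \<le> dist y z})" unfolding V_def by force
    moreover have "closed \<dots>" by (intro closed_INT ballI closed_Collect_le continuous_intros)
    ultimately show ?thesis by simp
  qed
  have at_d: "{(t, \<omega>). 0 \<le> t \<and> X (d n t) \<omega> \<in> Some ` V k} \<in> sets ?B" for n k
  proof -
    have "{(t, \<omega>). 0 \<le> t \<and> X (d n t) \<omega> \<in> Some ` V k} =
      (\<Union>j::nat. {t. 0 \<le> t \<and> \<lfloor>real (Suc n) * t\<rfloor> = int j} \<times>
         {\<omega>. X ((real j + 1) / real (Suc n)) \<omega> \<in> Some ` V k})" (is "?L = ?R")
    proof (intro equalityI subsetI)
      fix z assume "z \<in> ?L"
      then obtain t \<omega> where z: "z = (t, \<omega>)" "0 \<le> t" "X (d n t) \<omega> \<in> Some ` V k" by blast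
      have "0 \<le> \<lfloor>real (Suc n) * t\<rfloor>" using z(2) by simp
      then obtain j where "\<lfloor>real (Suc n) * t\<rfloor> = int j" using nonneg_int_cases by blast
      then show "z \<in> ?R" using z unfolding d_def by auto
    next
      fix z assume "z \<in> ?R"
      then show "z \<in> ?L" unfolding d_def by auto
    qed
    moreover have "{t. 0 \<le> t \<and> \<lfloor>real (Suc n) * t\<rfloor> = int j} \<in> sets borel" for j
      by measurable
    moreover have "{\<omega>. X ((real j + 1) / real (Suc n)) \<omega> \<in> Some ` V k} \<in> sets (raw_filtration X \<infinity>)" for j
      using V_borel by (intro in_sets_raw_filtration) auto
    ultimately show ?thesis by auto
  qed
  have "?H U = (\<Union>k N. \<Inter>n\<in>{N..}. {(t, \<omega>). 0 \<le> t \<and> X (d n t) \<omega> \<in> Some ` V k})" (is "_ = ?R")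
  proof (intro equalityI subsetI)
    fix z assume "z \<in> ?H U"
    then obtain t \<omega> y where z: "z = (t, \<omega>)" "0 \<le> t" "X t \<omega> = Some y" "y \<in> U" by auto
    obtain e where e: "0 < e" "ball y e \<subseteq> U" using U z(4) open_contains_ball by blast
    obtain k where k: "2 / real (Suc k) < e"
    proof -
      obtain k where "inverse (real (Suc k)) < e / 2"
        using reals_Archimedean[of "e / 2"] e(1) by auto
      then show ?thesis using that by (simp add: field_simps)
    qed
    have sub: "ball y (1 / real (Suc k)) \<subseteq> V k"
    proof
      fix w assume w: "w \<in> ball y (1 / real (Suc k))"
      show "w \<in> V k" unfolding V_def
      proof (intro CollectI allI impI)
        fix v assume "dist w v < 1 / real (Suc k)"
        then have "dist y v < 2 / real (Suc k)"
          using w dist_triangle[of y v w] by (simp add: mem_ball)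
        then show "v \<in> U" using k e(2) by (auto simp: mem_ball)
      qed
    qed
    have "\<forall>\<^sub>F s in at_right t. X s \<omega> \<in> Some ` ball y (1 / real (Suc k))"
      by (rule right_continuous_paths[OF z(2,3)]) auto
    then have "\<forall>\<^sub>F n in sequentially. X (d n t) \<omega> \<in> Some ` ball y (1 / real (Suc k))"
      using d_lim[of t] unfolding filterlim_iff by blast
    then obtain N where "\<And>n. n \<ge> N \<Longrightarrow> X (d n t) \<omega> \<in> Some ` V k"
      using sub unfolding eventually_sequentially by blast
    then show "z \<in> ?R" using z by auto
  next
    fix z assume "z \<in> ?R"
    then obtain k N where kN: "\<And>n. n \<ge> N \<Longrightarrow> z \<in> {(t, \<omega>). 0 \<le> t \<and> X (d n t) \<omega> \<in> Some ` V k}"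
      by blast
    obtain t \<omega> where z: "z = (t, \<omega>)" by (cases z)
    have kN: "0 \<le> t" "\<And>n. n \<ge> N \<Longrightarrow> X (d n t) \<omega> \<in> Some ` V k"
      using kN unfolding z by blast+
    have "X t \<omega> \<noteq> None"
      using absorbing[of t "d N t" \<omega>] d_gt[of t N] kN(1) kN(2)[of N] by (cases "X t \<omega>") auto
    then obtain y where y: "X t \<omega> = Some y" by blast
    have "\<forall>\<^sub>F s in at_right t. X s \<omega> \<in> Some ` ball y (1 / real (Suc k))"
      by (rule right_continuous_paths[OF kN(1) y]) auto
    then have "\<forall>\<^sub>F n in sequentially. X (d n t) \<omega> \<in> Some ` ball y (1 / real (Suc k))"
      using d_lim[of t] unfolding filterlim_iff by blast
    then obtain M where M: "\<And>n. n \<ge> M \<Longrightarrow> X (d n t) \<omega> \<in> Some ` ball y (1 / real (Suc k))"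
      unfolding eventually_sequentially by blast
    obtain w where w: "X (d (max M N) t) \<omega> = Some w" "w \<in> V k" "dist y w < 1 / real (Suc k)"
      using M[of "max M N"] kN(2)[of "max M N"] by auto
    then have "y \<in> U" unfolding V_def by (simp add: dist_commute)
    then show "z \<in> ?H U" using z y kN(1) by auto
  qed
  moreover have "(\<Inter>n\<in>{N..}. {(t, \<omega>). 0 \<le> t \<and> X (d n t) \<omega> \<in> Some ` V k}) \<in> sets ?B" for N k
    using at_d by (intro sets.countable_INT) auto
  ultimately show ?thesis by auto
qed

lemma occupation_measurable:
  assumes "A \<in> sets borel"
  shows "{(t, \<omega>). 0 \<le> t \<and> X t \<omega> \<in> Some ` A} \<in> sets (borel \<Otimes>\<^sub>M raw_filtration X \<infinity>)" (is "?H A \<in> sets ?B")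
proof -
  have "A \<in> sigma_sets UNIV {U. open U}" using assms by (simp add: borel_def)
  then show ?thesis
  proof induction
    case (Basic U)
    then show ?case using occupation_measurable_open[of U] by simp
  next
    case Empty
    then show ?case by simp
  next
    case (Compl A)
    have "?H (UNIV - A) = ?H UNIV - ?H A" by auto
    then show ?case using Compl occupation_measurable_open[OF open_UNIV] by auto
  next
    case (Union A)
    have "?H (\<Union>i. A i) = (\<Union>i. ?H (A i))" by auto
    then show ?case using Union by auto
  qed
qed

text \<open>The infimum is below \<open>c\<close> iff some visit occurs before \<open>c\<close>,
  whether or not the infimum is attained. So the event is the projection of a jointly measurable set
  of times and paths.\<close>

lemma hitting_time_measurable_borel:
  assumes M: "finite_measure M" "sets M = sets (raw_filtration X \<infinity>)" and A: "A \<in> sets borel"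
  shows "hitting_time X A \<in> borel_measurable (completion M)"
proof (rule borel_measurableI_less)
  fix c :: ennreal
  have UNIV: "space M = UNIV" using sets_eq_imp_space_eq[OF M(2)] by simp
  have "{t::real. 0 < t \<and> ennreal t < c} \<times> UNIV \<in> sets (borel \<Otimes>\<^sub>M M)"
    using sets.top[of M] UNIV by (intro pair_measureI) auto
  moreover have "{(t, \<omega>). 0 \<le> t \<and> X t \<omega> \<in> Some ` A} \<in> sets (borel \<Otimes>\<^sub>M M)"
    using occupation_measurable[OF A] by (simp only: sets_pair_measure_cong[OF refl M(2)])
  ultimately have "{\<omega>. \<exists>t. (t, \<omega>) \<in> ({t::real. 0 < t \<and> ennreal t < c} \<times> UNIV) \<inter> {(t, \<omega>). 0 \<le> t \<and> X t \<omega> \<in> Some ` A}}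
      \<in> sets (completion M)"
    by (intro measurable_projection M(1) UNIV sets.Int)
  also have "{\<omega>. \<exists>t. (t, \<omega>) \<in> ({t::real. 0 < t \<and> ennreal t < c} \<times> UNIV) \<inter> {(t, \<omega>). 0 \<le> t \<and> X t \<omega> \<in> Some ` A}} =
     {\<omega> \<in> space (completion M). hitting_time X A \<omega> < c}"
    unfolding hitting_time_def by (auto simp: UNIV Inf_less_iff)
  finally show "{\<omega> \<in> space (completion M). hitting_time X A \<omega> < c} \<in> sets (completion M)" .
qed

section \<open>Initial laws and nearly Borel sets\<close>

lemma
  assumes "\<pi> \<in> space (prob_algebra borel)"
  shows sets_law: "sets (law P \<pi>) = sets (raw_filtration X \<infinity>)"
    and prob_space_law: "prob_space (law P \<pi>)"
    and emeasure_law: "N \<in> sets (raw_filtration X \<infinity>) \<Longrightarrow> emeasure (law P \<pi>) N = (\<integral>\<^sup>+y. emeasure (P y) N \<partial>\<pi>)"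
proof -
  have \<pi>: "sets \<pi> = sets borel" "space \<pi> \<noteq> {}"
    using assms by (auto simp: space_prob_algebra dest: sets_eq_imp_space_eq)
  show "sets (law P \<pi>) = sets (raw_filtration X \<infinity>)"
    unfolding law_def using \<pi> by (intro sets_bind[where N = "raw_filtration X \<infinity>"]) (auto simp: sets_P)
  show "prob_space (law P \<pi>)" unfolding law_def by (rule prob_space_bind'[OF assms laws])
  show "N \<in> sets (raw_filtration X \<infinity>) \<Longrightarrow> emeasure (law P \<pi>) N = (\<integral>\<^sup>+y. emeasure (P y) N \<partial>\<pi>)"
    unfolding law_def by (rule emeasure_bind_prob_algebra[OF assms laws])
qed

text \<open>Almost every path avoids \<open>B2 - B1\<close>, and on such a path \<open>A\<close> and
  the Borel set \<open>B1\<close> are visited at the same times. The bracketing sets depend on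
  \<open>\<pi>\<close>, so measurability is obtained for one initial law at a time.\<close>

lemma hitting_time_nearly_borel:
  assumes A: "nearly_borel X P A" and \<pi>: "\<pi> \<in> space (prob_algebra borel)"
  shows "hitting_time X A \<in> borel_measurable (completion (law P \<pi>))"
proof -
  from bspec[OF A[unfolded nearly_borel_def] \<pi>] obtain B1 B2
    where B: "B1 \<in> sets borel" "B1 \<subseteq> A" "A \<subseteq> B2"
      "AE \<omega> in law P \<pi>. \<not> (\<exists>t\<ge>0. X t \<omega> \<in> Some ` (B2 - B1))"
    by (elim bexE conjE)
  have eq: "AE \<omega> in law P \<pi>. hitting_time X B1 \<omega> = hitting_time X A \<omega>"
    using B(4)
  proof eventually_elim
    case (elim \<omega>)
    have "X t \<omega> \<in> Some ` B1 \<longleftrightarrow> X t \<omega> \<in> Some ` A" if "0 < t" for t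
    proof -
      have "X t \<omega> \<notin> Some ` (B2 - B1)" using elim that less_imp_le by blast
      then show ?thesis using B(2,3) by (cases "X t \<omega>") auto
    qed
    then have "{t. 0 < t \<and> X t \<omega> \<in> Some ` B1} = {t. 0 < t \<and> X t \<omega> \<in> Some ` A}" by blast
    then show ?case unfolding hitting_time_def by simp
  qed
  have UNIV: "space (law P \<pi>) = UNIV" using sets_eq_imp_space_eq[OF sets_law[OF \<pi>]] by simp
  have meas: "hitting_time X B1 \<in> borel_measurable (completion (law P \<pi>))"
    using prob_space_law[OF \<pi>] sets_law[OF \<pi>] B(1)
    by (intro hitting_time_measurable_borel) (auto simp: prob_space_def)
  show ?thesis
  proof (rule borel_measurableI_less)
    fix c :: ennreal
    have "{\<omega>. hitting_time X B1 \<omega> < c} \<in> sets (completion (law P \<pi>))"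
      using borel_measurable_less[OF meas borel_measurable_const, of c] UNIV by simp
    note S = this
    have "AE \<omega> in completion (law P \<pi>).
        \<omega> \<in> {\<omega>. hitting_time X B1 \<omega> < c} \<longleftrightarrow> \<omega> \<in> {\<omega>. hitting_time X A \<omega> < c}"
      using AE_completion[OF eq] by eventually_elim simp
    then have "{\<omega>. hitting_time X A \<omega> < c} \<in> sets (completion (law P \<pi>))"
      by (rule completion.in_sets_AE[OF _ S]) (simp add: UNIV)
    then show "{\<omega> \<in> space (completion (law P \<pi>)). hitting_time X A \<omega> < c} \<in> sets (completion (law P \<pi>))"
      by (simp add: UNIV)
  qed
qed

lemma return_in_prob_algebra: "return borel x \<in> space (prob_algebra borel)"
  by (simp add: space_prob_algebra prob_space_return)

lemma hitting_time_measurable: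
  assumes "nearly_borel X P A"
  shows "hitting_time X A \<in> borel_measurable (completion (P x))"
  using hitting_time_nearly_borel[OF assms return_in_prob_algebra[of x]] unfolding law_return .

text \<open>An event that is null for the mixture is null for almost every component, with one raw
  measurable cover \<open>N\<close> common to all starting points.\<close>

lemma AE_law:
  assumes \<pi>: "\<pi> \<in> space (prob_algebra borel)" and ae: "AE \<omega> in law P \<pi>. Q \<omega>"
  shows "\<exists>N\<in>sets (raw_filtration X \<infinity>). {\<omega>. \<not> Q \<omega>} \<subseteq> N \<and> (AE y in \<pi>. emeasure (P y) N = 0)"
proof -
  have UNIV: "space (law P \<pi>) = UNIV" using sets_eq_imp_space_eq[OF sets_law[OF \<pi>]] by simp
  obtain N where N: "{\<omega>. \<not> Q \<omega>} \<subseteq> N" "emeasure (law P \<pi>) N = 0" "N \<in> sets (law P \<pi>)"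
    using AE_E[OF ae] UNIV by auto
  have NM: "N \<in> sets (raw_filtration X \<infinity>)" using N(3) sets_law[OF \<pi>] by simp
  have "(\<integral>\<^sup>+y. emeasure (P y) N \<partial>\<pi>) = 0" using emeasure_law[OF \<pi> NM] N(2) by simp
  moreover have "(\<lambda>y. emeasure (P y) N) \<in> borel_measurable \<pi>"
  proof -
    have "sets \<pi> = sets borel" using \<pi> by (simp add: space_prob_algebra)
    then show ?thesis
      using measurable_emeasure_kernel[OF P_measurable NM]
      by (simp add: measurable_cong_sets[OF \<open>sets \<pi> = sets borel\<close> refl])
  qed
  ultimately have "AE y in \<pi>. emeasure (P y) N = 0" by (simp add: nn_integral_0_iff_AE)
  then show ?thesis using N(1) NM by blast
qed

text \<open>\<open>transition\<close> may lose mass to the cemetery, whereas initial laws are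
  probability measures. Placing the missing mass at \<open>x\<close> yields a probability measure
  that dominates it.\<close>

lemma transition_le_initial_law:
  assumes t: "0 \<le> t"
  shows "\<exists>\<pi>\<in>space (prob_algebra borel). \<forall>N. (AE y in \<pi>. N y) \<longrightarrow> (AE y in transition X P t x. N y)"
proof -
  define g where "g = (\<lambda>\<omega>. case X t \<omega> of None \<Rightarrow> x | Some y \<Rightarrow> y)"
  have vimage: "g -` A = {\<omega>. X t \<omega> \<in> Some ` A} \<union> (if x \<in> A then {\<omega>. X t \<omega> = None} else {})" for A
    unfolding g_def by (auto split: option.splits)
  have g: "g \<in> P x \<rightarrow>\<^sub>M borel"
  proof (rule measurableI)
    fix A :: "'e set" assume A: "A \<in> sets borel"
    have "{\<omega>. X t \<omega> = None} \<in> sets (P x)"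
      using None_in_sets_raw_filtration[of t \<infinity> X] t by (simp add: sets_P)
    then show "g -` A \<inter> space (P x) \<in> sets (P x)" using in_sets_P[OF t A] by (simp add: vimage)
  qed simp
  interpret prob_space "P x" by (rule prob_space_P)
  have "distr (P x) borel g \<in> space (prob_algebra borel)"
    using prob_space_distr[OF g] by (simp add: space_prob_algebra)
  moreover have "AE y in transition X P t x. N y" if N: "AE y in distr (P x) borel g. N y" for N
  proof -
    obtain S where S: "{y. \<not> N y} \<subseteq> S" "emeasure (distr (P x) borel g) S = 0" "S \<in> sets borel"
      using AE_E[OF N] by auto
    have "emeasure (transition X P t x) S = emeasure (P x) {\<omega>. X t \<omega> \<in> Some ` S}"
      by (rule emeasure_transition[OF t S(3)])
    also have "\<dots> \<le> emeasure (P x) (g -` S \<inter> space (P x))"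
      using measurable_sets[OF g S(3)] by (intro emeasure_mono) (auto simp: vimage)
    also have "\<dots> = 0" using S(2,3) emeasure_distr[OF g] by simp
    finally have "S \<in> null_sets (transition X P t x)" using S(3) by (auto intro: null_setsI)
    then show ?thesis by (rule AE_I') (use S(1) in auto)
  qed
  ultimately show ?thesis by blast
qed

text \<open>The Markov property is available only for raw measurable functionals. A raw version
  \<open>F'\<close> is chosen under an initial law \<open>\<pi>\<close> that dominates
  \<open>P_t(x,dy)\<close>; then it is a version under \<open>P y\<close> for almost every
  \<open>y\<close> reached at time \<open>t\<close>, which is all that the right-hand side
  sees.\<close>

lemma markov_hitting_time:
  assumes A: "nearly_borel X P A" and t: "0 \<le> t"
  shows "\<exists>G\<in>borel_measurable (P x). (AE \<omega> in P x. discount l (hitting_time X A (\<theta> t \<omega>)) = G \<omega>) \<and>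
    (\<integral>\<^sup>+\<omega>. G \<omega> \<partial>P x) =
    (\<integral>\<^sup>+y. (\<integral>\<^sup>+\<omega>. discount l (hitting_time X A \<omega>) \<partial>P y) \<partial>transition X P t x)"
proof -
  obtain \<pi> where \<pi>: "\<pi> \<in> space (prob_algebra borel)"
    "\<And>N. (AE y in \<pi>. N y) \<Longrightarrow> (AE y in transition X P t x. N y)"
    using transition_le_initial_law[OF t, of x] by blast
  let ?F = "\<lambda>\<omega>. discount l (hitting_time X A \<omega>)"
  have "?F \<in> borel_measurable (completion (law P \<pi>))"
    using hitting_time_nearly_borel[OF A \<pi>(1)] by measurable
  then obtain F' where F': "F' \<in> borel_measurable (law P \<pi>)" "AE \<omega> in law P \<pi>. ?F \<omega> = F' \<omega>"
    using completion_ex_borel_measurable by blast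
  have F'_meas [measurable]: "F' \<in> borel_measurable (raw_filtration X \<infinity>)"
    using F'(1) by (simp add: measurable_cong_sets[OF sets_law[OF \<pi>(1)] refl])
  obtain N where N: "N \<in> sets (raw_filtration X \<infinity>)" "{\<omega>. \<not> ?F \<omega> = F' \<omega>} \<subseteq> N"
      "AE y in \<pi>. emeasure (P y) N = 0"
    using AE_law[OF \<pi>(1) F'(2)] by blast
  have N0: "AE y in transition X P t x. emeasure (P y) N = 0" by (rule \<pi>(2)[OF N(3)])
  have V: "AE y in transition X P t x. (\<integral>\<^sup>+\<omega>. ?F \<omega> \<partial>P y) = (\<integral>\<^sup>+\<omega>. F' \<omega> \<partial>P y)"
    using N0
  proof eventually_elim
    case (elim y)
    have "AE \<omega> in P y. ?F \<omega> = F' \<omega>"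
      using elim N(1,2) by (intro AE_I'[of N]) (auto simp: sets_P intro: null_setsI)
    then show ?case by (rule nn_integral_cong_AE)
  qed
  define G where "G = (\<lambda>\<omega>. F' (\<theta> t \<omega>) * indicator {\<omega>. X t \<omega> \<noteq> None} \<omega>)"
  have "G \<in> borel_measurable (raw_filtration X \<infinity>)"
    using measurable_compose[OF shift_measurable[OF t] F'_meas] alive_sets_P[OF t, of x]
    unfolding G_def by (intro borel_measurable_times_ennreal borel_measurable_indicator) (auto simp: sets_P)
  then have "G \<in> borel_measurable (P x)" by (simp add: measurable_cong_sets[OF sets_P refl])
  \<comment> \<open>The Markov property for the indicator of \<open>N\<close> shows that the shifted
    path almost surely avoids \<open>N\<close>. If the path is dead at \<open>t\<close>, it hits
    nothing afterwards and both sides are 0.\<close>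
  moreover have "AE \<omega> in P x. ?F (\<theta> t \<omega>) = G \<omega>"
  proof -
    have "(\<integral>\<^sup>+\<omega>. indicator N (\<theta> t \<omega>) * indicator {\<omega>. X t \<omega> \<noteq> None} \<omega> \<partial>P x) =
        (\<integral>\<^sup>+y. (\<integral>\<^sup>+\<omega>. indicator N \<omega> \<partial>P y) \<partial>transition X P t x)"
      using N(1) by (intro markov_nn_integral[OF t]) auto
    also have "\<dots> = (\<integral>\<^sup>+y. 0 \<partial>transition X P t x)"
      using N0 N(1) by (intro nn_integral_cong_AE) (auto simp: sets_P)
    finally have "(\<integral>\<^sup>+\<omega>. indicator N (\<theta> t \<omega>) * indicator {\<omega>. X t \<omega> \<noteq> None} \<omega> \<partial>P x) = 0" by simp
    moreover have "(\<lambda>\<omega>. indicator N (\<theta> t \<omega>) * indicator {\<omega>. X t \<omega> \<noteq> None} \<omega> :: ennreal) \<in> borel_measurable (P x)"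
    proof -
      have "(\<lambda>\<omega>. indicator N (\<theta> t \<omega>) :: ennreal) \<in> borel_measurable (raw_filtration X \<infinity>)"
        by (rule measurable_compose[OF shift_measurable[OF t]]) (use N(1) in auto)
      then show ?thesis
        using alive_sets_P[OF t, of x]
        by (intro borel_measurable_times_ennreal borel_measurable_indicator)
           (auto simp: measurable_cong_sets[OF sets_P refl])
    qed
    ultimately have "AE \<omega> in P x. indicator N (\<theta> t \<omega>) * indicator {\<omega>. X t \<omega> \<noteq> None} \<omega> = (0::ennreal)"
      by (simp add: nn_integral_0_iff_AE)
    then show ?thesis
    proof eventually_elim
      case (elim \<omega>)
      show ?case
      proof (cases "X t \<omega> = None")
        case True
        have "X s (\<theta> t \<omega>) = None" if "0 < s" for s
          using absorbing[of t "s + t" \<omega>] t that shift[of s t \<omega>] True by simp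
        then have "hitting_time X A (\<theta> t \<omega>) = \<top>" unfolding hitting_time_def
          by (auto simp: image_iff intro!: Inf_eqI)
        then show ?thesis unfolding G_def using True by simp
      next
        case False
        then have "\<theta> t \<omega> \<notin> N" using elim by (auto simp: indicator_def split: if_splits)
        then show ?thesis unfolding G_def using False N(2) by auto
      qed
    qed
  qed
  moreover have "(\<integral>\<^sup>+\<omega>. G \<omega> \<partial>P x) =
      (\<integral>\<^sup>+y. (\<integral>\<^sup>+\<omega>. ?F \<omega> \<partial>P y) \<partial>transition X P t x)"
    unfolding G_def markov_nn_integral[OF t F'_meas] by (rule nn_integral_cong_AE[OF V, symmetric])
  ultimately show ?thesis by blast
qed

lemma hitting_time_shift:
  assumes t: "0 \<le> t"
  shows "ennreal t + hitting_time X A (\<theta> t \<omega>) = Inf (ennreal ` {s. t < s \<and> X s \<omega> \<in> Some ` A})"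
proof -
  have "{s. t < s \<and> X s \<omega> \<in> Some ` A} = (\<lambda>s. t + s) ` {s. 0 < s \<and> X s (\<theta> t \<omega>) \<in> Some ` A}"
  proof (intro equalityI subsetI)
    fix s assume "s \<in> {s. t < s \<and> X s \<omega> \<in> Some ` A}"
    then show "s \<in> (\<lambda>s. t + s) ` {s. 0 < s \<and> X s (\<theta> t \<omega>) \<in> Some ` A}"
      using t shift[of "s - t" t \<omega>] by (intro image_eqI[of _ _ "s - t"]) auto
  next
    fix s assume "s \<in> (\<lambda>s. t + s) ` {s. 0 < s \<and> X s (\<theta> t \<omega>) \<in> Some ` A}"
    then obtain r where r: "s = t + r" "0 < r" "X r (\<theta> t \<omega>) \<in> Some ` A" by blast
    then have "X (t + r) \<omega> \<in> Some ` A" using t shift[of r t \<omega>] by (simp add: add.commute)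
    then show "s \<in> {s. t < s \<and> X s \<omega> \<in> Some ` A}" using r by simp
  qed
  moreover have "Inf (ennreal ` ((\<lambda>s. t + s) ` {s. 0 < s \<and> X s (\<theta> t \<omega>) \<in> Some ` A})) =
      ennreal t + hitting_time X A (\<theta> t \<omega>)"
    unfolding hitting_time_def using t by (intro Inf_ennreal_shift) auto
  ultimately show ?thesis by simp
qed

text \<open>Stated as a sum because subtraction in \<open>[0,\<infinity>]\<close> is truncated. The
  comparison is made path by path: with a visit after \<open>\<epsilon>\<close> and up to
  \<open>t\<close>, the left side is at most 1 and the indicator pays for it; without one, the two
  discounted terms are equal. The measurable versions \<open>G\<close> and \<open>H\<close> enter
  only for the integration.\<close>

lemma discounted_hitting_decrement:
  assumes A: "nearly_borel X P A" and l: "0 \<le> l" and t: "0 \<le> \<epsilon>" "\<epsilon> \<le> t"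
  defines "v \<equiv> \<lambda>y. \<integral>\<^sup>+\<omega>. discount l (hitting_time X A \<omega>) \<partial>P y"
  shows "ennreal (exp (- l * \<epsilon>)) * (\<integral>\<^sup>+y. v y \<partial>transition X P \<epsilon> x) \<le>
    emeasure (completion (P x)) {\<omega>. hitting_time X A \<omega> \<le> ennreal t} +
    ennreal (exp (- l * t)) * (\<integral>\<^sup>+y. v y \<partial>transition X P t x)"
proof -
  let ?D = "\<lambda>u \<omega>. discount l (hitting_time X A (\<theta> u \<omega>))"
  let ?C = "completion (P x)"
  have t0: "0 \<le> t" using t by simp
  obtain G where G: "G \<in> borel_measurable (P x)" "AE \<omega> in P x. ?D \<epsilon> \<omega> = G \<omega>"
      "(\<integral>\<^sup>+\<omega>. G \<omega> \<partial>P x) = (\<integral>\<^sup>+y. v y \<partial>transition X P \<epsilon> x)"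
    using markov_hitting_time[OF A t(1), of x l] unfolding v_def by blast
  obtain H where H: "H \<in> borel_measurable (P x)" "AE \<omega> in P x. ?D t \<omega> = H \<omega>"
      "(\<integral>\<^sup>+\<omega>. H \<omega> \<partial>P x) = (\<integral>\<^sup>+y. v y \<partial>transition X P t x)"
    using markov_hitting_time[OF A t0, of x l] unfolding v_def by blast
  have S: "{\<omega>. hitting_time X A \<omega> \<le> ennreal t} \<in> sets ?C"
    using borel_measurable_le[OF hitting_time_measurable[OF A] borel_measurable_const, of x "ennreal t"]
    by simp
  have pointwise: "ennreal (exp (- l * \<epsilon>)) * ?D \<epsilon> \<omega> \<le>
      indicator {\<omega>. hitting_time X A \<omega> \<le> ennreal t} \<omega> + ennreal (exp (- l * t)) * ?D t \<omega>" for \<omega>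
  proof (cases "\<exists>s. \<epsilon> < s \<and> s \<le> t \<and> X s \<omega> \<in> Some ` A")
    case True
    then obtain s where s: "\<epsilon> < s" "s \<le> t" "X s \<omega> \<in> Some ` A" by blast
    then have "hitting_time X A \<omega> \<le> ennreal s"
      unfolding hitting_time_def using t(1) by (intro Inf_lower) auto
    then have "hitting_time X A \<omega> \<le> ennreal t" using s(2) by (auto intro: order_trans ennreal_leI)
    moreover have "ennreal (exp (- l * \<epsilon>)) * ?D \<epsilon> \<omega> \<le> 1"
      using discount_le_1[OF l, of "ennreal \<epsilon> + hitting_time X A (\<theta> \<epsilon> \<omega>)"]
      unfolding discount_add[OF t(1)] .
    ultimately show ?thesis by (auto simp: add_increasing2)
  next
    case False
    then have "{s. \<epsilon> < s \<and> X s \<omega> \<in> Some ` A} = {s. t < s \<and> X s \<omega> \<in> Some ` A}"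
      using t(2) by (auto simp: not_le)
    then have "ennreal \<epsilon> + hitting_time X A (\<theta> \<epsilon> \<omega>) = ennreal t + hitting_time X A (\<theta> t \<omega>)"
      unfolding hitting_time_shift[OF t(1)] hitting_time_shift[OF t0] by simp
    then have "ennreal (exp (- l * \<epsilon>)) * ?D \<epsilon> \<omega> = ennreal (exp (- l * t)) * ?D t \<omega>"
      unfolding discount_add[OF t(1), symmetric] discount_add[OF t0, symmetric] by simp
    then show ?thesis by (simp add: add_increasing)
  qed
  have "ennreal (exp (- l * \<epsilon>)) * (\<integral>\<^sup>+y. v y \<partial>transition X P \<epsilon> x) =
      (\<integral>\<^sup>+\<omega>. ennreal (exp (- l * \<epsilon>)) * G \<omega> \<partial>P x)"
    unfolding G(3)[symmetric] using G(1) by (rule nn_integral_cmult[symmetric])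
  also have "\<dots> = (\<integral>\<^sup>+\<omega>. ennreal (exp (- l * \<epsilon>)) * G \<omega> \<partial>?C)" by (simp add: nn_integral_completion)
  also have "\<dots> \<le> (\<integral>\<^sup>+\<omega>. indicator {\<omega>. hitting_time X A \<omega> \<le> ennreal t} \<omega> +
      ennreal (exp (- l * t)) * H \<omega> \<partial>?C)"
  proof (rule nn_integral_mono_AE)
    show "AE \<omega> in ?C. ennreal (exp (- l * \<epsilon>)) * G \<omega> \<le>
        indicator {\<omega>. hitting_time X A \<omega> \<le> ennreal t} \<omega> + ennreal (exp (- l * t)) * H \<omega>"
      using AE_completion[OF G(2)] AE_completion[OF H(2)]
    proof eventually_elim
      case (elim \<omega>)
      then show ?case using pointwise[of \<omega>] by simp
    qed
  qed
  also have "\<dots> = emeasure ?C {\<omega>. hitting_time X A \<omega> \<le> ennreal t} +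
      (\<integral>\<^sup>+\<omega>. ennreal (exp (- l * t)) * H \<omega> \<partial>?C)"
    using S measurable_completion[OF H(1)] by (subst nn_integral_add) auto
  also have "(\<integral>\<^sup>+\<omega>. ennreal (exp (- l * t)) * H \<omega> \<partial>?C) =
      ennreal (exp (- l * t)) * (\<integral>\<^sup>+y. v y \<partial>transition X P t x)"
    unfolding H(3)[symmetric] nn_integral_completion using H(1) by (rule nn_integral_cmult)
  finally show ?thesis .
qed

end

section \<open>Transition densities in duality\<close>

text \<open>Under \<open>P z\<close> the path starts at \<open>z\<close> and is right continuous, so
  the integrands converge to \<open>L\<close> almost surely and Fatou's lemma applies. This turns a
  bound on averages over short times into a bound at the single point \<open>z\<close>. Time and
  position move together, hence the joint limit.\<close>

lemma (in borel_right_process) le_of_right_limit: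
  fixes g :: "real \<Rightarrow> 'e \<Rightarrow> real"
  assumes g: "((\<lambda>(u, w). g u w) \<longlongrightarrow> L) (nhds (0, z))"
    and meas: "\<And>u. 0 < u \<Longrightarrow> u < \<eta> \<Longrightarrow> g u \<in> borel_measurable borel"
    and le: "\<And>u. 0 < u \<Longrightarrow> u < \<eta> \<Longrightarrow> (\<integral>\<^sup>+w. ennreal (g u w) \<partial>transition X P u z) \<le> H"
    and \<eta>: "0 < \<eta>"
  shows "ennreal L \<le> H"
proof -
  \<comment> \<open>The shift by 2 keeps \<open>u n\<close> strictly below \<open>\<eta>\<close>
    already for \<open>n = 0\<close>.\<close>
  define u where "u n = \<eta> / real (n + 2)" for n :: nat
  have u: "0 < u n" "u n < \<eta>" for n using \<eta> by (auto simp: u_def divide_simps)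
  have u_lim: "u \<longlonglongrightarrow> 0"
    unfolding u_def[abs_def] by (rule LIMSEQ_ignore_initial_segment[OF lim_const_over_n, of \<eta> 2])
  then have u_right: "filterlim u (at_right 0) sequentially"
    using u(1) less_imp_neq[OF u(1)] by (auto simp: filterlim_at intro!: always_eventually)
  let ?F = "\<lambda>n. observe X (\<lambda>w. ennreal (g (u n) w)) (u n)"
  have F_lim: "(\<lambda>n. ?F n \<omega>) \<longlonglongrightarrow> ennreal L" if \<omega>: "X 0 \<omega> = Some z" for \<omega>
  proof (rule topological_tendstoI)
    fix S :: "ennreal set" assume S: "open S" "ennreal L \<in> S"
    have "((\<lambda>(u, w). ennreal (g u w)) \<longlongrightarrow> ennreal L) (nhds (0, z))"
      using tendsto_ennrealI[OF g] by (simp add: case_prod_unfold)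
    then have "\<forall>\<^sub>F q in nhds (0, z). (\<lambda>(u, w). ennreal (g u w)) q \<in> S"
      using S by (rule topological_tendstoD)
    then obtain d where d: "0 < d" "\<And>q. dist q (0, z) < d \<Longrightarrow> (\<lambda>(u, w). ennreal (g u w)) q \<in> S"
      unfolding eventually_nhds_metric by blast
    have "\<forall>\<^sub>F s in at_right 0. X s \<omega> \<in> Some ` ball z (d / 2)"
      using d(1) by (intro right_continuous_paths[OF order_refl \<omega>]) auto
    then have "\<forall>\<^sub>F n in sequentially. X (u n) \<omega> \<in> Some ` ball z (d / 2)"
      using u_right unfolding filterlim_iff by blast
    moreover have "\<forall>\<^sub>F n in sequentially. dist (u n) 0 < d / 2"
      using u_lim d(1) by (intro tendstoD) auto
    ultimately show "\<forall>\<^sub>F n in sequentially. ?F n \<omega> \<in> S"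
    proof eventually_elim
      case (elim n)
      then obtain w where w: "X (u n) \<omega> = Some w" "dist z w < d / 2" by auto
      have "dist (u n, w) (0, z) \<le> dist (u n) 0 + dist w z"
        unfolding dist_Pair_Pair by (rule sqrt_sum_squares_le_sum) auto
      also have "\<dots> < d" using elim(2) w(2) by (simp add: dist_commute)
      finally show ?case using d(2)[of "(u n, w)"] w(1) by (simp add: observe_def)
    qed
  qed
  have "ennreal L = (\<integral>\<^sup>+\<omega>. ennreal L \<partial>P z)" by simp
  also have "\<dots> \<le> (\<integral>\<^sup>+\<omega>. liminf (\<lambda>n. ?F n \<omega>) \<partial>P z)"
  proof (rule nn_integral_mono_AE)
    show "AE \<omega> in P z. ennreal L \<le> liminf (\<lambda>n. ?F n \<omega>)"
      using normal[of z]
    proof eventually_elim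
      case (elim \<omega>)
      show ?case using lim_imp_Liminf[OF _ F_lim[OF elim]] by simp
    qed
  qed
  also have "\<dots> \<le> liminf (\<lambda>n. \<integral>\<^sup>+\<omega>. ?F n \<omega> \<partial>P z)"
    using u meas by (intro nn_integral_liminf observe_measurable) (auto intro: less_imp_le)
  also have "\<dots> \<le> H"
  proof (rule Liminf_le)
    show "\<forall>\<^sub>F n in sequentially. (\<integral>\<^sup>+\<omega>. ?F n \<omega> \<partial>P z) \<le> H"
    proof (rule always_eventually, rule allI)
      fix n
      have "(\<integral>\<^sup>+\<omega>. ?F n \<omega> \<partial>P z) = (\<integral>\<^sup>+w. ennreal (g (u n) w) \<partial>transition X P (u n) z)"
        using u[of n] meas[of "u n"] by (intro nn_integral_transition[symmetric]) auto
      also have "\<dots> \<le> H" using u[of n] by (rule le)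
      finally show "(\<integral>\<^sup>+\<omega>. ?F n \<omega> \<partial>P z) \<le> H" .
    qed
  qed simp
  finally show ?thesis .
qed

text \<open>Duality is carried by the single function \<open>p\<close>: a density in its last
  variable for \<open>X\<close>, and in its middle variable for the dual process.\<close>

locale dual_transition_densities =
  X: borel_right_process X \<theta> P + Y: borel_right_process X' \<theta>' P' + sigma_finite_measure \<mu>
  for X :: "real \<Rightarrow> 'w \<Rightarrow> 'e::metric_space option" and \<theta> P
    and X' :: "real \<Rightarrow> 'v \<Rightarrow> 'e option" and \<theta>' P' and \<mu> :: "'e measure" +
  fixes p :: "real \<Rightarrow> 'e \<Rightarrow> 'e \<Rightarrow> ennreal"
  assumes sets_mu [measurable_cong]: "sets \<mu> = sets borel"
    and density: "transition_density \<mu> X P p"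
    and dual_density: "transition_density \<mu> X' P' (\<lambda>t y z. p t z y)"
begin

text \<open>The density is measurable only over positive times. Extension by 0 gives a jointly
  measurable function of all real times, so time integrals can run over the whole line.\<close>

definition q :: "real \<Rightarrow> 'e \<Rightarrow> 'e \<Rightarrow> ennreal" where
  "q t y z = (if 0 < t then p t y z else 0)"

lemma q_measurable [measurable (raw)]:
  assumes [measurable]: "f \<in> M \<rightarrow>\<^sub>M borel" "g \<in> M \<rightarrow>\<^sub>M borel" "h \<in> M \<rightarrow>\<^sub>M borel"
  shows "(\<lambda>a. q (f a) (g a) (h a)) \<in> borel_measurable M"
proof -
  let ?R = "restrict_space borel {0<..} \<Otimes>\<^sub>M (borel \<Otimes>\<^sub>M borel)"
  have p: "(\<lambda>(t, y, z). p t y z) \<in> borel_measurable ?R"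
    using density unfolding transition_density_def by blast
  have "(\<lambda>a. if 0 < f a then f a else 1) \<in> M \<rightarrow>\<^sub>M restrict_space borel {0<..}"
    by (rule measurable_restrict_space2) auto
  then have "(\<lambda>a. (if 0 < f a then f a else 1, g a, h a)) \<in> M \<rightarrow>\<^sub>M ?R"
    by measurable
  from measurable_compose[OF this p]
  have [measurable]: "(\<lambda>a. p (if 0 < f a then f a else 1) (g a) (h a)) \<in> borel_measurable M"
    by simp
  have "(\<lambda>a. q (f a) (g a) (h a)) =
      (\<lambda>a. if 0 < f a then p (if 0 < f a then f a else 1) (g a) (h a) else 0)"
    unfolding q_def by (intro ext) simp
  then show ?thesis by simp
qed

lemma nn_integral_q:
  assumes t: "0 < t" and f: "f \<in> borel_measurable borel"
  shows "(\<integral>\<^sup>+z. f z \<partial>transition X P t y) = (\<integral>\<^sup>+z. q t y z * f z \<partial>\<mu>)"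
proof -
  have "p t y = q t y" using t by (auto simp: q_def)
  then have "transition X P t y = density \<mu> (q t y)"
    using density t unfolding transition_density_def by simp
  then show ?thesis using f by (simp add: nn_integral_density measurable_cong_sets[OF sets_mu refl])
qed

lemma nn_integral_q_dual:
  assumes t: "0 < t" and f: "f \<in> borel_measurable borel"
  shows "(\<integral>\<^sup>+z. f z \<partial>transition X' P' t y) = (\<integral>\<^sup>+z. q t z y * f z \<partial>\<mu>)"
proof -
  have "(\<lambda>z. p t z y) = (\<lambda>z. q t z y)" using t by (auto simp: q_def)
  then have "transition X' P' t y = density \<mu> (\<lambda>z. q t z y)"
    using dual_density t unfolding transition_density_def by simp
  then show ?thesis using f by (simp add: nn_integral_density measurable_cong_sets[OF sets_mu refl])
qed

text \<open>
  \<open>split r s x z\<close> is a version of \<open>p(s,x,z)\<close>. The density \<open>p\<close> satisfies the Chapman-Kolmogorov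
  equation only almost everywhere, whereas \<open>split r s x z\<close> is independent of \<open>r\<close> at every \<open>z\<close>;
  this matters because \<open>z\<close> is integrated against the equilibrium measure, which may be singular.
\<close>
definition split :: "real \<Rightarrow> real \<Rightarrow> 'e \<Rightarrow> 'e \<Rightarrow> ennreal" where
  "split r s x z = (\<integral>\<^sup>+w. q r x w * q (s - r) w z \<partial>\<mu>)"

lemma split_measurable [measurable (raw)]:
  assumes [measurable]: "f \<in> M \<rightarrow>\<^sub>M borel" "g \<in> M \<rightarrow>\<^sub>M borel"
  shows "(\<lambda>a. split r (f a) x (g a)) \<in> borel_measurable M"
  unfolding split_def by measurable

lemma split_eq_0: "s \<le> r \<Longrightarrow> split r s x z = 0"
  unfolding split_def q_def by simp

lemma split_dual:
  assumes "r < s"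
  shows "split r s x z = (\<integral>\<^sup>+w. q r x w \<partial>transition X' P' (s - r) z)"
  unfolding split_def using assms by (subst nn_integral_q_dual) (auto simp: mult.commute)

text \<open>The dual Chapman-Kolmogorov equation is applied from the start \<open>z\<close>, then
  the integrals are exchanged, then the equation for \<open>X\<close> is applied from the start
  \<open>x\<close>. Both hold at every starting point, so no exceptional \<open>z\<close>
  appears.\<close>

lemma split_indep:
  assumes r: "0 < r" "r < t" "t < s"
  shows "split r s x z = split t s x z"
proof -
  interpret P: pair_sigma_finite \<mu> \<mu> by unfold_locales
  have "split r s x z = (\<integral>\<^sup>+w. q r x w \<partial>transition X' P' ((s - t) + (t - r)) z)"
    using split_dual[of r s x z] r by simp
  also have "\<dots> = (\<integral>\<^sup>+y. (\<integral>\<^sup>+w. q r x w \<partial>transition X' P' (t - r) y) \<partial>transition X' P' (s - t) z)"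
    using r by (intro Y.chapman_kolmogorov) auto
  also have "\<dots> = (\<integral>\<^sup>+y. q (s - t) y z * (\<integral>\<^sup>+w. q (t - r) w y * q r x w \<partial>\<mu>) \<partial>\<mu>)"
    using r by (simp add: nn_integral_q_dual)
  also have "\<dots> = (\<integral>\<^sup>+y. (\<integral>\<^sup>+w. q r x w * (q (t - r) w y * q (s - t) y z) \<partial>\<mu>) \<partial>\<mu>)"
    by (subst nn_integral_cmult[symmetric]) (auto intro!: nn_integral_cong simp: mult_ac)
  also have "\<dots> = (\<integral>\<^sup>+w. (\<integral>\<^sup>+y. q r x w * (q (t - r) w y * q (s - t) y z) \<partial>\<mu>) \<partial>\<mu>)"
    by (rule P.Fubini') measurable
  also have "\<dots> = (\<integral>\<^sup>+w. q r x w * (\<integral>\<^sup>+y. q (t - r) w y * q (s - t) y z \<partial>\<mu>) \<partial>\<mu>)"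
    by (intro nn_integral_cong nn_integral_cmult) measurable
  also have "\<dots> = (\<integral>\<^sup>+w. (\<integral>\<^sup>+y. q (s - t) y z \<partial>transition X P (t - r) w) \<partial>transition X P r x)"
    using r by (simp add: nn_integral_q)
  also have "\<dots> = (\<integral>\<^sup>+y. q (s - t) y z \<partial>transition X P (r + (t - r)) x)"
    using r by (intro X.chapman_kolmogorov[symmetric]) auto
  also have "\<dots> = split t s x z" unfolding split_def using r by (simp add: nn_integral_q)
  finally show ?thesis .
qed

text \<open>The bound at time \<open>s - u\<close> is averaged over the position of the dual process
  at a short time \<open>u\<close>. The average of the density is
  \<open>split (s - u) s x z\<close>, which does not depend on \<open>u\<close>, so the limit is
  taken only on the side of the continuous function \<open>b\<close>.\<close>

lemma split_lower_bound:
  fixes b :: "real \<Rightarrow> 'e \<Rightarrow> real"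
  assumes bound: "\<And>t y. 0 < t \<Longrightarrow> t \<le> T \<Longrightarrow> ennreal (b t y) \<le> p t x y"
    and cont: "isCont (\<lambda>(t, y). b t y) (s, z)"
    and meas: "\<And>t. 0 < t \<Longrightarrow> b t \<in> borel_measurable borel"
    and s: "0 < \<epsilon>" "\<epsilon> < s" "s \<le> T"
  shows "ennreal (b s z) \<le> split \<epsilon> s x z"
proof (rule Y.le_of_right_limit[where \<eta> = "s - \<epsilon>"])
  have "isCont (\<lambda>v. (s - fst v, snd v)) (0, z)" by (intro continuous_intros)
  moreover have "isCont (\<lambda>(t, y). b t y) (s - fst (0, z), snd (0, z))" using cont by simp
  ultimately have "isCont (\<lambda>v. (\<lambda>(t, y). b t y) (s - fst v, snd v)) (0, z)" by (rule isCont_o2)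
  then show "((\<lambda>(u, w). b (s - u) w) \<longlongrightarrow> b s z) (nhds (0, z))"
    by (simp add: isCont_def case_prod_unfold tendsto_nhds_iff)
  show "b (s - u) \<in> borel_measurable borel" if "0 < u" "u < s - \<epsilon>" for u
    using meas that s by simp
  show "(\<integral>\<^sup>+w. ennreal (b (s - u) w) \<partial>transition X' P' u z) \<le> split \<epsilon> s x z"
    if u: "0 < u" "u < s - \<epsilon>" for u
  proof -
    have "ennreal (b (s - u) w) \<le> q (s - u) x w" for w
      using bound[of "s - u" w] u s by (simp add: q_def)
    then have "(\<integral>\<^sup>+w. ennreal (b (s - u) w) \<partial>transition X' P' u z) \<le>
        (\<integral>\<^sup>+w. q (s - u) x w \<partial>transition X' P' (s - (s - u)) z)"
      by (simp add: nn_integral_mono)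
    also have "\<dots> = split (s - u) s x z" using u by (intro split_dual[symmetric]) simp
    also have "\<dots> = split \<epsilon> s x z" using u s by (intro split_indep[symmetric]) auto
    finally show ?thesis .
  qed
qed (use s in simp)

section \<open>Potentials of measures\<close>

lemma resolvent_density_eq: "resolvent_density p l y z = (\<integral>\<^sup>+t. ennreal (exp (- l * t)) * q t y z \<partial>lborel)"
  unfolding resolvent_density_def by (intro nn_integral_cong) (simp add: q_def indicator_def)

lemma resolvent_density_measurable [measurable (raw)]:
  assumes [measurable]: "f \<in> M \<rightarrow>\<^sub>M borel" "g \<in> M \<rightarrow>\<^sub>M borel"
  shows "(\<lambda>a. resolvent_density p l (f a) (g a)) \<in> borel_measurable M"
  unfolding resolvent_density_eq by measurable

text \<open>Applying \<open>P_r\<close> and discounting by \<open>r\<close> removes the times before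
  \<open>r\<close> from the resolvent: after exchanging the integrals, time is translated by
  \<open>r\<close>. The integral may run over all \<open>s\<close>, since \<open>split r s\<close>
  vanishes for \<open>s \<le> r\<close>.\<close>

lemma discounted_potential:
  assumes \<nu>: "sigma_finite_measure \<nu>" and sets_nu [measurable_cong]: "sets \<nu> = sets borel" and r: "0 < r"
  shows "ennreal (exp (- l * r)) * (\<integral>\<^sup>+w. (\<integral>\<^sup>+z. resolvent_density p l w z \<partial>\<nu>) \<partial>transition X P r x) =
    (\<integral>\<^sup>+z. (\<integral>\<^sup>+s. ennreal (exp (- l * s)) * split r s x z \<partial>lborel) \<partial>\<nu>)"
proof -
  interpret \<nu>: sigma_finite_measure \<nu> by fact
  interpret MN: pair_sigma_finite \<nu> \<mu> by unfold_locales
  interpret muL: pair_sigma_finite \<mu> lborel by unfold_locales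
  let ?e = "\<lambda>s. ennreal (exp (- l * s))"
  have inner: "(\<integral>\<^sup>+w. q r x w * resolvent_density p l w z \<partial>\<mu>) = (\<integral>\<^sup>+s. ?e s * split r (r + s) x z \<partial>lborel)" for z
  proof -
    have "(\<integral>\<^sup>+w. q r x w * resolvent_density p l w z \<partial>\<mu>) =
        (\<integral>\<^sup>+w. (\<integral>\<^sup>+s. q r x w * (?e s * q s w z) \<partial>lborel) \<partial>\<mu>)"
      unfolding resolvent_density_eq
      by (intro nn_integral_cong nn_integral_cmult[symmetric]) measurable
    also have "\<dots> = (\<integral>\<^sup>+s. (\<integral>\<^sup>+w. q r x w * (?e s * q s w z) \<partial>\<mu>) \<partial>lborel)"
      by (rule muL.Fubini'[symmetric]) measurable
    also have "\<dots> = (\<integral>\<^sup>+s. (\<integral>\<^sup>+w. ?e s * (q r x w * q s w z) \<partial>\<mu>) \<partial>lborel)"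
      by (simp add: mult_ac)
    also have "\<dots> = (\<integral>\<^sup>+s. ?e s * (\<integral>\<^sup>+w. q r x w * q s w z \<partial>\<mu>) \<partial>lborel)"
      by (intro nn_integral_cong nn_integral_cmult) measurable
    also have "\<dots> = (\<integral>\<^sup>+s. ?e s * split r (r + s) x z \<partial>lborel)" by (simp add: split_def)
    finally show ?thesis .
  qed
  have "(\<integral>\<^sup>+w. (\<integral>\<^sup>+z. resolvent_density p l w z \<partial>\<nu>) \<partial>transition X P r x) =
      (\<integral>\<^sup>+w. q r x w * (\<integral>\<^sup>+z. resolvent_density p l w z \<partial>\<nu>) \<partial>\<mu>)"
    by (intro nn_integral_q r) measurable
  also have "\<dots> = (\<integral>\<^sup>+w. (\<integral>\<^sup>+z. q r x w * resolvent_density p l w z \<partial>\<nu>) \<partial>\<mu>)"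
    by (intro nn_integral_cong nn_integral_cmult[symmetric]) measurable
  also have "\<dots> = (\<integral>\<^sup>+z. (\<integral>\<^sup>+w. q r x w * resolvent_density p l w z \<partial>\<mu>) \<partial>\<nu>)"
    by (rule MN.Fubini') measurable
  also have "\<dots> = (\<integral>\<^sup>+z. (\<integral>\<^sup>+s. ?e s * split r (r + s) x z \<partial>lborel) \<partial>\<nu>)"
    unfolding inner ..
  finally have "?e r * (\<integral>\<^sup>+w. (\<integral>\<^sup>+z. resolvent_density p l w z \<partial>\<nu>) \<partial>transition X P r x) =
      ?e r * (\<integral>\<^sup>+z. (\<integral>\<^sup>+s. ?e s * split r (r + s) x z \<partial>lborel) \<partial>\<nu>)" by simp
  also have "\<dots> = (\<integral>\<^sup>+z. (\<integral>\<^sup>+s. ?e (r + s) * split r (r + s) x z \<partial>lborel) \<partial>\<nu>)"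
  proof -
    have "exp (- l * r) * exp (- l * s) = exp (- l * (r + s))" for s
      unfolding exp_add[symmetric] by (simp only: distrib_left)
    then have "?e r * ?e s = ?e (r + s)" for s by (simp only: ennreal_mult[symmetric] exp_ge_zero)
    then have "?e r * (?e s * c) = ?e (r + s) * c" for s c by (simp only: mult.assoc[symmetric])
    then show ?thesis
      by (subst nn_integral_cmult[symmetric], measurable)
         (intro nn_integral_cong, subst nn_integral_cmult[symmetric], auto)
  qed
  also have "\<dots> = (\<integral>\<^sup>+z. (\<integral>\<^sup>+s. ?e s * split r s x z \<partial>lborel) \<partial>\<nu>)"
  proof -
    have "(\<integral>\<^sup>+s. ?e (r + s) * split r (r + s) x z \<partial>lborel) = (\<integral>\<^sup>+s. ?e s * split r s x z \<partial>lborel)" for z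
      using nn_integral_real_affine[of "\<lambda>s. ?e s * split r s x z" 1 r] by simp
    then show ?thesis by (simp only:)
  qed
  finally show ?thesis .
qed

text \<open>\<open>equilibrium_measure\<close> says nothing about the size of \<open>\<nu>\<close>,
  but a strictly positive function with finite integral forces sigma-finiteness through its
  superlevel sets. The function is \<open>u_l(x,z)\<close>, positive because \<open>p\<close> is
  positive on a time interval of positive length.\<close>

lemma sigma_finite_of_potential:
  assumes sets_nu [measurable_cong]: "sets \<nu> = sets borel"
    and finite: "(\<integral>\<^sup>+z. resolvent_density p l x z \<partial>\<nu>) < \<infinity>"
    and T: "0 < T" and pos: "\<And>t y. 0 < t \<Longrightarrow> t \<le> T \<Longrightarrow> 0 < p t x y"
  shows "sigma_finite_measure \<nu>"
proof -
  have pos_u: "0 < resolvent_density p l x z" for z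
  proof (rule ccontr)
    assume "\<not> 0 < resolvent_density p l x z"
    then have "(\<integral>\<^sup>+t. ennreal (exp (- l * t)) * q t x z \<partial>lborel) = 0"
      unfolding resolvent_density_eq by (simp add: not_less)
    then have "AE t in lborel. ennreal (exp (- l * t)) * q t x z = 0"
      by (subst (asm) nn_integral_0_iff_AE) measurable
    then have "AE t in lborel. t \<notin> {0<..T}"
    proof eventually_elim
      case (elim t)
      then show ?case using pos[of t z] by (auto simp: q_def)
    qed
    then have "{0<..T} \<in> null_sets lborel" using AE_iff_null_sets[of "{0<..T}" lborel] by simp
    then have "emeasure lborel {0<..T} = 0" by (rule null_setsD1)
    then show False using T by simp
  qed
  define S where "S n = {z. ennreal (1 / real (Suc n)) \<le> resolvent_density p l x z}" for n
  have S: "S n \<in> sets \<nu>" for n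
    unfolding S_def sets_nu by measurable
  show ?thesis
  proof (standard, intro exI[of _ "range S"] conjI ballI)
    show "\<Union> (range S) = space \<nu>"
    proof -
      have "\<exists>n. z \<in> S n" for z
      proof -
        \<comment> \<open>A positive real is placed below the resolvent density, which may itself be
          infinite.\<close>
        obtain e where e: "0 < e" "ennreal e < resolvent_density p l x z"
        proof -
          obtain c where c: "0 < c" "c < resolvent_density p l x z" using dense[OF pos_u[of z]] by blast
          then have "c < top" by (simp add: less_top[symmetric]) (use c(2) in auto)
          then have "0 < enn2real c" "ennreal (enn2real c) = c" using c(1) by (auto simp: enn2real_positive_iff)
          then show ?thesis using that c(2) by metis
        qed
        obtain n where "inverse (real (Suc n)) < e" using reals_Archimedean[OF e(1)] by blast
        then have "ennreal (1 / real (Suc n)) \<le> ennreal e" by (intro ennreal_leI) (simp add: inverse_eq_divide)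
        then have "ennreal (1 / real (Suc n)) \<le> resolvent_density p l x z" using e(2) by simp
        then show ?thesis unfolding S_def by blast
      qed
      then show ?thesis using sets_eq_imp_space_eq[OF sets_nu] by auto
    qed
    fix a assume "a \<in> range S"
    then obtain n where a: "a = S n" by blast
    have "ennreal (1 / real (Suc n)) * emeasure \<nu> (S n) = (\<integral>\<^sup>+z. ennreal (1 / real (Suc n)) * indicator (S n) z \<partial>\<nu>)"
      using S by (simp add: nn_integral_cmult_indicator)
    also have "\<dots> \<le> (\<integral>\<^sup>+z. resolvent_density p l x z \<partial>\<nu>)"
      by (intro nn_integral_mono) (auto simp: S_def indicator_def)
    finally have "ennreal (1 / real (Suc n)) * emeasure \<nu> (S n) < \<infinity>" using finite by (rule le_less_trans)
    then show "emeasure \<nu> a \<noteq> \<infinity>"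
      unfolding a by (auto simp: ennreal_mult_eq_top_iff ennreal_mult_less_top)
  qed (use S in auto)
qed

text \<open>Of the shape of the bound only two features matter: positivity makes
  \<open>\<nu>\<close> sigma-finite, and joint continuity carries the bound over from
  \<open>p\<close> to \<open>split\<close>.\<close>

lemma hitting_probability_lower_bound:
  fixes b :: "real \<Rightarrow> 'e \<Rightarrow> real"
  assumes A: "nearly_borel X P A" and l: "0 \<le> l" and \<nu>: "equilibrium_measure X P p l A \<nu>"
    and bound: "\<And>t y. 0 < t \<Longrightarrow> t \<le> T \<Longrightarrow> ennreal (b t y) \<le> p t x y"
    and pos: "\<And>t y. 0 < t \<Longrightarrow> 0 < b t y"
    and cont: "\<And>t y. 0 < t \<Longrightarrow> isCont (\<lambda>(t, y). b t y) (t, y)"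
    and t: "0 < \<epsilon>" "\<epsilon> < t" "t \<le> T"
  shows "(\<integral>\<^sup>+z. (\<integral>\<^sup>+s. ennreal (exp (- l * s)) * ennreal (b s z) * indicator {\<epsilon><..t} s \<partial>lborel) \<partial>\<nu>) \<le>
    emeasure (completion (P x)) {\<omega>. hitting_time X A \<omega> \<le> ennreal t}"
proof -
  let ?e = "\<lambda>s. ennreal (exp (- l * s))"
  have sets_nu [measurable_cong]: "sets \<nu> = sets borel" using \<nu> by (simp add: equilibrium_measure_def)
  define v where "v = (\<lambda>y. \<integral>\<^sup>+\<omega>. discount l (hitting_time X A \<omega>) \<partial>P y)"
  have v_eq: "v y = (\<integral>\<^sup>+z. resolvent_density p l y z \<partial>\<nu>)" for y
  proof -
    have "v y = (\<integral>\<^sup>+\<omega>\<in>{\<omega>. hitting_time X A \<omega> < \<infinity>}.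
              ennreal (exp (- l * enn2real (hitting_time X A \<omega>))) \<partial>completion (P y))"
      unfolding v_def nn_integral_completion
      by (intro nn_integral_cong) (simp add: discount_def indicator_def)
    then show ?thesis using \<nu> by (simp add: equilibrium_measure_def)
  qed
  have v_le: "v y \<le> 1" for y
  proof -
    have "v y \<le> (\<integral>\<^sup>+\<omega>. 1 \<partial>P y)" unfolding v_def by (intro nn_integral_mono discount_le_1 l)
    then show ?thesis by simp
  qed
  have pos_p: "0 < p t x y" if "0 < t" "t \<le> T" for t y
    by (rule less_le_trans[OF _ bound[OF that]]) (simp add: pos that)
  have "(\<integral>\<^sup>+z. resolvent_density p l x z \<partial>\<nu>) < \<infinity>"
    using v_le[of x] v_eq[of x] by (simp add: order_le_less_trans[OF _ ennreal_one_less_top])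
  then have sf: "sigma_finite_measure \<nu>"
    using t pos_p by (intro sigma_finite_of_potential[OF sets_nu, where T = T]) auto
  have meas_b: "b t \<in> borel_measurable borel" if "0 < t" for t
  proof (rule borel_measurable_continuous_onI)
    show "continuous_on UNIV (b t)"
    proof (rule continuous_at_imp_continuous_on, rule ballI)
      fix y :: 'e
      have "isCont (\<lambda>y. (t, y)) y" by (intro continuous_intros)
      then have "isCont (\<lambda>y. (\<lambda>(t, y). b t y) (t, y)) y" by (rule isCont_o2) (rule cont[OF that])
      then show "isCont (b t) y" by simp
    qed
  qed
  define W where "W r = ?e r * (\<integral>\<^sup>+y. v y \<partial>transition X P r x)" for r
  define J where "J = (\<integral>\<^sup>+z. (\<integral>\<^sup>+s. ?e s * split \<epsilon> s x z * indicator {\<epsilon><..t} s \<partial>lborel) \<partial>\<nu>)"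
  have W: "W r = (\<integral>\<^sup>+z. (\<integral>\<^sup>+s. ?e s * split r s x z \<partial>lborel) \<partial>\<nu>)" if "0 < r" for r
    unfolding W_def v_eq by (rule discounted_potential[OF sf sets_nu that])
  have t0: "0 < t" using t by simp
  have "W \<epsilon> = J + W t"
  proof -
    \<comment> \<open>Up to \<open>\<epsilon>\<close> all terms vanish; from
      \<open>\<epsilon>\<close> to \<open>t\<close> the version split at \<open>t\<close> is 0;
      beyond \<open>t\<close> the two versions agree by \<open>split_indep\<close>.\<close>
    have "?e s * split \<epsilon> s x z = ?e s * split \<epsilon> s x z * indicator {\<epsilon><..t} s + ?e s * split t s x z" for s z
    proof -
      consider "s \<le> \<epsilon>" | "\<epsilon> < s" "s \<le> t" | "t < s" by linarith
      then show ?thesis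
        using t by cases (auto simp: split_eq_0 split_indep[of \<epsilon> t s])
    qed
    then have "W \<epsilon> = (\<integral>\<^sup>+z. (\<integral>\<^sup>+s. ?e s * split \<epsilon> s x z * indicator {\<epsilon><..t} s + ?e s * split t s x z \<partial>lborel) \<partial>\<nu>)"
      unfolding W[OF t(1)] by simp
    also have "\<dots> = (\<integral>\<^sup>+z. (\<integral>\<^sup>+s. ?e s * split \<epsilon> s x z * indicator {\<epsilon><..t} s \<partial>lborel) +
        (\<integral>\<^sup>+s. ?e s * split t s x z \<partial>lborel) \<partial>\<nu>)"
      by (intro nn_integral_cong nn_integral_add) measurable
    also have "\<dots> = J + W t"
      unfolding J_def W[OF t0] by (rule nn_integral_add) measurable
    finally show ?thesis .
  qed
  moreover have "W \<epsilon> \<le> emeasure (completion (P x)) {\<omega>. hitting_time X A \<omega> \<le> ennreal t} + W t"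
    unfolding W_def v_def using t by (intro X.discounted_hitting_decrement[OF A l]) auto
  \<comment> \<open>Finiteness allows \<open>W t\<close> to be cancelled from both sides in
    \<open>[0,\<infinity>]\<close>.\<close>
  moreover have "W t \<noteq> \<top>"
  proof -
    have "(\<integral>\<^sup>+y. v y \<partial>transition X P t x) \<le> (\<integral>\<^sup>+y. 1 \<partial>transition X P t x)"
      by (intro nn_integral_mono v_le)
    also have "\<dots> \<le> 1" using X.emeasure_transition_le_1[of t x UNIV] t0 by simp
    finally have "(\<integral>\<^sup>+y. v y \<partial>transition X P t x) < \<top>" by (rule le_less_trans) simp
    then show ?thesis unfolding W_def by (simp add: ennreal_mult_eq_top_iff)
  qed
  ultimately have "J \<le> emeasure (completion (P x)) {\<omega>. hitting_time X A \<omega> \<le> ennreal t}"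
    by (simp add: add.commute[of _ "W t"] ennreal_add_left_cancel_le)
  moreover have "(\<integral>\<^sup>+z. (\<integral>\<^sup>+s. ?e s * ennreal (b s z) * indicator {\<epsilon><..t} s \<partial>lborel) \<partial>\<nu>) \<le> J"
    unfolding J_def
  proof (intro nn_integral_mono)
    fix z s
    show "?e s * ennreal (b s z) * indicator {\<epsilon><..t} s \<le> ?e s * split \<epsilon> s x z * indicator {\<epsilon><..t} s"
    proof (cases "s \<in> {\<epsilon><..t}")
      case True
      then have "ennreal (b s z) \<le> split \<epsilon> s x z"
        using t meas_b cont by (intro split_lower_bound[where T = T] bound) auto
      then show ?thesis by (intro mult_right_mono mult_left_mono) auto
    qed simp
  qed
  ultimately show ?thesis by (rule order_trans[rotated])
qed

end

section \<open>Sub-Gaussian estimates\<close>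

text \<open>
  Substituting \<open>s = t r\<^bsup>1-\<beta>\<^esup>\<close>, \<open>1 \<le> r \<le> 1 + \<rho>\<close>, turns the integrand into a multiple of
  \<open>r\<^bsup>(\<beta>-1)a-\<beta>\<^esup>\<close>, whose minimum is attained at an end point. The increasing parametrisation
  required by the substitution rule is \<open>r = - u\<close>.
\<close>
lemma powr_integral_lower_bound:
  fixes a \<beta> \<rho> t :: real
  assumes \<beta>: "1 < \<beta>" and \<rho>: "0 < \<rho>" and t: "0 < t"
  shows "ennreal (t powr (1 - a) * ((\<beta> - 1) * \<rho> * min ((1 + \<rho>) powr ((\<beta> - 1) * a - \<beta>)) 1)) \<le>
    (\<integral>\<^sup>+s. ennreal (s powr (- a)) * indicator {t * (1 + \<rho>) powr (1 - \<beta>)<..t} s \<partial>lborel)"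
proof -
  define \<kappa> where "\<kappa> = (\<beta> - 1) * a - \<beta>"
  define m where "m = min ((1 + \<rho>) powr \<kappa>) 1"
  define c where "c = t powr (1 - a) * (\<beta> - 1)"
  define g where "g u = t * (- u) powr (1 - \<beta>)" for u :: real
  define g' where "g' u = t * ((\<beta> - 1) * (- u) powr (- \<beta>))" for u :: real
  have c0: "0 \<le> c" using \<beta> by (simp add: c_def)
  have deriv: "(g has_real_derivative g' u) (at u)" if "u \<in> {-(1+\<rho>)..-1}" for u
    unfolding g_def[abs_def] g'_def using that
    by (auto intro!: derivative_eq_intros simp: algebra_simps)
  have cont: "continuous_on {-(1+\<rho>)..-1} g'"
    unfolding g'_def[abs_def] by (intro continuous_intros) auto
  have nonneg: "0 \<le> g' u" if "u \<in> {-(1+\<rho>)..-1}" for u using \<beta> t by (simp add: g'_def)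
  have ends: "g (-(1+\<rho>)) = t * (1 + \<rho>) powr (1 - \<beta>)" "g (-1) = t"
    by (simp_all add: g_def add.commute)
  have integrand: "c * m \<le> g u powr (- a) * g' u" if u: "u \<in> {-(1+\<rho>)..-1}" for u
  proof -
    define r where "r = - u"
    have r: "1 \<le> r" "r \<le> 1 + \<rho>" using u by (auto simp: r_def)
    have "g u powr (- a) * g' u = t powr (- a) * (r powr (1 - \<beta>)) powr (- a) * (t * ((\<beta> - 1) * r powr (- \<beta>)))"
      using t r unfolding g_def g'_def r_def[symmetric] by (simp add: powr_mult)
    also have "\<dots> = (t powr (- a) * t powr 1) * (\<beta> - 1) * (r powr ((1 - \<beta>) * (- a)) * r powr (- \<beta>))"
      using t by (simp add: powr_powr)
    also have "\<dots> = c * r powr \<kappa>"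
      unfolding powr_add[symmetric] c_def \<kappa>_def by (simp add: algebra_simps)
    finally have eq: "g u powr (- a) * g' u = c * r powr \<kappa>" .
    have "m \<le> r powr \<kappa>"
    proof (cases "0 \<le> \<kappa>")
      case True
      then have "1 \<le> r powr \<kappa>" using r(1) by (rule ge_one_powr_ge_zero[rotated])
      then show ?thesis unfolding m_def by simp
    next
      case False
      then have "(1 + \<rho>) powr \<kappa> \<le> r powr \<kappa>" using r by (intro powr_mono2') auto
      then show ?thesis unfolding m_def by simp
    qed
    then show ?thesis unfolding eq using c0 by (rule mult_left_mono)
  qed
  have "ennreal (t powr (1 - a) * ((\<beta> - 1) * \<rho> * m)) =
      (\<integral>\<^sup>+u. ennreal (c * m) * indicator {-(1+\<rho>)..-1} u \<partial>lborel)"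
  proof -
    have "0 \<le> c * m" using c0 by (simp add: m_def)
    moreover have "t powr (1 - a) * ((\<beta> - 1) * \<rho> * m) = c * m * \<rho>" by (simp add: c_def)
    moreover have "emeasure lborel {-(1+\<rho>)..-1} = ennreal \<rho>"
      using emeasure_lborel_Icc[of "-(1+\<rho>)" "-1"] \<rho> by simp
    ultimately show ?thesis
      using \<rho> by (subst nn_integral_cmult_indicator) (simp_all only: ennreal_mult less_imp_le sets_lborel borel_closed closed_atLeastAtMost)
  qed
  also have "\<dots> \<le> (\<integral>\<^sup>+u. ennreal (g u powr (- a)) * ennreal (g' u) * indicator {-(1+\<rho>)..-1} u \<partial>lborel)"
  proof (intro nn_integral_mono)
    fix u
    show "ennreal (c * m) * indicator {-(1+\<rho>)..-1} u \<le>
        ennreal (g u powr (- a)) * ennreal (g' u) * indicator {-(1+\<rho>)..-1} u"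
      using integrand[of u] nonneg[of u]
      by (cases "u \<in> {-(1+\<rho>)..-1}") (auto simp: ennreal_mult[symmetric] intro!: ennreal_leI)
  qed
  also have "\<dots> = (\<integral>\<^sup>+s. ennreal (s powr (- a)) * indicator {g (-(1+\<rho>))..g (-1)} s \<partial>lborel)"
    using \<rho> by (intro nn_integral_substitution_aux[symmetric] deriv cont nonneg) auto
  \<comment> \<open>Substitution yields a closed interval; its left end point is a null set.\<close>
  also have "\<dots> = (\<integral>\<^sup>+s. ennreal (s powr (- a)) * indicator {t * (1 + \<rho>) powr (1 - \<beta>)<..t} s \<partial>lborel)"
    unfolding ends
    by (intro nn_integral_cong_AE eventually_mono[OF AE_lborel_singleton[of "t * (1 + \<rho>) powr (1 - \<beta>)"]])
       (auto simp: indicator_def)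
  finally show ?thesis unfolding m_def \<kappa>_def .
qed

text \<open>At \<open>y = x\<close> the base of the inner power is 0, where continuity rests on the
  positive exponent \<open>\<gamma>\<close>.\<close>

lemma isCont_sub_gaussian:
  fixes x y :: "'e::metric_space" and a \<beta> \<gamma> C1 C2 t :: real
  assumes "0 < t" "0 < \<gamma>"
  shows "isCont (\<lambda>(t, y). C1 / t powr a * exp (- C2 * (dist x y / t powr (1 / \<beta>)) powr \<gamma>)) (t, y)"
proof -
  have "((\<lambda>v. C1 / fst v powr a * exp (- C2 * (dist x (snd v) / fst v powr (1 / \<beta>)) powr \<gamma>)) \<longlongrightarrow>
      C1 / t powr a * exp (- C2 * (dist x y / t powr (1 / \<beta>)) powr \<gamma>)) (at (t, y))"
  proof (intro tendsto_intros tendsto_powr')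
    show "(fst \<longlongrightarrow> t) (at (t, y))" "(fst \<longlongrightarrow> t) (at (t, y))" "(snd \<longlongrightarrow> y) (at (t, y))"
      using tendsto_fst[OF tendsto_ident_at, of "(t, y)" UNIV] tendsto_snd[OF tendsto_ident_at, of "(t, y)" UNIV]
      by auto
  qed (use assms in auto)
  then show ?thesis by (simp add: isCont_def case_prod_unfold)
qed

text \<open>The worst case is the largest distance at the smallest time. There the time ratio
  contributes \<open>(1+\<rho>)^((\<beta>-1)/\<beta>)\<close> to the base, and raising it to
  \<open>\<beta>/(\<beta>-1)\<close> leaves exactly \<open>1+\<rho>\<close>.\<close>

lemma sub_gaussian_lower_bound:
  fixes C2 D r s t \<beta> \<rho> :: real
  assumes \<beta>: "1 < \<beta>" and \<rho>: "0 < \<rho>" and C2: "0 \<le> C2" and r: "0 \<le> r" "r \<le> D"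
    and s: "t * (1 + \<rho>) powr (1 - \<beta>) \<le> s" and t: "0 < t"
  shows "exp (- (1 + \<rho>) * C2 * (D / t powr (1 / \<beta>)) powr (\<beta> / (\<beta> - 1))) \<le>
    exp (- C2 * (r / s powr (1 / \<beta>)) powr (\<beta> / (\<beta> - 1)))"
proof -
  let ?\<gamma> = "\<beta> / (\<beta> - 1)"
  have s0: "0 < s" using s t \<rho> by (intro less_le_trans[OF _ s]) auto
  have g0: "0 \<le> ?\<gamma>" using \<beta> by simp
  have "t powr (1 / \<beta>) * (1 + \<rho>) powr ((1 - \<beta>) / \<beta>) = (t * (1 + \<rho>) powr (1 - \<beta>)) powr (1 / \<beta>)"
    using t \<rho> by (simp add: powr_mult powr_powr)
  also have "\<dots> \<le> s powr (1 / \<beta>)" using s t \<rho> \<beta> by (intro powr_mono2) auto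
  finally have le: "t powr (1 / \<beta>) * (1 + \<rho>) powr ((1 - \<beta>) / \<beta>) \<le> s powr (1 / \<beta>)" .
  have "r / s powr (1 / \<beta>) \<le> D / (t powr (1 / \<beta>) * (1 + \<rho>) powr ((1 - \<beta>) / \<beta>))"
    using r le t \<rho> by (intro frac_le) auto
  also have "\<dots> = D / t powr (1 / \<beta>) * (1 + \<rho>) powr ((\<beta> - 1) / \<beta>)"
  proof -
    have "(1 + \<rho>) powr ((\<beta> - 1) / \<beta>) = inverse ((1 + \<rho>) powr ((1 - \<beta>) / \<beta>))"
      unfolding powr_minus[symmetric] by (rule arg_cong[where f = "\<lambda>e. (1 + \<rho>) powr e"]) (simp add: minus_divide_left)
    then show ?thesis by (simp add: field_simps)
  qed
  finally have "(r / s powr (1 / \<beta>)) powr ?\<gamma> \<le> (D / t powr (1 / \<beta>) * (1 + \<rho>) powr ((\<beta> - 1) / \<beta>)) powr ?\<gamma>"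
    using r s0 g0 by (intro powr_mono2) auto
  also have "\<dots> = (D / t powr (1 / \<beta>)) powr ?\<gamma> * ((1 + \<rho>) powr ((\<beta> - 1) / \<beta>)) powr ?\<gamma>"
    by (rule powr_mult)
  also have "((1 + \<rho>) powr ((\<beta> - 1) / \<beta>)) powr ?\<gamma> = 1 + \<rho>"
    using \<beta> \<rho> by (simp add: powr_powr)
  finally have "C2 * (r / s powr (1 / \<beta>)) powr ?\<gamma> \<le> C2 * ((D / t powr (1 / \<beta>)) powr ?\<gamma> * (1 + \<rho>))"
    using C2 by (rule mult_left_mono)
  then have "- (1 + \<rho>) * C2 * (D / t powr (1 / \<beta>)) powr ?\<gamma> \<le> - C2 * (r / s powr (1 / \<beta>)) powr ?\<gamma>"
    by (simp add: algebra_simps)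
  then show ?thesis by simp
qed

section \<open>The near part of the target set\<close>

lemma nearly_borel_Int:
  fixes X :: "real \<Rightarrow> 'w \<Rightarrow> 'e::topological_space option"
  assumes B: "nearly_borel X P B" and C: "C \<in> sets borel"
  shows "nearly_borel X P (B \<inter> C)"
  unfolding nearly_borel_def
proof
  fix \<nu> :: "'e measure" assume "\<nu> \<in> space (prob_algebra borel)"
  from bspec[OF B[unfolded nearly_borel_def] this] obtain B1 B2
    where B: "B1 \<in> sets borel" "B2 \<in> sets borel" "B1 \<subseteq> B" "B \<subseteq> B2"
      "AE \<omega> in law P \<nu>. \<not> (\<exists>t\<ge>0. X t \<omega> \<in> Some ` (B2 - B1))"
    by (elim bexE conjE)
  have "AE \<omega> in law P \<nu>. \<not> (\<exists>t\<ge>0. X t \<omega> \<in> Some ` (B2 \<inter> C - B1 \<inter> C))"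
    using B(5) by eventually_elim blast
  then show "\<exists>B1\<in>sets borel. \<exists>B2\<in>sets borel. B1 \<subseteq> B \<inter> C \<and> B \<inter> C \<subseteq> B2 \<and>
      (AE \<omega> in law P \<nu>. \<not> (\<exists>t\<ge>0. X t \<omega> \<in> Some ` (B2 - B1)))"
    using B(1-4) C by (intro bexI[of _ "B1 \<inter> C"] bexI[of _ "B2 \<inter> C"]) auto
qed

text \<open>The near part cuts \<open>B\<close> with a closed set, which is the whole space if the
  essential distance is infinite.\<close>

lemma nearly_borel_near_part:
  assumes "nearly_borel X P B"
  shows "nearly_borel X P (near_part X P B x \<delta>)"
proof -
  let ?C = "{y. ennreal (dist y x) \<le> essential_distance X P x B + ennreal \<delta>}"
  have "closed ?C" by (intro closed_Collect_le continuous_on_ennreal continuous_intros)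
  then have "?C \<in> sets borel" by simp
  then have "nearly_borel X P (B \<inter> ?C)" by (rule nearly_borel_Int[OF assms])
  moreover have "near_part X P B x \<delta> = B \<inter> ?C" unfolding near_part_def by blast
  ultimately show ?thesis by simp
qed

text \<open>The theorem weighs the closure of the near part, so the distance bound must survive
  passing to limit points; a closed ball provides this.\<close>

lemma closure_near_part_subset:
  assumes "essential_distance X P x B \<noteq> \<infinity>" "0 \<le> \<delta>"
  shows "closure (near_part X P B x \<delta>) \<subseteq> cball x (enn2real (essential_distance X P x B) + \<delta>)"
proof (rule closure_minimal)
  let ?d = "essential_distance X P x B"
  have "?d = ennreal (enn2real ?d)" using assms(1) by (simp add: less_top)
  then have eq: "?d + ennreal \<delta> = ennreal (enn2real ?d + \<delta>)" using assms(2) by (metis enn2real_nonneg ennreal_plus)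
  show "near_part X P B x \<delta> \<subseteq> cball x (enn2real ?d + \<delta>)"
  proof
    fix y assume "y \<in> near_part X P B x \<delta>"
    then have "ennreal (dist y x) \<le> ennreal (enn2real ?d + \<delta>)" unfolding near_part_def eq by blast
    moreover have "0 \<le> enn2real ?d + \<delta>" using assms(2) by simp
    ultimately have "dist y x \<le> enn2real ?d + \<delta>" by (simp only: ennreal_le_iff)
    then show "y \<in> cball x (enn2real ?d + \<delta>)" by (simp add: dist_commute)
  qed
qed simp

theorem theorem5p2:
  fixes \<mu> :: "'e::metric_space measure"
    and X :: "real \<Rightarrow> 'w \<Rightarrow> 'e option" and \<theta> :: "real \<Rightarrow> 'w \<Rightarrow> 'w" and P :: "'e \<Rightarrow> 'w measure"
    and X' :: "real \<Rightarrow> 'v \<Rightarrow> 'e option" and \<theta>' :: "real \<Rightarrow> 'v \<Rightarrow> 'v" and P' :: "'e \<Rightarrow> 'v measure"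
    and p :: "real \<Rightarrow> 'e \<Rightarrow> 'e \<Rightarrow> ennreal"
    and x :: 'e and B :: "'e set" and \<nu> :: "'e measure"
    and T \<alpha> \<beta> C1 C2 C3 \<delta> \<rho> l :: real
  assumes mu: "sets \<mu> = sets borel" "sigma_finite_measure \<mu>" "full_support \<mu>"
    and process: "borel_right_process X \<theta> P"
    and AC: "abs_cont_process \<mu> X P" "transition_density \<mu> X P p"
    and H2a: "borel_right_process X' \<theta>' P'" "abs_cont_process \<mu> X' P'"
             "in_duality \<mu> X P X' P'" "transition_density \<mu> X' P' (\<lambda>t y z. p t z y)"
    and H2b: "locally_compact_space (euclidean :: 'e topology)"
             "separable_space (euclidean :: 'e topology)"
             "radon_measure \<mu>" "co_resolvent_continuous \<mu> p"
    and constants: "T > 0" "\<alpha> > 0" "\<beta> > 1" "C1 > 0" "C2 > 0"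
    and lower_bound:
      "\<forall>t\<in>{0<..T}. \<forall>y. p t x y \<ge>
         ennreal (C1 / t powr (\<alpha> / \<beta>) *
                  exp (- C2 * (dist x y / t powr (1 / \<beta>)) powr (\<beta> / (\<beta> - 1))))"
    and B: "nearly_borel X P B" "compact (closure B)"
    and "\<delta> > 0" "\<rho> > 0" and l: "admissible_rate \<mu> p l"
    and nu: "equilibrium_measure X P p l (near_part X P B x \<delta>) \<nu>"
    and C3: "C3 = (\<beta> - 1) * \<rho> * min ((1 + \<rho>) powr (\<alpha> - \<beta> - \<alpha> / \<beta>)) 1"
  shows "C3 > 0 \<and>
    (\<forall>t\<in>{0<..T}.
       emeasure (completion (P x)) {\<omega>. hitting_time X B \<omega> \<le> ennreal t} \<ge>
       emeasure \<nu> (closure (near_part X P B x \<delta>)) / ennreal (exp (l * T)) *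
       ennreal (C1 * C3 / t powr ((\<alpha> - \<beta>) / \<beta>)) *
       (if essential_distance X P x B = \<infinity> then 0
        else ennreal (exp (- (1 + \<rho>) * C2 *
               ((enn2real (essential_distance X P x B) + \<delta>) / t powr (1 / \<beta>))
                 powr (\<beta> / (\<beta> - 1))))))"
proof (intro conjI ballI)
  show C3_pos: "C3 > 0" unfolding C3 using \<open>\<rho> > 0\<close> constants(3) by simp
  fix t assume "t \<in> {0<..T}"
  then have t: "0 < t" "t \<le> T" by auto
  interpret X: borel_right_process X \<theta> P by (rule process)
  interpret D: dual_transition_densities X \<theta> P X' \<theta>' P' \<mu> p
    using process H2a(1) mu(1,2) AC(2) H2a(4)
    by (simp add: dual_transition_densities_def dual_transition_densities_axioms_def)
  define A where "A = near_part X P B x \<delta>"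
  define d where "d = essential_distance X P x B"
  define E where "E = exp (- (1 + \<rho>) * C2 * ((enn2real d + \<delta>) / t powr (1 / \<beta>)) powr (\<beta> / (\<beta> - 1)))"
  define b where "b = (\<lambda>t y. C1 / t powr (\<alpha> / \<beta>) *
      exp (- C2 * (dist x y / t powr (1 / \<beta>)) powr (\<beta> / (\<beta> - 1))))"
  define \<epsilon> where "\<epsilon> = t * (1 + \<rho>) powr (1 - \<beta>)"
  \<comment> \<open>Everything that does not depend on \<open>s\<close>: the discount is bounded by
    its value at \<open>T\<close>, and the exponential is frozen at \<open>t\<close> with the factor
    \<open>1+\<rho>\<close>.\<close>
  define K where "K = exp (- l * T) * C1 * E"
  have l0: "0 \<le> l" using l by (auto simp: admissible_rate_def)
  have K0: "0 \<le> K" using constants by (simp add: K_def E_def)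
  have sets_nu: "sets \<nu> = sets borel" using nu by (simp add: equilibrium_measure_def)
  have "(1 + \<rho>) powr (1 - \<beta>) < (1 + \<rho>) powr 0" using \<open>\<rho> > 0\<close> constants(3) by (intro powr_less_mono) auto
  then have \<epsilon>: "0 < \<epsilon>" "\<epsilon> < t" using t(1) \<open>\<rho> > 0\<close> by (auto simp: \<epsilon>_def)
  have "emeasure \<nu> (closure A) / ennreal (exp (l * T)) * ennreal (C1 * C3 / t powr ((\<alpha> - \<beta>) / \<beta>)) *
      (if d = \<infinity> then 0 else ennreal E) \<le> emeasure (completion (P x)) {\<omega>. hitting_time X A \<omega> \<le> ennreal t}"
  \<comment> \<open>For infinite essential distance the exponential factor is 0 by convention and
    the bound is trivial.\<close>
  proof (cases "d = \<infinity>")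
    case False
    have near: "dist x z \<le> enn2real d + \<delta>" if "z \<in> closure A" for z
      using that closure_near_part_subset[of X P x B \<delta>] False \<open>\<delta> > 0\<close> unfolding A_def d_def by auto
    have integrand: "ennreal K * ennreal (s powr (- (\<alpha> / \<beta>))) \<le> ennreal (exp (- l * s)) * ennreal (b s z)"
      if s: "s \<in> {\<epsilon><..t}" and z: "z \<in> closure A" for s z
    proof -
      have "E \<le> exp (- C2 * (dist x z / s powr (1 / \<beta>)) powr (\<beta> / (\<beta> - 1)))"
        unfolding E_def using s near[OF z] constants \<open>\<rho> > 0\<close> t
        by (intro sub_gaussian_lower_bound) (auto simp: \<epsilon>_def)
      moreover have "exp (- l * T) \<le> exp (- l * s)" using s t l0 by (auto intro: mult_left_mono)
      ultimately have "exp (- l * T) * (C1 * s powr (- (\<alpha> / \<beta>)) * E) \<le>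
          exp (- l * s) * (C1 * s powr (- (\<alpha> / \<beta>)) * exp (- C2 * (dist x z / s powr (1 / \<beta>)) powr (\<beta> / (\<beta> - 1))))"
        using constants by (intro mult_mono mult_nonneg_nonneg) (auto simp: E_def)
      then have "K * s powr (- (\<alpha> / \<beta>)) \<le> exp (- l * s) * b s z"
        unfolding K_def b_def powr_minus by (simp add: field_simps)
      then show ?thesis using K0 constants
        by (simp add: ennreal_mult[symmetric] b_def ennreal_leI)
    qed
    \<comment> \<open>The exponent in \<open>C3\<close> is \<open>(\<beta>-1)a - \<beta>\<close> for
      \<open>a = \<alpha>/\<beta>\<close>, as delivered by the power integral.\<close>
    have "C3 = (\<beta> - 1) * \<rho> * min ((1 + \<rho>) powr ((\<beta> - 1) * (\<alpha> / \<beta>) - \<beta>)) 1"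
      unfolding C3 using constants by (simp add: field_simps)
    then have J: "ennreal (t powr (1 - \<alpha> / \<beta>) * C3) \<le>
        (\<integral>\<^sup>+s. ennreal (s powr (- (\<alpha> / \<beta>))) * indicator {\<epsilon><..t} s \<partial>lborel)"
      unfolding \<epsilon>_def using powr_integral_lower_bound[OF constants(3) \<open>\<rho> > 0\<close> t(1), of "\<alpha> / \<beta>"] by simp
    have "emeasure \<nu> (closure A) / ennreal (exp (l * T)) * ennreal (C1 * C3 / t powr ((\<alpha> - \<beta>) / \<beta>)) * ennreal E =
        ennreal K * ennreal (t powr (1 - \<alpha> / \<beta>) * C3) * emeasure \<nu> (closure A)"
    proof -
      have "inverse (ennreal (exp (l * T))) = ennreal (exp (- l * T))"
        by (subst inverse_ennreal) (auto simp: exp_minus)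
      moreover have "t powr (1 - \<alpha> / \<beta>) = 1 / t powr ((\<alpha> - \<beta>) / \<beta>)"
      proof -
        have "1 - \<alpha> / \<beta> = - ((\<alpha> - \<beta>) / \<beta>)" using constants by (simp add: field_simps)
        then show ?thesis by (simp only: powr_minus inverse_eq_divide)
      qed
      moreover have "ennreal K = ennreal (exp (- l * T)) * ennreal C1 * ennreal E"
        unfolding K_def using constants by (simp add: ennreal_mult E_def)
      ultimately show ?thesis
        using constants C3_pos by (simp add: divide_ennreal_def ennreal_mult mult_ac divide_inverse)
    qed
    also have "\<dots> = (\<integral>\<^sup>+z. ennreal K * ennreal (t powr (1 - \<alpha> / \<beta>) * C3) * indicator (closure A) z \<partial>\<nu>)"
      by (rule nn_integral_cmult_indicator[symmetric]) (simp add: sets_nu)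
    \<comment> \<open>Off the closure the left integrand is 0, so the pointwise estimate is needed
      only where \<open>near\<close> applies.\<close>
    also have "\<dots> \<le> (\<integral>\<^sup>+z. (\<integral>\<^sup>+s. ennreal (exp (- l * s)) * ennreal (b s z) * indicator {\<epsilon><..t} s \<partial>lborel) \<partial>\<nu>)"
    proof (intro nn_integral_mono)
      fix z
      show "ennreal K * ennreal (t powr (1 - \<alpha> / \<beta>) * C3) * indicator (closure A) z \<le>
          (\<integral>\<^sup>+s. ennreal (exp (- l * s)) * ennreal (b s z) * indicator {\<epsilon><..t} s \<partial>lborel)"
      proof (cases "z \<in> closure A")
        case True
        have "ennreal K * ennreal (t powr (1 - \<alpha> / \<beta>) * C3) \<le>
            ennreal K * (\<integral>\<^sup>+s. ennreal (s powr (- (\<alpha> / \<beta>))) * indicator {\<epsilon><..t} s \<partial>lborel)"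
          using J by (rule mult_left_mono) simp
        also have "\<dots> = (\<integral>\<^sup>+s. ennreal K * (ennreal (s powr (- (\<alpha> / \<beta>))) * indicator {\<epsilon><..t} s) \<partial>lborel)"
          by (rule nn_integral_cmult[symmetric]) measurable
        also have "\<dots> \<le> (\<integral>\<^sup>+s. ennreal (exp (- l * s)) * ennreal (b s z) * indicator {\<epsilon><..t} s \<partial>lborel)"
        proof (intro nn_integral_mono)
          fix s
          show "ennreal K * (ennreal (s powr (- (\<alpha> / \<beta>))) * indicator {\<epsilon><..t} s) \<le>
              ennreal (exp (- l * s)) * ennreal (b s z) * indicator {\<epsilon><..t} s"
            using integrand[OF _ True, of s] by (cases "s \<in> {\<epsilon><..t}") auto
        qed
        finally show ?thesis using True by simp
      qed simp
    qed
    also have "\<dots> \<le> emeasure (completion (P x)) {\<omega>. hitting_time X A \<omega> \<le> ennreal t}"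
    proof (rule D.hitting_probability_lower_bound[OF _ l0 _ _ _ _ \<epsilon> t(2)])
      show "nearly_borel X P A" unfolding A_def by (rule nearly_borel_near_part[OF B(1)])
      show "equilibrium_measure X P p l A \<nu>" unfolding A_def by (rule nu)
      show "ennreal (b s y) \<le> p s x y" if "0 < s" "s \<le> T" for s y
        using lower_bound that unfolding b_def by auto
      show "0 < b s y" if "0 < s" for s y unfolding b_def using that constants by simp
      show "isCont (\<lambda>(s, y). b s y) (s, y)" if "0 < s" for s y
        unfolding b_def using that constants by (intro isCont_sub_gaussian) auto
    qed
    finally show ?thesis using False by simp
  qed simp
  \<comment> \<open>The estimate was made for the near part; the larger set \<open>B\<close> is hit
    no later.\<close>
  also have "\<dots> \<le> emeasure (completion (P x)) {\<omega>. hitting_time X B \<omega> \<le> ennreal t}"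
  proof (rule emeasure_mono)
    have "A \<subseteq> B" unfolding A_def near_part_def by blast
    then have "hitting_time X B \<omega> \<le> hitting_time X A \<omega>" for \<omega>
      unfolding hitting_time_def by (intro Inf_superset_mono image_mono) blast
    then show "{\<omega>. hitting_time X A \<omega> \<le> ennreal t} \<subseteq> {\<omega>. hitting_time X B \<omega> \<le> ennreal t}"
      using order_trans by blast
    show "{\<omega>. hitting_time X B \<omega> \<le> ennreal t} \<in> sets (completion (P x))"
      using borel_measurable_le[OF X.hitting_time_measurable[OF B(1)] borel_measurable_const, of x "ennreal t"]
      by simp
  qed
  finally show "emeasure \<nu> (closure (near_part X P B x \<delta>)) / ennreal (exp (l * T)) *
       ennreal (C1 * C3 / t powr ((\<alpha> - \<beta>) / \<beta>)) *
       (if essential_distance X P x B = \<infinity> then 0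
        else ennreal (exp (- (1 + \<rho>) * C2 *
               ((enn2real (essential_distance X P x B) + \<delta>) / t powr (1 / \<beta>))
                 powr (\<beta> / (\<beta> - 1)))))
     \<le> emeasure (completion (P x)) {\<omega>. hitting_time X B \<omega> \<le> ennreal t}"
    unfolding A_def d_def E_def .
qed

end
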